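(* Let $\varphi\in\mathrm{Lip}(\Omega)$ and let $\mu_B$, $B\in\mathcal{N}(\Omega)$, be the unique probability maximizing $P(\varphi)=\sup_{\mu}\{h(\mu)+\int_\Omega\varphi\,d\mu\}$ over $T$-invariant Borel probabilities. Let $f\in\mathcal{N}(\Omega)$ with $\mu_f\neq\mu_B$, and let $g\in\mathrm{Lip}(\Omega)$ satisfy $\int_\Omega g\,d\mu_f=0$ ($g$ is not assumed to lie in $\mathrm{Ker}(\mathcal{L}_f)$). Suppose $$f=\zeta+(u-u\circ T)+c,\qquad g=\eta+(v-v\circ T),\qquad \varphi=\xi+(w-w\circ T)+k,$$ with $\zeta,\eta,\xi\in\mathrm{Ker}(\mathcal{L}_f)$, $u,v,w\in\mathrm{Lip}(\Omega)$ and $c,k\in\mathbb{R}$. Then $$\frac{d}{dt}\Bigl(h(\mu_{f+tg})+\int_\Omega\varphi\,d\mu_{f+tg}\Bigr)\Big|_{t=0}=\int_\Omega(\xi-\zeta)\,\eta\,d\mu_f.$$ Consequently, if this directional derivative vanishes for all directions $\eta\in\mathrm{Ker}(\mathcal{L}_f)$ (i.e. with $g=\eta$), then it vanishes for all directions $g\in\mathrm{Lip}(\Omega)$ with $\int_\Omega g\,d\mu_f=0$.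
   Context: Let $(M,d_M)$ be a compact metric space with $\mathrm{diam}(M)=1$, $\Omega:=M^{\mathbb{N}}$ with metric $d(x,y)=\sum_{n\ge1}2^{-n}d_M(x_n,y_n)$, and $T:\Omega\to\Omega$ the shift. $\mathrm{Lip}(\Omega)$ is the space of real Lipschitz functions on $\Omega$. Fix a Borel probability $\nu$ on $M$ with support $M$. For $f\in\mathrm{Lip}(\Omega)$ the Ruelle operator on $\mathrm{Lip}(\Omega)$ is $\mathcal{L}_f(w)(x)=\int_M e^{f(ax)}w(ax)\,d\nu(a)$, where $ax=(a,x_1,x_2,\dots)$, and $\mathrm{Ker}(\mathcal{L}_f)=\{w\in\mathrm{Lip}(\Omega):\mathcal{L}_f w=0\}$. By the Ruelle-Perron-Frobenius (RPF) theorem there are $\lambda_f>0$, a strictly positive $w_f\in\mathrm{Lip}(\Omega)$ and a Borel probability $\rho_f$ with $\mathcal{L}_f w_f=\lambda_f w_f$, $\mathcal{L}_f^*\rho_f=\lambda_f\rho_f$, $\int w_f\,d\rho_f=1$. $\mathcal{N}(\Omega)$ is the set of normalized potentials, i.e. $f\in\mathrm{Lip}(\Omega)$ with $\mathcal{L}_f1=1$; for $f\in\mathrm{Lip}(\Omega)$, $N(f)=f+\log w_f-\log(w_f\circ T)-\log\lambda_f\in\mathcal{N}(\Omega)$. The Lipschitz-Gibbs probability $\mu_f$ is the unique Borel probability with $\mathcal{L}_{N(f)}^*\mu_f=\mu_f$; it is $T$-invariant. Its entropy is $h(\mu_f)=-\int_\Omega N(f)\,d\mu_f$. The unique maximizer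 $\mu_B$ of the variational problem $P(\varphi)$ (the equilibrium probability of $\varphi$) is a Lipschitz-Gibbs probability whose normalized potential $B$ is cohomologous to $\varphi$ up to a constant, that is $B=N(\varphi)$ and $\mu_B=\mu_\varphi$. One has the direct sum decomposition $\mathrm{Lip}(\Omega)=\mathrm{Ker}(\mathcal{L}_f)\oplus\{w-w\circ T+c: w\in\mathrm{Lip}(\Omega),c\in\mathbb{R}\}$ for $f\in\mathcal{N}(\Omega)$. *)

theory Defs
  imports "HOL-Probability.Probability"
begin

section \<open>The symbolic space\<close>

text \<open>
  The alphabet is a type \<open>'a::metric_space\<close> (to be assumed compact of diameter 1), and a point of
  the symbolic space is a function \<open>x :: nat \<Rightarrow> 'a\<close>; coordinates are numbered from 0, so
  that \<open>x n\<close> has weight \<open>(1/2) ^ Suc n\<close>. The \<open>dist\<close> that the library puts on \<open>nat \<Rightarrow> 'a\<close> is a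
  different metric, with different Lipschitz functions, and is not used. The library topology on
  \<open>nat \<Rightarrow> 'a\<close> is the product topology; it is the one induced by \<open>seq_dist\<close>
  (\<open>mtopology_seq_dist\<close> below), so \<open>borel\<close> is the intended sigma-algebra.
\<close>

definition seq_dist :: "(nat \<Rightarrow> 'a::metric_space) \<Rightarrow> (nat \<Rightarrow> 'a) \<Rightarrow> real" where
  "seq_dist x y = (\<Sum>n. (1/2) ^ Suc n * dist (x n) (y n))"

definition shift_map :: "(nat \<Rightarrow> 'a) \<Rightarrow> nat \<Rightarrow> 'a" where
  "shift_map x = (\<lambda>n. x (Suc n))"

definition Lip :: "((nat \<Rightarrow> 'a::metric_space) \<Rightarrow> real) set" where
  "Lip = {w. \<exists>L. \<forall>x y. \<bar>w x - w y\<bar> \<le> L * seq_dist x y}"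

definition measure_support :: "'a::topological_space measure \<Rightarrow> 'a set" where
  "measure_support \<nu> = {x. \<forall>U. open U \<longrightarrow> x \<in> U \<longrightarrow> emeasure \<nu> U > 0}"

definition borel_prob :: "'a::topological_space measure \<Rightarrow> bool" where
  "borel_prob \<mu> \<longleftrightarrow> prob_space \<mu> \<and> sets \<mu> = sets borel"

definition invariant_probs :: "(nat \<Rightarrow> 'a::metric_space) measure set" where
  "invariant_probs = {\<mu>. borel_prob \<mu> \<and> distr \<mu> borel shift_map = \<mu>}"


section \<open>Ruelle operator and Gibbs probabilities\<close>

text \<open>The sequence \<open>case_nat a x\<close> is \<open>(a, x 0, x 1, \<dots>)\<close>.\<close>

definition ruelle :: "'a measure \<Rightarrow> ((nat \<Rightarrow> 'a) \<Rightarrow> real) \<Rightarrow> ((nat \<Rightarrow> 'a) \<Rightarrow> real) \<Rightarrow> (nat \<Rightarrow> 'a) \<Rightarrow> real" where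
  "ruelle \<nu> f w x = (\<integral>a. exp (f (case_nat a x)) * w (case_nat a x) \<partial>\<nu>)"

definition ruelle_ker :: "'a::metric_space measure \<Rightarrow> ((nat \<Rightarrow> 'a) \<Rightarrow> real) \<Rightarrow> ((nat \<Rightarrow> 'a) \<Rightarrow> real) set" where
  "ruelle_ker \<nu> f = {w \<in> Lip. ruelle \<nu> f w = (\<lambda>_. 0)}"

text \<open>\<open>ruelle_dual_eigen \<nu> f l \<mu>\<close> says that the dual of the Ruelle operator maps \<open>\<mu>\<close> to \<open>l * \<mu>\<close>.\<close>

definition ruelle_dual_eigen ::
    "'a::metric_space measure \<Rightarrow> ((nat \<Rightarrow> 'a) \<Rightarrow> real) \<Rightarrow> real \<Rightarrow> (nat \<Rightarrow> 'a) measure \<Rightarrow> bool" where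
  "ruelle_dual_eigen \<nu> f l \<mu> \<longleftrightarrow> (\<forall>w\<in>Lip. (\<integral>x. ruelle \<nu> f w x \<partial>\<mu>) = l * (\<integral>x. w x \<partial>\<mu>))"

definition normalized :: "'a::metric_space measure \<Rightarrow> ((nat \<Rightarrow> 'a) \<Rightarrow> real) set" where
  "normalized \<nu> = {f \<in> Lip. ruelle \<nu> f (\<lambda>_. 1) = (\<lambda>_. 1)}"

definition is_rpf ::
    "'a::metric_space measure \<Rightarrow> ((nat \<Rightarrow> 'a) \<Rightarrow> real) \<Rightarrow>
      real \<times> ((nat \<Rightarrow> 'a) \<Rightarrow> real) \<times> (nat \<Rightarrow> 'a) measure \<Rightarrow> bool" where
  "is_rpf \<nu> f = (\<lambda>(l, w, \<rho>).
     l > 0 \<and> w \<in> Lip \<and> (\<forall>x. w x > 0) \<and> borel_prob \<rho> \<and>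
     ruelle \<nu> f w = (\<lambda>x. l * w x) \<and> ruelle_dual_eigen \<nu> f l \<rho> \<and> (\<integral>x. w x \<partial>\<rho>) = 1)"

text \<open>
  For \<open>f \<in> Lip\<close> the Ruelle-Perron-Frobenius theorem says that exactly one triple satisfies
  \<open>is_rpf \<nu> f\<close>, and that the probability in the definition of \<open>gibbs\<close> exists and is unique.
\<close>

definition rpf :: "'a::metric_space measure \<Rightarrow> ((nat \<Rightarrow> 'a) \<Rightarrow> real) \<Rightarrow>
      real \<times> ((nat \<Rightarrow> 'a) \<Rightarrow> real) \<times> (nat \<Rightarrow> 'a) measure" where
  "rpf \<nu> f = (SOME t. is_rpf \<nu> f t)"

definition normalization ::
    "'a::metric_space measure \<Rightarrow> ((nat \<Rightarrow> 'a) \<Rightarrow> real) \<Rightarrow> (nat \<Rightarrow> 'a) \<Rightarrow> real" where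
  "normalization \<nu> f = (case rpf \<nu> f of (l, w, \<rho>) \<Rightarrow>
     (\<lambda>x. f x + ln (w x) - ln (w (shift_map x)) - ln l))"

definition gibbs ::
    "'a::metric_space measure \<Rightarrow> ((nat \<Rightarrow> 'a) \<Rightarrow> real) \<Rightarrow> (nat \<Rightarrow> 'a) measure" where
  "gibbs \<nu> f = (THE \<mu>. borel_prob \<mu> \<and> ruelle_dual_eigen \<nu> (normalization \<nu> f) 1 \<mu>)"


section \<open>Entropy and pressure\<close>

definition gibbs_entropy :: "'a::metric_space measure \<Rightarrow> ((nat \<Rightarrow> 'a) \<Rightarrow> real) \<Rightarrow> real" where
  "gibbs_entropy \<nu> f = - (\<integral>x. normalization \<nu> f x \<partial>gibbs \<nu> f)"

text \<open>
  The entropy of an arbitrary invariant probability, relative to the a priori probability \<open>\<nu>\<close>. It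
  is at most 0 and may be \<open>-\<infinity>\<close>. The lemma \<open>apriori_entropy_of_gibbs\<close> below shows that it extends the
  entropy of Gibbs probabilities.
\<close>

definition apriori_entropy :: "'a::metric_space measure \<Rightarrow> (nat \<Rightarrow> 'a) measure \<Rightarrow> ereal" where
  "apriori_entropy \<nu> \<mu> = (INF f\<in>normalized \<nu>. ereal (- (\<integral>x. f x \<partial>\<mu>)))"

definition pressure :: "'a::metric_space measure \<Rightarrow> ((nat \<Rightarrow> 'a) \<Rightarrow> real) \<Rightarrow> ereal" where
  "pressure \<nu> \<phi> = (SUP \<mu>\<in>invariant_probs. apriori_entropy \<nu> \<mu> + ereal (\<integral>x. \<phi> x \<partial>\<mu>))"

definition equilibrium ::
    "'a::metric_space measure \<Rightarrow> ((nat \<Rightarrow> 'a) \<Rightarrow> real) \<Rightarrow> (nat \<Rightarrow> 'a) measure \<Rightarrow> bool" where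
  "equilibrium \<nu> \<phi> \<mu> \<longleftrightarrow>
     \<mu> \<in> invariant_probs \<and> apriori_entropy \<nu> \<mu> + ereal (\<integral>x. \<phi> x \<partial>\<mu>) = pressure \<nu> \<phi>"


section \<open>Consistency of the definitions\<close>

context
  assumes dist_le_1: "\<And>a b::'a::metric_space. dist a b \<le> 1"
begin

lemma summable_seq_dist: "summable (\<lambda>n. (1/2) ^ Suc n * dist (x n) (y n :: 'a))"
proof (rule summable_comparison_test')
  show "summable (\<lambda>n. (1/2::real) ^ Suc n)"
    by (simp add: summable_geometric)
  show "norm ((1/2) ^ Suc n * dist (x n) (y n)) \<le> (1/2) ^ Suc n" for n
    using mult_left_mono[OF dist_le_1[of "x n" "y n"], of "(1/2) ^ Suc n"] by simp
qed

lemma seq_dist_le_1: "seq_dist x (y :: nat \<Rightarrow> 'a) \<le> 1"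
proof -
  have "seq_dist x y \<le> (\<Sum>n. (1/2::real) ^ Suc n)"
    unfolding seq_dist_def
  proof (rule suminf_le[OF _ summable_seq_dist])
    show "(1/2) ^ Suc n * dist (x n) (y n) \<le> (1/2) ^ Suc n" for n
      using mult_left_mono[OF dist_le_1[of "x n" "y n"], of "(1/2) ^ Suc n"] by simp
  qed (simp add: summable_geometric)
  also have "\<dots> = 1"
    using power_half_series by (simp add: sums_iff)
  finally show ?thesis .
qed

lemma seq_dist_nth: "(1/2) ^ Suc n * dist (x n) (y n) \<le> seq_dist x (y :: nat \<Rightarrow> 'a)"
  unfolding seq_dist_def
  using sum_le_suminf[OF summable_seq_dist, of "{n}" x y] by simp

lemma Metric_space_seq_dist: "Metric_space UNIV (seq_dist :: (nat \<Rightarrow> 'a) \<Rightarrow> _)"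
proof
  fix x y z :: "nat \<Rightarrow> 'a"
  show nn: "0 \<le> seq_dist x y"
    unfolding seq_dist_def by (rule suminf_nonneg[OF summable_seq_dist]) simp
  show "seq_dist x y = seq_dist y x"
    by (simp add: seq_dist_def dist_commute)
  show "(seq_dist x y = 0) = (x = y)"
  proof
    assume "seq_dist x y = 0"
    then have "(1/2) ^ Suc n * dist (x n) (y n) \<le> 0" for n
      using seq_dist_nth[of n x y] by simp
    then show "x = y"
      by (intro ext) (simp add: mult_le_0_iff power_le_zero_eq)
  qed (simp add: seq_dist_def)
  have "seq_dist x z \<le> (\<Sum>n. (1/2) ^ Suc n * dist (x n) (y n) + (1/2) ^ Suc n * dist (y n) (z n))"
    unfolding seq_dist_def
  proof (rule suminf_le[OF _ summable_seq_dist])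
    show "(1/2) ^ Suc n * dist (x n) (z n)
        \<le> (1/2) ^ Suc n * dist (x n) (y n) + (1/2) ^ Suc n * dist (y n) (z n)" for n
      using mult_left_mono[OF dist_triangle[of "x n" "z n" "y n"], of "(1/2) ^ Suc n"]
      by (simp add: distrib_left)
  qed (intro summable_add summable_seq_dist)
  also have "\<dots> = seq_dist x y + seq_dist y z"
    unfolding seq_dist_def by (rule suminf_add[symmetric]; rule summable_seq_dist)
  finally show "seq_dist x z \<le> seq_dist x y + seq_dist y z" .
qed

lemma continuous_seq_dist: "continuous_on UNIV (\<lambda>y. seq_dist x (y :: nat \<Rightarrow> 'a))"
proof -
  have "uniform_limit UNIV (\<lambda>N y. \<Sum>n<N. (1/2) ^ Suc n * dist (x n) (y n :: 'a))
          (\<lambda>y. \<Sum>n. (1/2) ^ Suc n * dist (x n) (y n)) sequentially"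
  proof (rule Weierstrass_m_test)
    show "norm ((1/2) ^ Suc n * dist (x n) (y n :: 'a)) \<le> (1/2) ^ Suc n" for n y
      using mult_left_mono[OF dist_le_1[of "x n" "y n"], of "(1/2) ^ Suc n"] by simp
  qed (simp add: summable_geometric)
  then show ?thesis
    unfolding seq_dist_def
    by (rule uniform_limit_theorem[rotated])
       (auto intro!: always_eventually continuous_intros
          continuous_on_product_then_coordinatewise[OF continuous_on_id])
qed

lemma mtopology_seq_dist:
  "Metric_space.mtopology UNIV (seq_dist :: (nat \<Rightarrow> 'a) \<Rightarrow> _) = euclidean"
proof -
  interpret Metric_space UNIV "seq_dist :: (nat \<Rightarrow> 'a) \<Rightarrow> _"
    by (rule Metric_space_seq_dist)
  have "openin mtopology U \<longleftrightarrow> open U" for U :: "(nat \<Rightarrow> 'a) set"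
  proof
    assume U: "openin mtopology U"
    show "open U"
    proof (subst open_subopen, intro ballI)
      fix x assume "x \<in> U"
      then obtain r where r: "r > 0" "mball x r \<subseteq> U"
        using U unfolding openin_mtopology by blast
      have "open {y. seq_dist x y < r}"
        by (intro open_Collect_less continuous_seq_dist continuous_on_const)
      moreover have "x \<in> {y. seq_dist x y < r}"
        using r by simp
      moreover have "{y. seq_dist x y < r} \<subseteq> U"
        using r by (auto simp: mball_def)
      ultimately show "\<exists>T. open T \<and> x \<in> T \<and> T \<subseteq> U" by blast
    qed
  next
    assume U: "open U"
    have "continuous_map mtopology (euclidean :: 'a topology) (\<lambda>x. x k)" for k
    proof (subst continuous_map_def, safe)
      fix V :: "'a set" assume "openin euclidean V"
      then have V: "open V" by simp
      show "openin mtopology {x \<in> topspace mtopology. x k \<in> V}"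
        unfolding openin_mtopology
      proof (safe; simp)
        fix x :: "nat \<Rightarrow> 'a" assume "x k \<in> V"
        then obtain e where e: "e > 0" "\<And>b. dist (x k) b < e \<Longrightarrow> b \<in> V"
          using V by (auto simp: open_dist dist_commute)
        have "mball x ((1/2) ^ Suc k * e) \<subseteq> {x. x k \<in> V}"
        proof (clarsimp simp: mball_def simp del: power_Suc)
          fix y assume "seq_dist x y < (1/2) ^ Suc k * e"
          then have "(1/2) ^ Suc k * dist (x k) (y k) < (1/2) ^ Suc k * e"
            using seq_dist_nth[of k x y] by linarith
          then show "y k \<in> V"
            by (intro e(2)) (simp del: power_Suc)
        qed
        then show "\<exists>r>0. mball x r \<subseteq> {x. x k \<in> V}"
          using e(1) by (intro exI[of _ "(1/2) ^ Suc k * e"]) simp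
      qed
    qed auto
    then have "continuous_map mtopology (euclidean :: (nat \<Rightarrow> 'a) topology) (\<lambda>x. x)"
      unfolding euclidean_product_topology[symmetric] continuous_map_componentwise_UNIV by blast
    from openin_continuous_map_preimage[OF this, of U] U show "openin mtopology U"
      by simp
  qed
  then show ?thesis
    by (simp add: topology_eq)
qed

lemma Lip_continuous: 
  assumes "w \<in> (Lip :: ((nat \<Rightarrow> 'a) \<Rightarrow> real) set)"
  shows "continuous_on UNIV w"
proof -
  from assms obtain L where L: "\<And>x y. \<bar>w x - w y\<bar> \<le> L * seq_dist x y"
    by (auto simp: Lip_def)
  interpret Metric_space UNIV "seq_dist :: (nat \<Rightarrow> 'a) \<Rightarrow> _"
    by (rule Metric_space_seq_dist)
  have "(w \<longlongrightarrow> w x) (at x)" for x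
  proof -
    have "((\<lambda>y. seq_dist x y) \<longlongrightarrow> seq_dist x x) (at x)"
      using continuous_seq_dist[of x] unfolding continuous_on_def by blast
    then have "((\<lambda>y. L * seq_dist x y) \<longlongrightarrow> L * seq_dist x x) (at x)"
      by (intro tendsto_mult_left)
    then have "((\<lambda>y. L * seq_dist x y) \<longlongrightarrow> 0) (at x)"
      by simp
    then have "((\<lambda>y. w y - w x) \<longlongrightarrow> 0) (at x)"
      by (rule Lim_null_comparison[rotated])
         (use L[of x] in \<open>auto intro!: always_eventually simp: abs_minus_commute\<close>)
    then show ?thesis
      by (simp add: LIM_zero_iff)
  qed
  then show ?thesis
    by (auto simp: continuous_on_def)
qed

lemma Lip_bounded:
  assumes "w \<in> (Lip :: ((nat \<Rightarrow> 'a) \<Rightarrow> real) set)"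
  obtains C where "\<And>x. \<bar>w x\<bar> \<le> C"
proof -
  from assms obtain L where L: "\<And>x y. \<bar>w x - w y\<bar> \<le> L * seq_dist x y"
    by (auto simp: Lip_def)
  interpret Metric_space UNIV "seq_dist :: (nat \<Rightarrow> 'a) \<Rightarrow> _"
    by (rule Metric_space_seq_dist)
  have "\<bar>w x\<bar> \<le> \<bar>w (\<lambda>_. undefined)\<bar> + \<bar>L\<bar>" for x
  proof -
    have "L * seq_dist x (\<lambda>_. undefined) \<le> \<bar>L\<bar> * 1"
      using seq_dist_le_1 by (intro mult_mono) auto
    with L[of x "\<lambda>_. undefined"] show ?thesis by simp
  qed
  then show thesis by (rule that)
qed

lemma Lip_integrable:
  assumes "borel_prob \<mu>" "w \<in> (Lip :: ((nat \<Rightarrow> 'a) \<Rightarrow> real) set)"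
  shows "integrable \<mu> w"
proof -
  interpret prob_space \<mu> using assms by (simp add: borel_prob_def)
  obtain C where "\<And>x. \<bar>w x\<bar> \<le> C" using Lip_bounded[OF assms(2)] by blast
  moreover have "w \<in> borel_measurable \<mu>"
    using borel_measurable_continuous_onI[OF Lip_continuous[OF assms(2)]] assms(1)
    by (simp add: borel_prob_def cong: measurable_cong_sets)
  ultimately show ?thesis
    by (intro integrable_const_bound[of _ C]) auto
qed

lemma Lip_diff:
  assumes "w \<in> (Lip :: ((nat \<Rightarrow> 'a) \<Rightarrow> real) set)" "v \<in> Lip"
  shows "(\<lambda>x. w x - v x) \<in> Lip"
proof -
  from assms obtain K L where KL: "\<And>x y. \<bar>w x - w y\<bar> \<le> K * seq_dist x y"
     "\<And>x y. \<bar>v x - v y\<bar> \<le> L * seq_dist x y"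
    by (auto simp: Lip_def)
  have "\<bar>(w x - v x) - (w y - v y)\<bar> \<le> (K + L) * seq_dist x y" for x y
    using KL[of x y] by (simp add: distrib_right)
  then show ?thesis unfolding Lip_def by blast
qed

lemma Lip_exp:
  assumes "w \<in> (Lip :: ((nat \<Rightarrow> 'a) \<Rightarrow> real) set)"
  shows "(\<lambda>x. exp (w x)) \<in> Lip"
proof -
  from assms obtain L where L: "\<And>x y. \<bar>w x - w y\<bar> \<le> L * seq_dist x y"
    by (auto simp: Lip_def)
  obtain C where C: "\<And>x. \<bar>w x\<bar> \<le> C" using Lip_bounded[OF assms] by blast
  have one: "exp s - exp t \<le> exp C * \<bar>s - t\<bar>" if "s \<le> C" for s t :: real
  proof -
    have "1 - exp (t - s) \<le> \<bar>s - t\<bar>"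
      using exp_ge_add_one_self[of "t - s"] by linarith
    then have "exp s * (1 - exp (t - s)) \<le> exp s * \<bar>s - t\<bar>"
      by (rule mult_left_mono) simp
    also have "\<dots> \<le> exp C * \<bar>s - t\<bar>"
      using that by (intro mult_right_mono) auto
    finally show ?thesis
      by (simp add: right_diff_distrib flip: exp_add)
  qed
  have "\<bar>exp (w x) - exp (w y)\<bar> \<le> (exp C * L) * seq_dist x y" for x y
  proof -
    have "\<bar>exp (w x) - exp (w y)\<bar> \<le> exp C * \<bar>w x - w y\<bar>"
      using one[of "w x" "w y"] one[of "w y" "w x"] C[of x] C[of y]
      by (auto simp: abs_le_iff abs_minus_commute)
    also have "\<dots> \<le> exp C * (L * seq_dist x y)"
      using L by (intro mult_left_mono) auto
    finally show ?thesis by simp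
  qed
  then show ?thesis unfolding Lip_def by blast
qed

lemma apriori_entropy_of_gibbs:
  fixes \<nu> :: "'a measure"
  assumes B: "B \<in> normalized \<nu>" and \<mu>: "borel_prob \<mu>" "ruelle_dual_eigen \<nu> B 1 \<mu>"
  shows "apriori_entropy \<nu> \<mu> = ereal (- (\<integral>x. B x \<partial>\<mu>))"
proof -
  interpret prob_space \<mu> using \<mu> by (simp add: borel_prob_def)
  have "(\<integral>x. g x \<partial>\<mu>) \<le> (\<integral>x. B x \<partial>\<mu>)" if g: "g \<in> normalized \<nu>" for g
  proof -
    have Lip: "g \<in> Lip" "B \<in> Lip" using g B by (auto simp: normalized_def)
    then have E: "(\<lambda>x. exp (g x - B x)) \<in> Lip"
      by (intro Lip_exp Lip_diff)
    have "ruelle \<nu> B (\<lambda>x. exp (g x - B x)) = ruelle \<nu> g (\<lambda>_. 1)"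
      by (simp add: ruelle_def fun_eq_iff flip: exp_add)
    also have "\<dots> = (\<lambda>_. 1)" using g by (simp add: normalized_def)
    finally have "(\<integral>x. exp (g x - B x) \<partial>\<mu>) = 1"
      using bspec[OF \<mu>(2)[unfolded ruelle_dual_eigen_def] E] by (simp add: prob_space)
    moreover have "(\<integral>x. g x - B x \<partial>\<mu>) \<le> (\<integral>x. exp (g x - B x) - 1 \<partial>\<mu>)"
    proof (rule integral_mono)
      show "g x - B x \<le> exp (g x - B x) - 1" for x
        using exp_ge_add_one_self[of "g x - B x"] by linarith
    qed (use Lip E \<mu>(1) in \<open>auto intro!: Lip_integrable Bochner_Integration.integrable_diff\<close>)
    ultimately show ?thesis
      using Lip_integrable[OF \<mu>(1)] Lip E by (simp add: prob_space)
  qed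
  then show ?thesis
    unfolding apriori_entropy_def using B by (intro antisym INF_lower INF_greatest) auto
qed

end

end

theory Submission
  imports Defs
begin

text \<open>
  For a normalized potential with Lipschitz constant \<open>F\<close>, both the Ruelle operator \<open>L\<close> and its logarithmic
  version \<open>q \<mapsto> ln (L (exp q))\<close> contract the modulus of continuity \<open>1 - exp (- 3 F d)\<close> by a factor that
  depends only on \<open>F\<close>. This gives the eigenfunctions of every Lipschitz potential, the decomposition of
  \<open>Lip\<close>, and the convergence of \<open>L\<^sup>n w\<close> to a constant, from which the Gibbs probability is built coordinate
  by coordinate by the Ionescu-Tulcea theorem.

  Up to coboundaries \<open>f + t g\<close> is \<open>f + t \<eta>\<close>. As \<open>L\<^sub>f \<eta> = 0\<close>, the same contraction shows that its normalization
  \<open>N\<^sub>t\<close> is \<open>f + t \<eta> + O(t\<^sup>2)\<close> uniformly. For \<open>\<psi>\<close> in the kernel of \<open>L\<^sub>f\<close>, integrating \<open>L\<close> for \<open>N\<^sub>t\<close> against its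
  Gibbs probability \<open>\<mu>\<^sub>t\<close> gives \<open>\<integral>\<psi> d\<mu>\<^sub>t = t \<integral>L\<^sub>f (\<eta> \<psi>) d\<mu>\<^sub>t + O(t\<^sup>2) = t \<integral>\<eta> \<psi> d\<mu>\<^sub>f + O(t\<^sup>2)\<close>. Since the entropy
  is \<open>- \<integral>N\<^sub>t d\<mu>\<^sub>t\<close>, the functional equals \<open>\<integral>(\<xi> - \<zeta>) d\<mu>\<^sub>t - t \<integral>\<eta> d\<mu>\<^sub>t\<close> up to a constant and \<open>O(t\<^sup>2)\<close>.
\<close>

section \<open>Lipschitz functions on the symbolic space\<close>

text \<open>\<open>rpf\<close> and \<open>gibbs\<close> are picked by choice operators, so nothing
  can be computed about them before existence and uniqueness are known; this is why the
  Ruelle-Perron-Frobenius theory is developed here, with explicit constants. A Lipschitz constant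
  need not shrink under a normalized operator, because the weights also vary with the base point. A
  bounded modulus does shrink: on the part of the mass that two base points do not share, the
  oscillation is an adequate bound, and the modulus controls it. In logarithmic form an
  eigenfunction is a fixed point modulo constants, and the operator commutes with adding constants.
  Existence and uniqueness then come from one contraction estimate. The eigendata are never
  differentiated in t. It suffices that the second-order error is uniform in the point and that all
  constants are the same for every |t| \<le> 1; the explicit dependence of the entropy on t is
  harmless because \<eta> has integral O(t) under the perturbed probability.\<close>

definition lip_le :: "real \<Rightarrow> ((nat \<Rightarrow> 'a::metric_space) \<Rightarrow> real) \<Rightarrow> bool" where
  "lip_le L w \<longleftrightarrow> (\<forall>x y. w x - w y \<le> L * seq_dist x y)"

lemma lip_leD: "lip_le L w \<Longrightarrow> w x - w y \<le> L * seq_dist x y"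
  by (simp add: lip_le_def)

lemma seq_dist_commute: "seq_dist x y = seq_dist y x"
  by (simp add: seq_dist_def dist_commute)

lemma seq_dist_refl [simp]: "seq_dist x x = 0"
  by (simp add: seq_dist_def)

text \<open>\<open>lip_le\<close> stores only one side; both orders of the arguments are quantified
  and \<open>seq_dist\<close> is symmetric, so the two-sided bound follows. The one-sided form keeps
  integral and logarithm estimates free of absolute values.\<close>

lemma lip_leD_abs: "lip_le L w \<Longrightarrow> \<bar>w x - w y\<bar> \<le> L * seq_dist x y"
  using lip_leD[of L w x y] lip_leD[of L w y x] by (simp add: seq_dist_commute abs_le_iff)

lemma lip_le_Lip: "lip_le L w \<Longrightarrow> w \<in> Lip"
  unfolding Lip_def using lip_leD_abs by blast

locale full_shift =
  fixes \<nu> :: "'a::metric_space measure"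
  assumes compact_alphabet: "compact (UNIV :: 'a set)"
    and dist_le_1: "\<And>a b :: 'a. dist a b \<le> 1"
    and nu: "borel_prob \<nu>"
begin

sublocale nu: prob_space \<nu>
  using nu by (simp add: borel_prob_def)

lemma sets_nu [measurable_cong, simp]: "sets \<nu> = sets borel"
  using nu by (simp add: borel_prob_def)

lemmas Lip_continuous = Defs.Lip_continuous[OF dist_le_1]
  and Lip_integrable = Defs.Lip_integrable[OF dist_le_1]
  and Lip_diff = Defs.Lip_diff[OF dist_le_1]
  and Lip_exp = Defs.Lip_exp[OF dist_le_1]
  and Lip_bounded = Defs.Lip_bounded[OF dist_le_1]
  and seq_dist_le_1 = Defs.seq_dist_le_1[OF dist_le_1]
  and seq_dist_nth = Defs.seq_dist_nth[OF dist_le_1]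
  and summable_seq_dist = Defs.summable_seq_dist[OF dist_le_1]

lemma seq_dist_nonneg [simp]: "0 \<le> seq_dist x (y :: nat \<Rightarrow> 'a)"
  using Metric_space.nonneg[OF Metric_space_seq_dist[OF dist_le_1]] .

lemma seq_dist_triangle: "seq_dist x z \<le> seq_dist x y + seq_dist y (z :: nat \<Rightarrow> 'a)"
  using Metric_space.triangle[OF Metric_space_seq_dist[OF dist_le_1]] by simp

text \<open>The weights halve from one coordinate to the next, so prepending a common symbol halves
  a distance and the shift at most doubles it. The contraction of the Ruelle operator rests on
  this.\<close>

lemma seq_dist_head:
  "seq_dist x y = dist (x 0) (y 0) / 2 + seq_dist (shift_map x) (shift_map (y :: nat \<Rightarrow> 'a)) / 2"
proof -
  have "seq_dist x y = (\<Sum>n. (1/2) ^ Suc (Suc n) * dist (x (Suc n)) (y (Suc n))) + dist (x 0) (y 0) / 2"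
    unfolding seq_dist_def using suminf_split_head[OF summable_seq_dist[of x y]] by simp
  also have "(\<Sum>n. (1/2) ^ Suc (Suc n) * dist (x (Suc n)) (y (Suc n)))
      = (\<Sum>n. (1/2) * ((1/2) ^ Suc n * dist (shift_map x n) (shift_map y n)))"
    by (simp add: shift_map_def mult_ac)
  also have "\<dots> = (1/2) * seq_dist (shift_map x) (shift_map y)"
    unfolding seq_dist_def by (rule suminf_mult[OF summable_seq_dist])
  finally show ?thesis by simp
qed

lemma shift_map_case_nat [simp]: "shift_map (case_nat a x) = x"
  by (simp add: shift_map_def)

lemma seq_dist_case_nat [simp]:
  "seq_dist (case_nat a x) (case_nat b (y :: nat \<Rightarrow> 'a)) = dist a b / 2 + seq_dist x y / 2"
  by (subst seq_dist_head) simp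

lemma seq_dist_shift_map: "seq_dist (shift_map x) (shift_map y) \<le> 2 * seq_dist x (y :: nat \<Rightarrow> 'a)"
  using seq_dist_head[of x y] by simp

lemma Lip_lip_le:
  assumes "w \<in> (Lip :: ((nat \<Rightarrow> 'a) \<Rightarrow> real) set)"
  obtains L where "L > 0" "lip_le L w"
proof -
  from assms obtain L where L: "\<bar>w x - w y\<bar> \<le> L * seq_dist x y" for x y
    by (auto simp: Lip_def)
  \<comment> \<open>Adding 1 makes the constant strictly positive even for constant functions, so
    that it can serve as the parameter of \<open>gap\<close>.\<close>
  have "w x - w y \<le> (\<bar>L\<bar> + 1) * seq_dist x y" for x y
    using L[of x y] mult_right_mono[of L "\<bar>L\<bar> + 1" "seq_dist x y"]
      seq_dist_nonneg[of x y] abs_ge_self[of L] by linarith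
  then show thesis
    by (intro that[of "\<bar>L\<bar> + 1"]) (auto simp: lip_le_def)
qed

lemma lip_le_mono: "lip_le L w \<Longrightarrow> L \<le> M \<Longrightarrow> lip_le M (w :: (nat \<Rightarrow> 'a) \<Rightarrow> real)"
  unfolding lip_le_def
  by (meson mult_right_mono order_trans seq_dist_nonneg)

lemma lip_le_const: "0 \<le> L \<Longrightarrow> lip_le L (\<lambda>x :: nat \<Rightarrow> 'a. c)"
  by (simp add: lip_le_def)

lemma lip_le_add:
  "lip_le L w \<Longrightarrow> lip_le M v \<Longrightarrow> lip_le (L + M) (\<lambda>x. w x + v (x :: nat \<Rightarrow> 'a))"
  unfolding lip_le_def by (smt (verit) distrib_right)

lemma lip_le_diff:
  assumes "lip_le L w" "lip_le M v"
  shows "lip_le (L + M) (\<lambda>x. w x - v (x :: nat \<Rightarrow> 'a))"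
  unfolding lip_le_def
proof (intro allI)
  fix x y show "w x - v x - (w y - v y) \<le> (L + M) * seq_dist x y"
    using lip_leD[OF assms(1), of x y] lip_leD[OF assms(2), of y x]
    by (simp add: distrib_right seq_dist_commute)
qed

lemma lip_le_cmult:
  assumes "lip_le L w"
  shows "lip_le (\<bar>c\<bar> * L) (\<lambda>x. c * w (x :: nat \<Rightarrow> 'a))"
  unfolding lip_le_def
proof (intro allI)
  fix x y
  have "c * w x - c * w y \<le> \<bar>c\<bar> * \<bar>w x - w y\<bar>"
    by (metis abs_ge_self abs_mult right_diff_distrib)
  also have "\<dots> \<le> \<bar>c\<bar> * (L * seq_dist x y)"
    using lip_leD_abs[OF assms] by (intro mult_left_mono) auto
  finally show "c * w x - c * w y \<le> \<bar>c\<bar> * L * seq_dist x y" by simp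
qed

lemma lip_le_shift:
  assumes "lip_le L w" "0 \<le> L"
  shows "lip_le (2 * L) (\<lambda>x. w (shift_map (x :: nat \<Rightarrow> 'a)))"
  unfolding lip_le_def
proof (intro allI)
  fix x y :: "nat \<Rightarrow> 'a"
  show "w (shift_map x) - w (shift_map y) \<le> 2 * L * seq_dist x y"
    using lip_leD[OF assms(1), of "shift_map x" "shift_map y"]
      mult_left_mono[OF seq_dist_shift_map[of x y] assms(2)] by (simp add: mult_ac)
qed

lemma Lip_const: "(\<lambda>x :: nat \<Rightarrow> 'a. c) \<in> Lip"
  by (rule lip_le_Lip[OF lip_le_const[of 0]]) simp

lemma Lip_add: "w \<in> Lip \<Longrightarrow> v \<in> Lip \<Longrightarrow> (\<lambda>x. w x + v (x :: nat \<Rightarrow> 'a)) \<in> Lip"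
  by (elim Lip_lip_le) (blast intro: lip_le_Lip lip_le_add)

lemma Lip_cmult: "w \<in> Lip \<Longrightarrow> (\<lambda>x. c * w (x :: nat \<Rightarrow> 'a)) \<in> Lip"
  by (elim Lip_lip_le) (blast intro: lip_le_Lip lip_le_cmult)

lemma Lip_uminus: "w \<in> Lip \<Longrightarrow> (\<lambda>x. - w (x :: nat \<Rightarrow> 'a)) \<in> Lip"
  using Lip_cmult[of w "-1"] by simp

lemma Lip_shift: "w \<in> Lip \<Longrightarrow> (\<lambda>x. w (shift_map (x :: nat \<Rightarrow> 'a))) \<in> Lip"
  by (elim Lip_lip_le) (blast intro: lip_le_Lip lip_le_shift less_imp_le)

lemma Lip_mult:
  assumes "w \<in> Lip" "v \<in> Lip"
  shows "(\<lambda>x. w x * v (x :: nat \<Rightarrow> 'a)) \<in> Lip"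
proof -
  obtain L where L: "L > 0" "lip_le L w" using Lip_lip_le[OF assms(1)] .
  obtain M where M: "M > 0" "lip_le M v" using Lip_lip_le[OF assms(2)] .
  obtain C where C: "\<And>x. \<bar>w x\<bar> \<le> C" using Lip_bounded[OF assms(1)] by blast
  obtain D where D: "\<And>x. \<bar>v x\<bar> \<le> D" using Lip_bounded[OF assms(2)] by blast
  have "w x * v x - w y * v y \<le> (C * M + D * L) * seq_dist x y" for x y
  proof -
    have "w x * v x - w y * v y = w x * (v x - v y) + v y * (w x - w y)"
      by (simp add: algebra_simps)
    also have "\<dots> \<le> \<bar>w x\<bar> * \<bar>v x - v y\<bar> + \<bar>v y\<bar> * \<bar>w x - w y\<bar>"
      by (metis abs_ge_self abs_mult add_mono)
    also have "\<dots> \<le> C * (M * seq_dist x y) + D * (L * seq_dist x y)"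
      using C[of x] D[of y]
      by (intro add_mono mult_mono lip_leD_abs[OF L(2)] lip_leD_abs[OF M(2)]) auto
    finally show ?thesis by (simp add: algebra_simps)
  qed
  then show ?thesis
    by (intro lip_le_Lip[of "C * M + D * L"]) (simp add: lip_le_def)
qed

section \<open>Compactness and functions bounded away from zero\<close>

lemma compact_seqs: "compact (UNIV :: (nat \<Rightarrow> 'a) set)"
proof -
  have "compact_space (euclidean :: 'a topology)"
    using compact_alphabet by (simp add: compact_space_def)
  then have "compact_space (product_topology (\<lambda>_. euclidean :: 'a topology) (UNIV :: nat set))"
    by (simp add: compact_space_product_topology)
  then have "compact_space (euclidean :: (nat \<Rightarrow> 'a) topology)"
    by (simp add: euclidean_product_topology)
  then show ?thesis
    by (simp add: compact_space_def)
qed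

text \<open>The minimum is attained on the compact space, so pointwise positivity is uniform.
  Logarithms of eigenfunctions and strict positivity of \<open>ruelle\<close> depend on
  this.\<close>

lemma Lip_pos_bounded_below:
  assumes "w \<in> Lip" "\<And>x. w (x :: nat \<Rightarrow> 'a) > 0"
  obtains c where "c > 0" "\<And>x. c \<le> w x"
proof -
  obtain x where "\<forall>y\<in>UNIV. w x \<le> w y"
    using continuous_attains_inf[OF compact_seqs _ Lip_continuous[OF assms(1)]] by auto
  then show thesis
    using that[of "w x"] assms(2) by auto
qed

lemma Lip_ln:
  assumes "w \<in> Lip" "\<And>x. w (x :: nat \<Rightarrow> 'a) > 0"
  shows "(\<lambda>x. ln (w x)) \<in> Lip"
proof -
  obtain c where c: "c > 0" "\<And>x. c \<le> w x" using Lip_pos_bounded_below[OF assms] by blast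
  obtain L where L: "L > 0" "lip_le L w" using Lip_lip_le[OF assms(1)] .
  have "ln (w x) - ln (w y) \<le> (L / c) * seq_dist x y" for x y
  proof -
    have "ln (w x) - ln (w y) \<le> (w x - w y) / w y"
      by (intro ln_diff_le assms(2))
    also have "\<dots> \<le> (L * seq_dist x y) / w y"
      using assms(2)[of y] by (intro divide_right_mono lip_leD[OF L(2)]) simp
    also have "\<dots> \<le> (L * seq_dist x y) / c"
      using c(1) c(2)[of y] L(1) assms(2)[of y]
      by (intro divide_left_mono mult_nonneg_nonneg mult_pos_pos) auto
    finally show ?thesis by simp
  qed
  then show ?thesis
    by (intro lip_le_Lip[of "L / c"]) (simp add: lip_le_def)
qed


section \<open>The Ruelle operator on Lipschitz functions\<close>

lemma measurable_case_nat_fst: "(\<lambda>a. case_nat a x) \<in> borel \<rightarrow>\<^sub>M (borel :: (nat \<Rightarrow> 'a) measure)"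
proof (rule borel_measurable_continuous_onI)
  show "continuous_on UNIV (\<lambda>a. case_nat a x :: nat \<Rightarrow> 'a)"
  proof (rule continuous_on_coordinatewise_then_product)
    show "continuous_on UNIV (\<lambda>a. (case i of 0 \<Rightarrow> a | Suc n \<Rightarrow> x n) :: 'a)" for i
      by (cases i) (auto intro: continuous_intros)
  qed
qed

lemma Lip_measurable: "w \<in> Lip \<Longrightarrow> w \<in> borel_measurable (borel :: (nat \<Rightarrow> 'a) measure)"
  by (rule borel_measurable_continuous_onI[OF Lip_continuous])

lemma integrable_case_nat:
  assumes "h \<in> Lip"
  shows "integrable \<nu> (\<lambda>a. h (case_nat a x))"
proof -
  obtain C where "\<And>y. \<bar>h y\<bar> \<le> C" using Lip_bounded[OF assms] by blast
  moreover have "(\<lambda>a. h (case_nat a x)) \<in> borel_measurable \<nu>"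
    using measurable_compose[OF measurable_case_nat_fst Lip_measurable[OF assms]]
    by (simp cong: measurable_cong_sets)
  ultimately show ?thesis
    by (intro nu.integrable_const_bound[of _ C]) auto
qed

lemma ruelle_integrable:
  assumes "f \<in> Lip" "w \<in> Lip"
  shows "integrable \<nu> (\<lambda>a. exp (f (case_nat a x)) * w (case_nat a x))"
  using integrable_case_nat[OF Lip_mult[OF Lip_exp[OF assms(1)] assms(2)]] .

lemma ruelle_Lip:
  assumes "f \<in> Lip" "w \<in> Lip"
  shows "ruelle \<nu> f w \<in> Lip"
proof -
  define h where "h = (\<lambda>x. exp (f x) * w x)"
  have h: "h \<in> Lip" unfolding h_def by (intro Lip_mult Lip_exp assms)
  obtain L where L: "L > 0" "lip_le L h" using Lip_lip_le[OF h] .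
  have "ruelle \<nu> f w x - ruelle \<nu> f w y \<le> (L / 2) * seq_dist x y" for x y
  proof -
    have "ruelle \<nu> f w x - ruelle \<nu> f w y = (\<integral>a. h (case_nat a x) - h (case_nat a y) \<partial>\<nu>)"
      unfolding ruelle_def h_def by (subst Bochner_Integration.integral_diff) (auto intro: ruelle_integrable assms)
    also have "\<dots> \<le> (\<integral>a. (L / 2) * seq_dist x y \<partial>\<nu>)"
    proof (rule integral_mono)
      show "h (case_nat a x) - h (case_nat a y) \<le> (L / 2) * seq_dist x y" for a
        using lip_leD[OF L(2), of "case_nat a x" "case_nat a y"] by simp
      show "integrable \<nu> (\<lambda>a. h (case_nat a x) - h (case_nat a y))"
        by (rule Bochner_Integration.integrable_diff; rule integrable_case_nat[OF h])
    qed simp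
    finally show ?thesis by (simp add: nu.prob_space)
  qed
  then show ?thesis
    by (intro lip_le_Lip[of "L / 2"]) (simp add: lip_le_def)
qed

lemma ruelle_add:
  "f \<in> Lip \<Longrightarrow> v \<in> Lip \<Longrightarrow> w \<in> Lip \<Longrightarrow>
    ruelle \<nu> f (\<lambda>x. v x + w x) x = ruelle \<nu> f v x + ruelle \<nu> f w x"
  unfolding ruelle_def by (simp add: distrib_left ruelle_integrable)

lemma ruelle_diff:
  "f \<in> Lip \<Longrightarrow> v \<in> Lip \<Longrightarrow> w \<in> Lip \<Longrightarrow>
    ruelle \<nu> f (\<lambda>x. v x - w x) x = ruelle \<nu> f v x - ruelle \<nu> f w x"
  unfolding ruelle_def by (simp add: right_diff_distrib ruelle_integrable)

lemma ruelle_cmult: "ruelle \<nu> f (\<lambda>x. c * w x) x = c * ruelle \<nu> f w x"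
  unfolding ruelle_def by (simp add: mult.left_commute[of _ c])

lemma ruelle_mono:
  assumes "f \<in> Lip" "v \<in> Lip" "w \<in> Lip" "\<And>x. v x \<le> w x"
  shows "ruelle \<nu> f v x \<le> ruelle \<nu> f w x"
  unfolding ruelle_def by (intro integral_mono ruelle_integrable assms) (simp add: assms(4))

lemma ruelle_pos:
  assumes "f \<in> Lip" "w \<in> Lip" "\<And>x. w x > 0"
  shows "ruelle \<nu> f w x > 0"
proof -
  have h: "(\<lambda>x. exp (f x) * w x) \<in> Lip" by (intro Lip_mult Lip_exp assms)
  obtain c where c: "c > 0" "\<And>x. c \<le> exp (f x) * w x"
    using Lip_pos_bounded_below[OF h] assms(3) by (metis exp_gt_zero mult_pos_pos)
  have "c = (\<integral>a. c \<partial>\<nu>)" by (simp add: nu.prob_space)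
  also have "\<dots> \<le> ruelle \<nu> f w x"
    unfolding ruelle_def by (intro integral_mono ruelle_integrable assms c) auto
  finally show ?thesis using c by simp
qed

text \<open>All preimages of \<open>x\<close> have the same shift \<open>x\<close>, so a function of
  the shift leaves the integral. Adding a coboundary to the potential thereby becomes conjugation of
  the operator, which is the algebra behind every normalization below.\<close>

lemma ruelle_shift: "ruelle \<nu> f (\<lambda>x. w x * v (shift_map x)) x = ruelle \<nu> f w x * v x"
  unfolding ruelle_def by (simp flip: mult.assoc)

lemma ruelle_tilt: "ruelle \<nu> (\<lambda>x. f x + g x) w = ruelle \<nu> f (\<lambda>x. exp (g x) * w x)"
  by (simp add: fun_eq_iff ruelle_def exp_add mult.assoc)

lemma normalizedD:
  assumes "N \<in> normalized \<nu>"
  shows "N \<in> Lip" "ruelle \<nu> N (\<lambda>_. 1) x = 1"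
  using assms by (auto simp: normalized_def)

lemma ruelle_normalized_const: "N \<in> normalized \<nu> \<Longrightarrow> ruelle \<nu> N (\<lambda>_. c) x = c"
  using ruelle_cmult[of N c "\<lambda>_. 1" x] normalizedD(2) by simp

lemma ruelle_normalized_shift: "N \<in> normalized \<nu> \<Longrightarrow> ruelle \<nu> N (\<lambda>x. v (shift_map x)) x = v x"
  using ruelle_shift[of N "\<lambda>_. 1" v x] normalizedD(2) by simp

lemma ruelle_normalized_le:
  assumes "N \<in> normalized \<nu>" "w \<in> Lip" "\<And>x. w x \<le> C"
  shows "ruelle \<nu> N w x \<le> C"
  using ruelle_mono[OF normalizedD(1)[OF assms(1)] assms(2) Lip_const assms(3)]
    ruelle_normalized_const[OF assms(1)] by simp

lemma ruelle_normalized_abs_le: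
  assumes N: "N \<in> normalized \<nu>" and w: "w \<in> Lip" and C: "\<And>x. \<bar>w x\<bar> \<le> C"
  shows "\<bar>ruelle \<nu> N w x\<bar> \<le> C"
proof -
  \<comment> \<open>The negative is written as a multiple so that \<open>ruelle_cmult\<close>
    rewrites it.\<close>
  have "w x \<le> C" "-1 * w x \<le> C" for x using C[of x] by auto
  from ruelle_normalized_le[OF N w this(1), of x]
       ruelle_normalized_le[OF N Lip_cmult[OF w] this(2), of x]
  show ?thesis by (simp only: ruelle_cmult abs_le_iff) simp
qed

end

section \<open>Contraction for a bounded modulus of continuity\<close>

text \<open>A concave modulus, comparable to \<open>d\<close> on [0, 1] and bounded by 1. Hence
  \<open>gap_le F A\<close> bounds the oscillation by \<open>A\<close> and the Lipschitz constant by
  \<open>3 * F * A\<close> at once, and a single seminorm does the work of the two in a Lasota-Yorke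
  estimate.\<close>

definition gap :: "real \<Rightarrow> real \<Rightarrow> real" where
  "gap F d = 1 - exp (- 3 * F * d)"

text \<open>With \<open>X = exp (- F * d)\<close> the contraction reads 1 - X^2 \<le> (1 - e/3) (1 -
  X^3), that is, e (1 - X^3) \<le> 3 X^2 (1 - X). Since 1 - X^3 \<le> 3 (1 - X), any e below X^2
  will do, and \<open>exp (- 2 * F)\<close> is the least value of X^2 for d \<le> 1.\<close>

definition rate :: "real \<Rightarrow> real" where
  "rate F = 1 - exp (- 2 * F) / 3"

definition gap_le :: "real \<Rightarrow> real \<Rightarrow> ((nat \<Rightarrow> 'a::metric_space) \<Rightarrow> real) \<Rightarrow> bool" where
  "gap_le F A w \<longleftrightarrow> (\<forall>x y. w x - w y \<le> A * gap F (seq_dist x y))"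

lemma rate_bounds: "0 < rate F" "rate F < 1" if "F > 0"
proof -
  have "exp (- 2 * F) < 1" using that by simp
  then show "0 < rate F" unfolding rate_def by linarith
qed (simp add: rate_def)

lemma gap_le_1: "gap F d \<le> 1"
  by (simp add: gap_def)

lemma gap_nonneg: "F \<ge> 0 \<Longrightarrow> d \<ge> 0 \<Longrightarrow> 0 \<le> gap F d"
  by (simp add: gap_def)

lemma gap_le_linear: "gap F d \<le> 3 * F * d"
  unfolding gap_def using exp_ge_add_one_self[of "- 3 * F * d"] by linarith

text \<open>\<open>gap F\<close> is concave and vanishes at 0, so it lies above its chord on [0, 1];
  \<open>seq_dist\<close> takes no values beyond 1. This makes every Lipschitz function bounded in
  the modulus.\<close>

lemma gap_ge_linear:
  assumes "0 \<le> d" "d \<le> 1"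
  shows "d * gap F 1 \<le> gap F d"
proof -
  have "exp ((1 - d) *\<^sub>R 0 + d *\<^sub>R (- 3 * F)) \<le> (1 - d) * exp 0 + d * exp (- 3 * F)"
    using convex_onD[OF exp_convex, of d 0 "- 3 * F"] assms by simp
  then have "exp (- 3 * F * d) \<le> 1 - d + d * exp (- 3 * F)"
    by (simp add: mult_ac)
  then show ?thesis by (simp add: gap_def right_diff_distrib)
qed

text \<open>
  Two points at distance \<open>d\<close> are moved by the same symbol with probability \<open>s = exp (- F d / 2)\<close>, which
  halves their distance; otherwise the modulus is bounded by 1. The exponent 3 in \<open>gap\<close> is what makes
  the average smaller than \<open>gap F d\<close> by a factor that does not depend on \<open>d\<close>.
\<close>

lemma gap_contraction:
  assumes F: "F > 0" and d: "0 \<le> d" "d \<le> 1"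
  shows "exp (- F * d / 2) * gap F (d / 2) + (1 - exp (- F * d / 2)) \<le> rate F * gap F d"
proof -
  define X where "X = exp (- F * d)"
  have X: "0 < X" "X \<le> 1" using F d by (auto simp: X_def)
  have X2: "X\<^sup>2 = exp (- 2 * F * d)" and X3: "X ^ 3 = exp (- 3 * F * d)"
    by (simp_all add: X_def flip: exp_of_nat_mult)
  have "exp (- F * d / 2) * exp (- 3 * F * (d / 2)) = X\<^sup>2"
    unfolding X2 by (simp flip: exp_add)
  then have lhs: "exp (- F * d / 2) * gap F (d / 2) + (1 - exp (- F * d / 2)) = 1 - X\<^sup>2"
    by (simp add: gap_def right_diff_distrib)
  have "- 2 * F \<le> - 2 * F * d" using F d mult_left_le[of d F] by simp
  then have "exp (- 2 * F) \<le> X\<^sup>2" unfolding X2 by simp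
  moreover have "1 - X ^ 3 \<le> 3 * (1 - X)"
  proof -
    have "3 * (1 - X) - (1 - X ^ 3) = (1 - X)\<^sup>2 * (X + 2)"
      by (simp add: power2_eq_square power3_eq_cube algebra_simps)
    also have "\<dots> \<ge> 0" using X by simp
    finally show ?thesis by simp
  qed
  moreover have "0 \<le> 1 - X ^ 3" using X by (simp add: power_le_one)
  ultimately have "exp (- 2 * F) * (1 - X ^ 3) \<le> X\<^sup>2 * (3 * (1 - X))"
    using X by (intro mult_mono) auto
  moreover have "(1 - e / 3) * (1 - X ^ 3) - (1 - X\<^sup>2)
      = (X\<^sup>2 * (3 * (1 - X)) - e * (1 - X ^ 3)) / 3" for e
    by (simp add: power2_eq_square power3_eq_cube field_simps)
  ultimately have "1 - X\<^sup>2 \<le> (1 - exp (- 2 * F) / 3) * (1 - X ^ 3)"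
    by (simp add: field_simps)
  then show ?thesis
    unfolding lhs unfolding rate_def gap_def X3 .
qed

context full_shift
begin

lemma gap_leD: "gap_le F A w \<Longrightarrow> w x - w y \<le> A * gap F (seq_dist x (y :: nat \<Rightarrow> 'a))"
  by (simp add: gap_le_def)

lemma gap_le_osc:
  assumes "gap_le F A w" "0 \<le> A"
  shows "w x - w (y :: nat \<Rightarrow> 'a) \<le> A"
  using gap_leD[OF assms(1), of x y] mult_left_mono[OF gap_le_1 assms(2), of F "seq_dist x y"] by simp

lemma gap_le_osc_abs:
  assumes "gap_le F A w" "0 \<le> A"
  shows "\<bar>w x - w (y :: nat \<Rightarrow> 'a)\<bar> \<le> A"
  using gap_le_osc[OF assms, of x y] gap_le_osc[OF assms, of y x] by (simp add: abs_le_iff)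

lemma gap_le_lip:
  assumes "gap_le F A w" "0 \<le> A"
  shows "lip_le (3 * F * A) (w :: (nat \<Rightarrow> 'a) \<Rightarrow> real)"
  unfolding lip_le_def
proof (intro allI)
  fix x y :: "nat \<Rightarrow> 'a"
  show "w x - w y \<le> 3 * F * A * seq_dist x y"
    using gap_leD[OF assms(1), of x y] mult_left_mono[OF gap_le_linear assms(2), of F "seq_dist x y"]
    by (simp add: mult_ac)
qed

lemma lip_gap_le:
  assumes "lip_le L w" "0 \<le> L" "F > 0"
  shows "gap_le F (L / gap F 1) (w :: (nat \<Rightarrow> 'a) \<Rightarrow> real)"
  unfolding gap_le_def
proof (intro allI)
  fix x y :: "nat \<Rightarrow> 'a"
  have pos: "gap F 1 > 0" using assms by (simp add: gap_def)
  have "w x - w y \<le> L * seq_dist x y" by (rule lip_leD[OF assms(1)])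
  also have "\<dots> \<le> L * (gap F (seq_dist x y) / gap F 1)"
    using gap_ge_linear[of "seq_dist x y" F] seq_dist_le_1 pos assms
    by (intro mult_left_mono) (simp_all add: pos_le_divide_eq)
  finally show "w x - w y \<le> L / gap F 1 * gap F (seq_dist x y)" by simp
qed

lemma gap_le_add: "gap_le F A w \<Longrightarrow> gap_le F B v \<Longrightarrow> gap_le F (A + B) (\<lambda>x. w x + v (x :: nat \<Rightarrow> 'a))"
  unfolding gap_le_def by (smt (verit) distrib_right)

lemma gap_le_const: "0 \<le> A \<Longrightarrow> F \<ge> 0 \<Longrightarrow> gap_le F A (\<lambda>x :: nat \<Rightarrow> 'a. c)"
  by (simp add: gap_le_def gap_nonneg)

lemma gap_le_limit:
  assumes "\<And>n. gap_le F (A n) (w n)" "A \<longlonglongrightarrow> B" "\<And>x. (\<lambda>n. w n x) \<longlonglongrightarrow> v x"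
  shows "gap_le F B (v :: (nat \<Rightarrow> 'a) \<Rightarrow> real)"
  unfolding gap_le_def
proof (intro allI)
  fix x y :: "nat \<Rightarrow> 'a"
  show "v x - v y \<le> B * gap F (seq_dist x y)"
    by (rule LIMSEQ_le[OF tendsto_diff[OF assms(3) assms(3)] tendsto_mult_right[OF assms(2)]])
       (use gap_leD[OF assms(1)] in blast)
qed

lemma lip_le_limit:
  assumes "\<And>n. lip_le L (w n)" "\<And>x. (\<lambda>n. w n x) \<longlonglongrightarrow> v x"
  shows "lip_le L (v :: (nat \<Rightarrow> 'a) \<Rightarrow> real)"
  unfolding lip_le_def
proof (intro allI)
  fix x y :: "nat \<Rightarrow> 'a"
  show "v x - v y \<le> L * seq_dist x y"
    by (rule LIMSEQ_le_const2[OF tendsto_diff[OF assms(2) assms(2)]])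
       (use lip_leD[OF assms(1)] in blast)
qed

text \<open>The affine map \<open>A \<mapsto> rate F * A + B\<close> contracts to its fixed point
  \<open>B / (1 - rate F)\<close>, so any finite initial bound improves to that value. With
  \<open>B = 0\<close> this forces a function to be constant; with \<open>B\<close> of order t^2 it
  gives the second-order bound on the correction in the perturbed potential.\<close>

lemma gap_le_self_improve:
  assumes F: "F > 0" and w: "gap_le F A w" "0 \<le> A" and B: "0 \<le> B"
    and step: "\<And>A. 0 \<le> A \<Longrightarrow> gap_le F A w \<Longrightarrow> gap_le F (rate F * A + B) w"
  shows "gap_le F (B / (1 - rate F)) (w :: (nat \<Rightarrow> 'a) \<Rightarrow> real)"
proof -
  define C where "C = B / (1 - rate F)"
  note rate = rate_bounds[OF F]
  have C: "0 \<le> C" "rate F * C + B = C"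
    using rate B by (auto simp: C_def field_simps)
  have "gap_le F (rate F ^ n * A + C) w" for n
  proof (induction n)
    case 0
    show ?case using gap_le_add[OF w(1) gap_le_const[OF C(1), of F 0]] F by simp
  next
    case (Suc n)
    have "gap_le F (rate F * (rate F ^ n * A + C) + B) w"
      using w(2) C(1) rate by (intro step Suc add_nonneg_nonneg mult_nonneg_nonneg) auto
    also have "rate F * (rate F ^ n * A + C) + B = rate F ^ Suc n * A + C"
      using C(2) by (simp add: distrib_left mult.assoc)
    finally show ?case .
  qed
  moreover have "(\<lambda>n. rate F ^ n * A + C) \<longlonglongrightarrow> 0 * A + C"
    using rate by (intro tendsto_intros LIMSEQ_realpow_zero) auto
  ultimately have "gap_le F (0 * A + C) w"
    by (rule gap_le_limit) auto
  then show ?thesis by (simp add: C_def)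
qed

text \<open>The fraction \<open>exp (- F * seq_dist x y / 2)\<close> of the transition weight at
  \<open>x\<close> is contained in the weight at \<open>y\<close>: this is the mass that a coupling
  of the two points moves by a common symbol.\<close>

lemma exp_lip_case_nat:
  assumes "lip_le F N"
  shows "exp (- F * seq_dist x y / 2) * exp (N (case_nat a x)) \<le> exp (N (case_nat a (y :: nat \<Rightarrow> 'a)))"
proof -
  have "N (case_nat a x) - N (case_nat a y) \<le> F * (seq_dist x y / 2)"
    using lip_leD[OF assms, of "case_nat a x" "case_nat a y"] by simp
  then show ?thesis by (simp flip: exp_add)
qed

lemma gap_le_case_nat:
  assumes "gap_le F A r"
  shows "r (case_nat a x) - r (case_nat a (y :: nat \<Rightarrow> 'a)) \<le> A * gap F (seq_dist x y / 2)"
  using gap_leD[OF assms, of "case_nat a x" "case_nat a y"] by simp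

text \<open>A coupling written as a lower bound for the value at \<open>y\<close>. On the shared
  mass \<open>s\<close> the two points move to distance \<open>d / 2\<close>; on the remaining mass
  \<open>1 - s\<close> only the oscillation bound \<open>A\<close> is used. What results is the
  average estimated in \<open>gap_contraction\<close>.\<close>

lemma ruelle_gap_le:
  assumes N: "N \<in> normalized \<nu>" "lip_le F N" and F: "F > 0" and r: "gap_le F A r" "0 \<le> A"
  shows "gap_le F (rate F * A) (ruelle \<nu> N r)"
  unfolding gap_le_def
proof (intro allI)
  fix x y :: "nat \<Rightarrow> 'a"
  define d where "d = seq_dist x y"
  define s where "s = exp (- F * d / 2)"
  define X where "X = ruelle \<nu> N r x"
  have rL: "r \<in> Lip" by (rule lip_le_Lip[OF gap_le_lip[OF r]])
  note NL = normalizedD(1)[OF N(1)]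
  have d: "0 \<le> d" "d \<le> 1" using seq_dist_le_1 by (auto simp: d_def)
  \<comment> \<open>\<open>X\<close> is an average of values of \<open>r\<close>, each of which is
    at most \<open>r z + A\<close>.\<close>
  have osc: "X \<le> r z + A" for z
    unfolding X_def using gap_le_osc[OF r, of _ z]
    by (intro ruelle_normalized_le[OF N(1) rL]) (simp add: algebra_simps)
  let ?p = "\<lambda>x a. exp (N (case_nat a x))"
  \<comment> \<open>The minorant of the integrand at \<open>y\<close>: on the shared part
    \<open>r\<close> is compared with its value over \<open>x\<close>, on the excess
    \<open>?p y a - s * ?p x a\<close> it is replaced by \<open>X - A\<close>. It is expanded so
    that each term has a known integral.\<close>
  let ?l = "\<lambda>a. s * (?p x a * r (case_nat a x)) - s * (?p x a * (A * gap F (d / 2)))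
      + (?p y a * (X - A) - s * (?p x a * (X - A)))"
  have int: "has_bochner_integral \<nu> (\<lambda>a. ?p z a * r (case_nat a z)) (ruelle \<nu> N r z)"
      "has_bochner_integral \<nu> (\<lambda>a. ?p z a * c) c" for z c
    using ruelle_integrable[OF NL rL] ruelle_integrable[OF NL Lip_const]
      ruelle_normalized_const[OF N(1), of c z]
    by (auto simp: has_bochner_integral_iff ruelle_def)
  have l: "has_bochner_integral \<nu> ?l (s * X - s * (A * gap F (d / 2)) + ((X - A) - s * (X - A)))"
    unfolding X_def by (intro has_bochner_integral_add has_bochner_integral_diff has_bochner_integral_mult_right int)
  have "(\<integral>a. ?l a \<partial>\<nu>) \<le> (\<integral>a. ?p y a * r (case_nat a y) \<partial>\<nu>)"
  proof (rule integral_mono)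
    fix a
    have "s * ?p x a * (r (case_nat a x) - A * gap F (d / 2)) \<le> s * ?p x a * r (case_nat a y)"
      using gap_le_case_nat[OF r(1), of a x y] by (intro mult_left_mono) (auto simp: d_def s_def)
    moreover have "(?p y a - s * ?p x a) * (X - A) \<le> (?p y a - s * ?p x a) * r (case_nat a y)"
      using exp_lip_case_nat[OF N(2), of x y a] osc[of "case_nat a y"]
      by (intro mult_left_mono) (auto simp: d_def s_def algebra_simps)
    ultimately show "?l a \<le> ?p y a * r (case_nat a y)"
      by (simp add: algebra_simps)
  qed (use l int in \<open>auto simp: has_bochner_integral_iff\<close>)
  also have "\<dots> = ruelle \<nu> N r y" by (simp add: ruelle_def)
  also have "(\<integral>a. ?l a \<partial>\<nu>) = s * X - s * (A * gap F (d / 2)) + ((X - A) - s * (X - A))"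
    by (rule has_bochner_integral_integral_eq[OF l])
  finally have "X - ruelle \<nu> N r y \<le> A * (s * gap F (d / 2) + (1 - s))"
    by (simp add: algebra_simps)
  also have "\<dots> \<le> A * (rate F * gap F d)"
    unfolding s_def using r(2) by (intro mult_left_mono gap_contraction F d) auto
  finally show "ruelle \<nu> N r x - ruelle \<nu> N r y \<le> rate F * A * gap F (seq_dist x y)"
    by (simp add: X_def d_def mult_ac)
qed

text \<open>The same coupling with multiplicative bounds. It leaves the factor
  \<open>s * exp (- (A * G)) + (1 - s) * exp (- A)\<close>, and convexity of the exponential bounds
  it below by the exponential of the averaged exponent, so the rate is the same as in the linear
  case.\<close>

lemma ln_ruelle_exp_gap_le:
  assumes N: "N \<in> normalized \<nu>" "lip_le F N" and F: "F > 0" and r: "gap_le F A r" "0 \<le> A"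
  shows "gap_le F (rate F * A) (\<lambda>x. ln (ruelle \<nu> N (\<lambda>x. exp (r x)) x))"
  unfolding gap_le_def
proof (intro allI)
  fix x y :: "nat \<Rightarrow> 'a"
  define d where "d = seq_dist x y"
  define s where "s = exp (- F * d / 2)"
  define X where "X = ruelle \<nu> N (\<lambda>x. exp (r x)) x"
  define Y where "Y = ruelle \<nu> N (\<lambda>x. exp (r x)) y"
  define G where "G = gap F (d / 2)"
  have rL: "r \<in> Lip" by (rule lip_le_Lip[OF gap_le_lip[OF r]])
  have eL: "(\<lambda>x. exp (r x)) \<in> Lip" by (rule Lip_exp[OF rL])
  note NL = normalizedD(1)[OF N(1)]
  have d: "0 \<le> d" "d \<le> 1" using seq_dist_le_1 by (auto simp: d_def)
  have s: "0 < s" "s \<le> 1" using F d by (auto simp: s_def)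
  have XY: "X > 0" "Y > 0" unfolding X_def Y_def by (auto intro: ruelle_pos NL eL)
  have osc: "exp (- A) * X \<le> exp (r z)" for z
  proof -
    have "exp (r x) \<le> exp (r z + A)" for x
      using gap_le_osc[OF r, of x z] by simp
    then have "X \<le> exp (r z + A)"
      unfolding X_def by (rule ruelle_normalized_le[OF N(1) eL])
    then show ?thesis by (simp add: exp_add exp_minus field_simps)
  qed
  let ?p = "\<lambda>x a. exp (N (case_nat a x))"
  let ?l = "\<lambda>a. s * exp (- (A * G)) * (?p x a * exp (r (case_nat a x)))
      + (?p y a * (exp (- A) * X) - s * (?p x a * (exp (- A) * X)))"
  have int: "has_bochner_integral \<nu> (\<lambda>a. ?p z a * exp (r (case_nat a z))) (ruelle \<nu> N (\<lambda>x. exp (r x)) z)"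
      "has_bochner_integral \<nu> (\<lambda>a. ?p z a * c) c" for z c
    using ruelle_integrable[OF NL eL] ruelle_integrable[OF NL Lip_const]
      ruelle_normalized_const[OF N(1), of c z]
    by (auto simp: has_bochner_integral_iff ruelle_def)
  have l: "has_bochner_integral \<nu> ?l (s * exp (- (A * G)) * X + (exp (- A) * X - s * (exp (- A) * X)))"
    unfolding X_def by (intro has_bochner_integral_add has_bochner_integral_diff has_bochner_integral_mult_right int)
  have "(\<integral>a. ?l a \<partial>\<nu>) \<le> (\<integral>a. ?p y a * exp (r (case_nat a y)) \<partial>\<nu>)"
  proof (rule integral_mono)
    fix a
    have "exp (- (A * G)) * exp (r (case_nat a x)) \<le> exp (r (case_nat a y))"
      using gap_le_case_nat[OF r(1), of a x y] by (simp add: d_def G_def flip: exp_add)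
    then have "s * ?p x a * (exp (- (A * G)) * exp (r (case_nat a x))) \<le> s * ?p x a * exp (r (case_nat a y))"
      using s by (intro mult_left_mono) auto
    moreover have "(?p y a - s * ?p x a) * (exp (- A) * X) \<le> (?p y a - s * ?p x a) * exp (r (case_nat a y))"
      using exp_lip_case_nat[OF N(2), of x y a] osc[of "case_nat a y"]
      by (intro mult_left_mono) (auto simp: d_def s_def algebra_simps)
    ultimately show "?l a \<le> ?p y a * exp (r (case_nat a y))"
      by (simp add: algebra_simps)
  qed (use l int in \<open>auto simp: has_bochner_integral_iff\<close>)
  also have "\<dots> = Y" by (simp add: ruelle_def Y_def)
  also have "(\<integral>a. ?l a \<partial>\<nu>) = s * exp (- (A * G)) * X + (exp (- A) * X - s * (exp (- A) * X))"
    by (rule has_bochner_integral_integral_eq[OF l])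
  finally have "X * (s * exp (- (A * G)) + (1 - s) * exp (- A)) \<le> Y"
    by (simp add: algebra_simps)
  moreover have "exp (- (rate F * A * gap F d)) \<le> s * exp (- (A * G)) + (1 - s) * exp (- A)"
  proof -
    have "A * (s * G + (1 - s)) \<le> A * (rate F * gap F d)"
      unfolding s_def G_def using r(2) by (intro mult_left_mono gap_contraction F d) auto
    then have "exp (- (rate F * A * gap F d)) \<le> exp ((1 - s) *\<^sub>R (- A) + s *\<^sub>R (- (A * G)))"
      by (simp add: algebra_simps)
    also have "\<dots> \<le> (1 - s) * exp (- A) + s * exp (- (A * G))"
      using convex_onD[OF exp_convex, of s "- A" "- (A * G)"] s by simp
    finally show ?thesis by simp
  qed
  ultimately have "X * exp (- (rate F * A * gap F d)) \<le> Y"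
    using XY by (meson less_imp_le mult_left_mono order_trans)
  then have "ln (X * exp (- (rate F * A * gap F d))) \<le> ln Y"
    using XY by (subst ln_le_cancel_iff) auto
  then show "ln (ruelle \<nu> N (\<lambda>x. exp (r x)) x) - ln (ruelle \<nu> N (\<lambda>x. exp (r x)) y)
      \<le> rate F * A * gap F (seq_dist x y)"
    using XY by (simp add: ln_mult X_def Y_def d_def)
qed

end

section \<open>Normalizing a Lipschitz potential\<close>

context full_shift
begin

text \<open>The limit is the sum of the telescoping differences, and \<epsilon> is the tail of the
  geometric series. The bound is uniform in the point because the operators are carried to the limit
  by their sup-norm nonexpansiveness.\<close>

lemma geometric_limit_exists:
  fixes u :: "nat \<Rightarrow> (nat \<Rightarrow> 'a) \<Rightarrow> real"
  assumes step: "\<And>n x. \<bar>u (Suc n) x - u n x\<bar> \<le> A * \<theta> ^ n" and \<theta>: "0 < \<theta>" "\<theta> < 1"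
  obtains v \<epsilon> where "\<And>n x. \<bar>u n x - v x\<bar> \<le> \<epsilon> n" "\<epsilon> \<longlonglongrightarrow> 0" "\<And>x. (\<lambda>n. u n x) \<longlonglongrightarrow> v x"
proof -
  define d where "d = (\<lambda>n x. u (Suc n) x - u n x)"
  have sumA: "summable (\<lambda>n. A * \<theta> ^ n)"
    using \<theta> by (intro summable_mult summable_geometric) auto
  have sumd: "summable (\<lambda>n. d n x)" for x
    by (rule summable_comparison_test'[OF sumA, of 0]) (use step in \<open>auto simp: d_def\<close>)
  define v where "v = (\<lambda>x. u 0 x + (\<Sum>n. d n x))"
  define \<epsilon> where "\<epsilon> = (\<lambda>n. \<Sum>k. A * \<theta> ^ (k + n))"
  have "\<bar>u n x - v x\<bar> \<le> \<epsilon> n" for n x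
  proof -
    have "(\<Sum>k<n. d k x) = u n x - u 0 x"
      unfolding d_def by (rule sum_lessThan_telescope)
    then have "v x - u n x = (\<Sum>k. d (k + n) x)"
      using suminf_split_initial_segment[OF sumd, of x n] by (simp add: v_def)
    moreover have "\<bar>\<Sum>k. d (k + n) x\<bar> \<le> (\<Sum>k. A * \<theta> ^ (k + n))"
    proof -
      have "norm (\<Sum>k. d (k + n) x) \<le> (\<Sum>k. A * \<theta> ^ (k + n))"
      proof (rule norm_suminf_le)
        show "norm (d (k + n) x) \<le> A * \<theta> ^ (k + n)" for k using step by (simp add: d_def)
        show "summable (\<lambda>k. A * \<theta> ^ (k + n))" using summable_ignore_initial_segment[OF sumA] .
      qed
      then show ?thesis by simp
    qed
    ultimately show ?thesis by (simp add: \<epsilon>_def abs_minus_commute)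
  qed
  moreover have "\<epsilon> \<longlonglongrightarrow> 0"
    unfolding \<epsilon>_def by (rule suminf_exist_split2[OF sumA])
  moreover have "(\<lambda>n. u n x) \<longlonglongrightarrow> v x" for x
  proof -
    have "(\<lambda>n. u n x - v x) \<longlonglongrightarrow> 0"
      by (rule Lim_null_comparison[OF always_eventually calculation(2)]) (use calculation(1) in auto)
    then show ?thesis by (simp add: LIM_zero_iff)
  qed
  ultimately show thesis by (rule that)
qed

section \<open>The Ruelle operator in logarithmic coordinates\<close>

definition log_ruelle :: "((nat \<Rightarrow> 'a) \<Rightarrow> real) \<Rightarrow> ((nat \<Rightarrow> 'a) \<Rightarrow> real) \<Rightarrow> (nat \<Rightarrow> 'a) \<Rightarrow> real" where
  "log_ruelle f q x = ln (ruelle \<nu> f (\<lambda>x. exp (q x)) x)"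

lemma exp_log_ruelle:
  "f \<in> Lip \<Longrightarrow> q \<in> Lip \<Longrightarrow> exp (log_ruelle f q x) = ruelle \<nu> f (\<lambda>x. exp (q x)) x"
  unfolding log_ruelle_def by (intro exp_ln ruelle_pos Lip_exp) auto

text \<open>Both \<open>f\<close> and \<open>q\<close> are evaluated at preimages that are twice as
  close. The constant is the mean of \<open>F\<close> and \<open>Q\<close>, so functions with
  constant \<open>F\<close> are mapped to such functions and the iterates stay uniformly
  Lipschitz.\<close>

lemma log_ruelle_lip_le:
  assumes f: "lip_le F f" and q: "lip_le Q q"
  shows "lip_le ((F + Q) / 2) (log_ruelle f q)"
  unfolding lip_le_def
proof (intro allI)
  fix x y :: "nat \<Rightarrow> 'a"
  define e where "e = (F + Q) / 2 * seq_dist x y"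
  note L = lip_le_Lip[OF f] lip_le_Lip[OF q]
  have "ruelle \<nu> f (\<lambda>x. exp (q x)) x \<le> (\<integral>a. exp e * (exp (f (case_nat a y)) * exp (q (case_nat a y))) \<partial>\<nu>)"
    unfolding ruelle_def
  proof (rule integral_mono)
    fix a
    have "f (case_nat a x) - f (case_nat a y) \<le> F * (seq_dist x y / 2)"
      "q (case_nat a x) - q (case_nat a y) \<le> Q * (seq_dist x y / 2)"
      using lip_leD[OF f, of "case_nat a x" "case_nat a y"] lip_leD[OF q, of "case_nat a x" "case_nat a y"]
      by auto
    then show "exp (f (case_nat a x)) * exp (q (case_nat a x))
        \<le> exp e * (exp (f (case_nat a y)) * exp (q (case_nat a y)))"
      by (simp add: e_def field_simps flip: exp_add)
  qed (intro integrable_mult_right ruelle_integrable Lip_exp L)+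
  also have "\<dots> = exp e * ruelle \<nu> f (\<lambda>x. exp (q x)) y"
    by (simp add: ruelle_def)
  finally have "exp (log_ruelle f q x) \<le> exp (e + log_ruelle f q y)"
    by (simp add: exp_log_ruelle[OF L] exp_add)
  then show "log_ruelle f q x - log_ruelle f q y \<le> (F + Q) / 2 * seq_dist x y"
    by (simp add: e_def)
qed

lemma log_ruelle_Lip: "f \<in> Lip \<Longrightarrow> q \<in> Lip \<Longrightarrow> log_ruelle f q \<in> Lip"
  by (elim Lip_lip_le) (blast intro: lip_le_Lip log_ruelle_lip_le)

lemma log_ruelle_add_const:
  assumes "f \<in> Lip" "q \<in> Lip"
  shows "log_ruelle f (\<lambda>x. q x + c) x = log_ruelle f q x + c"
proof -
  have "ruelle \<nu> f (\<lambda>x. exp (q x + c)) x = exp c * ruelle \<nu> f (\<lambda>x. exp (q x)) x"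
    by (simp add: exp_add mult.commute flip: ruelle_cmult)
  then have "exp (log_ruelle f (\<lambda>x. q x + c) x) = exp (log_ruelle f q x + c)"
    using exp_log_ruelle[OF assms(1) Lip_add[OF assms(2) Lip_const], of c x]
    by (simp add: exp_add exp_log_ruelle[OF assms])
  then show ?thesis by simp
qed

lemma log_ruelle_mono:
  assumes "f \<in> Lip" "q \<in> Lip" "p \<in> Lip" "\<And>x. q x \<le> p x"
  shows "log_ruelle f q x \<le> log_ruelle f p x"
proof -
  have "exp (log_ruelle f q x) \<le> exp (log_ruelle f p x)"
    unfolding exp_log_ruelle[OF assms(1,2)] exp_log_ruelle[OF assms(1,3)]
    by (intro ruelle_mono Lip_exp assms) (simp add: assms(4))
  then show ?thesis by simp
qed

text \<open>Monotone maps that commute with adding constants are nonexpansive in the sup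
  norm.\<close>

lemma log_ruelle_nonexpansive:
  assumes "f \<in> Lip" "q \<in> Lip" "p \<in> Lip" "\<And>x. \<bar>q x - p x\<bar> \<le> e"
  shows "\<bar>log_ruelle f q x - log_ruelle f p x\<bar> \<le> e"
proof -
  have "q x \<le> p x + e" "p x \<le> q x + e" for x using assms(4)[of x] by auto
  from log_ruelle_mono[OF assms(1,2) Lip_add[OF assms(3) Lip_const] this(1), of x]
       log_ruelle_mono[OF assms(1,3) Lip_add[OF assms(2) Lip_const] this(2), of x]
  show ?thesis
    by (simp add: log_ruelle_add_const assms abs_le_iff)
qed

text \<open>Here \<open>q\<close> is arbitrary: dividing the weights by their total
  \<open>ruelle \<nu> f (exp q)\<close> at the shifted point makes them a probability. Only when
  \<open>q\<close> is the logarithm of an eigenfunction is the result cohomologous to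
  \<open>f\<close> up to a constant.\<close>

lemma normalized_log_ruelle:
  assumes f: "f \<in> Lip" and q: "q \<in> Lip"
  shows "(\<lambda>x. f x + q x - log_ruelle f q (shift_map x)) \<in> normalized \<nu>"
proof -
  have "ruelle \<nu> (\<lambda>x. f x + q x - log_ruelle f q (shift_map x)) (\<lambda>_. 1) x
      = ruelle \<nu> f (\<lambda>x. exp (q x)) x * exp (- log_ruelle f q x)" for x
    unfolding ruelle_shift[symmetric, where f = f and v = "\<lambda>x. exp (- log_ruelle f q x)"]
    by (simp add: ruelle_def algebra_simps flip: exp_add)
  then have "ruelle \<nu> (\<lambda>x. f x + q x - log_ruelle f q (shift_map x)) (\<lambda>_. 1) x = 1" for x
    by (simp add: exp_minus flip: exp_log_ruelle[OF f q])
  then show ?thesis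
    by (auto simp: normalized_def fun_eq_iff intro!: Lip_diff Lip_add f q Lip_shift log_ruelle_Lip)
qed

lemma normalized_log_ruelle_lip_le:
  assumes f: "lip_le F f" and q: "lip_le Q q" and nn: "0 \<le> F" "0 \<le> Q"
  shows "lip_le (2 * (F + Q)) (\<lambda>x. f x + q x - log_ruelle f q (shift_map x))"
proof -
  have eq: "2 * (F + Q) = F + Q + 2 * ((F + Q) / 2)" by simp
  show ?thesis
    unfolding eq by (intro lip_le_diff lip_le_add lip_le_shift log_ruelle_lip_le f q) (use nn in simp)
qed

text \<open>Normalizing along \<open>q\<close> turns the difference of the two values into the
  logarithmic operator of a normalized potential applied to \<open>p - q\<close>. That potential has
  Lipschitz constant at most \<open>2 * (F + Q)\<close>, so \<open>K\<close>, and with it the rate,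
  depends on \<open>f\<close> and \<open>q\<close> but not on \<open>p\<close>.\<close>

lemma log_ruelle_contraction:
  assumes f: "lip_le F f" and q: "lip_le Q q" and p: "p \<in> Lip" and K: "2 * (F + Q) \<le> K" "K > 0" "0 \<le> F" "0 \<le> Q"
    and A: "gap_le K A (\<lambda>x. p x - q x)" "0 \<le> A"
  shows "gap_le K (rate K * A) (\<lambda>x. log_ruelle f p x - log_ruelle f q x)"
proof -
  define N where "N = (\<lambda>x. f x + q x - log_ruelle f q (shift_map x))"
  note L = lip_le_Lip[OF f] lip_le_Lip[OF q]
  have N: "N \<in> normalized \<nu>" "lip_le K N"
    unfolding N_def using normalized_log_ruelle[OF L]
      lip_le_mono[OF normalized_log_ruelle_lip_le[OF f q K(3,4)] K(1)] by auto
  have "ln (ruelle \<nu> N (\<lambda>x. exp (p x - q x)) x) = log_ruelle f p x - log_ruelle f q x" for x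
  proof -
    have "ruelle \<nu> N (\<lambda>x. exp (p x - q x)) x = ruelle \<nu> f (\<lambda>x. exp (p x)) x * exp (- log_ruelle f q x)"
      unfolding ruelle_shift[symmetric, where f = f and v = "\<lambda>x. exp (- log_ruelle f q x)"]
      by (simp add: ruelle_def N_def algebra_simps flip: exp_add)
    also have "\<dots> = exp (log_ruelle f p x - log_ruelle f q x)"
      by (simp add: exp_diff exp_minus field_simps flip: exp_log_ruelle[OF L(1) p])
    finally show ?thesis by simp
  qed
  with ln_ruelle_exp_gap_le[OF N K(2) A] show ?thesis by simp
qed

text \<open>Iterating from 0 keeps the Lipschitz constant at most \<open>F\<close>, so
  \<open>K = 4 * F\<close> serves for every step and successive differences contract geometrically.
  The modulus does not see constants; convergence therefore holds only modulo constants, and the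
  drift per step tends to the logarithm of the eigenvalue.\<close>

lemma log_ruelle_eigenfunction:
  assumes f: "f \<in> Lip"
  obtains q \<kappa> where "q \<in> Lip" "\<And>x. log_ruelle f q x = q x + \<kappa>"
proof -
  obtain F where F: "F > 0" "lip_le F f" using Lip_lip_le[OF f] .
  define K where "K = 4 * F"
  have K: "K > 0" "2 * (F + F) \<le> K" using F by (auto simp: K_def)
  note rate = rate_bounds[OF K(1)]
  define q where "q = (\<lambda>n. (log_ruelle f ^^ n) (\<lambda>_. 0))"
  have qS: "q (Suc n) = log_ruelle f (q n)" for n by (simp add: q_def)
  have lip: "lip_le F (q n)" for n
  proof (induction n)
    case 0
    show ?case using F by (simp add: q_def lip_le_const)
  next
    case (Suc n)
    show ?case unfolding qS using log_ruelle_lip_le[OF F(2) Suc] by simp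
  qed
  define A where "A = (F + F) / gap K 1"
  have A: "0 \<le> A" using F K by (simp add: A_def gap_nonneg)
  have gapq: "gap_le K (rate K ^ n * A) (\<lambda>x. q (Suc n) x - q n x)" for n
  proof (induction n)
    case 0
    show ?case
      using lip_gap_le[OF lip_le_diff[OF lip lip] _ K(1)] F by (simp add: A_def)
  next
    case (Suc n)
    have "0 \<le> rate K ^ n * A" using rate A by simp
    from log_ruelle_contraction[OF F(2) lip lip_le_Lip[OF lip] K(2,1) _ _ Suc this] F
    show ?case by (simp add: qS mult.assoc)
  qed
  \<comment> \<open>An arbitrary base point. Subtracting the value there removes the drift of the
    iterates.\<close>
  define z :: "nat \<Rightarrow> 'a" where "z = (\<lambda>_. undefined)"
  define r where "r = (\<lambda>n x. q n x - q n z)"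
  have "\<bar>r (Suc n) x - r n x\<bar> \<le> A * rate K ^ n" for n x
    using gap_le_osc_abs[OF gapq, of n x z] A rate by (simp add: r_def algebra_simps)
  then obtain v e where v: "\<And>n x. \<bar>r n x - v x\<bar> \<le> e n" "e \<longlonglongrightarrow> 0" "\<And>x. (\<lambda>n. r n x) \<longlonglongrightarrow> v x"
    using geometric_limit_exists[of r A "rate K"] rate by metis
  have rlip: "lip_le F (r n)" for n
    unfolding r_def using lip_le_diff[OF lip lip_le_const[of 0]] by simp
  have vL: "v \<in> Lip"
    by (rule lip_le_Lip[OF lip_le_limit[OF rlip v(3)]])
  have Tr: "log_ruelle f (r n) x = r (Suc n) x + (q (Suc n) z - q n z)" for n x
    using log_ruelle_add_const[OF f lip_le_Lip[OF lip[of n]], of "- q n z" x]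
    by (simp add: r_def qS)
  have lim: "(\<lambda>n. log_ruelle f (r n) x) \<longlonglongrightarrow> log_ruelle f v x" for x
  proof -
    have "(\<lambda>n. log_ruelle f (r n) x - log_ruelle f v x) \<longlonglongrightarrow> 0"
      by (rule Lim_null_comparison[OF always_eventually v(2)])
         (use log_ruelle_nonexpansive[OF f lip_le_Lip[OF rlip] vL v(1)] in auto)
    then show ?thesis by (simp add: LIM_zero_iff)
  qed
  \<comment> \<open>The sequence on the left does not involve \<open>x\<close>, so its limit does
    not either: this is the eigenvalue equation.\<close>
  have lim2: "(\<lambda>n. q (Suc n) z - q n z) \<longlonglongrightarrow> log_ruelle f v x - v x" for x
  proof -
    have "(\<lambda>n. log_ruelle f (r n) x - r (Suc n) x) \<longlonglongrightarrow> log_ruelle f v x - v x"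
      by (intro tendsto_diff lim LIMSEQ_Suc v(3))
    then show ?thesis by (simp add: Tr)
  qed
  have "log_ruelle f v x = v x + (log_ruelle f v z - v z)" for x
    using LIMSEQ_unique[OF lim2[of x] lim2[of z]] by simp
  then show thesis using that vL by blast
qed

text \<open>Normalization of \<open>M\<close> says that \<open>r\<close> is fixed, up to a constant,
  by the logarithmic operator of \<open>N\<close>. The contraction makes \<open>r\<close> constant,
  and comparing total weights makes \<kappa> vanish.\<close>

lemma normalized_cohomologous_unique:
  assumes N: "N \<in> normalized \<nu>" and M: "M \<in> normalized \<nu>" and r: "r \<in> Lip"
    and eq: "\<And>x. M x = N x + r x - r (shift_map x) - \<kappa>"
  shows "M = N"
proof -
  obtain F where F: "F > 0" "lip_le F N" using Lip_lip_le[OF normalizedD(1)[OF N]] .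
  obtain R where R: "R > 0" "lip_le R r" using Lip_lip_le[OF r] .
  note rate = rate_bounds[OF F(1)]
  have "ln (ruelle \<nu> N (\<lambda>x. exp (r x)) x) = r x + \<kappa>" for x
  proof -
    have "1 = ruelle \<nu> M (\<lambda>_. 1) x" using normalizedD(2)[OF M] by simp
    also have "\<dots> = ruelle \<nu> N (\<lambda>x. exp (r x)) x * exp (- r x - \<kappa>)"
      unfolding ruelle_shift[symmetric, where f = N and v = "\<lambda>x. exp (- r x - \<kappa>)"]
      by (simp add: ruelle_def eq algebra_simps flip: exp_add)
    finally have "ruelle \<nu> N (\<lambda>x. exp (r x)) x = exp (r x + \<kappa>)"
      by (simp add: exp_diff exp_minus exp_add field_simps)
    then show ?thesis by simp
  qed
  moreover have "gap_le F (rate F * A) (\<lambda>x. ln (ruelle \<nu> N (\<lambda>x. exp (r x)) x))"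
    if "0 \<le> A" "gap_le F A r" for A
    by (rule ln_ruelle_exp_gap_le[OF N F(2,1) that(2,1)])
  ultimately have "gap_le F (rate F * A + 0) r" if "0 \<le> A" "gap_le F A r" for A
    using that by (simp add: gap_le_def)
  from gap_le_self_improve[OF F(1) lip_gap_le[OF R(2) _ F(1)] _ _ this] R F
  have "gap_le F 0 r" by (simp add: gap_nonneg)
  then have r_const: "r x = r y" for x y
    using gap_le_osc_abs[of F 0 r x y] by simp
  then have Meq: "M x = N x - \<kappa>" for x
    using eq[of x] r_const[of x "shift_map x"] by simp
  have "1 = ruelle \<nu> M (\<lambda>_. 1) undefined" using normalizedD(2)[OF M] by simp
  also have "\<dots> = exp (- \<kappa>) * ruelle \<nu> N (\<lambda>_. 1) undefined"
    by (simp add: ruelle_def Meq exp_diff exp_minus field_simps)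
  finally have "\<kappa> = 0" using normalizedD(2)[OF N] by simp
  then show ?thesis using Meq by auto
qed

section \<open>Iterates of a normalized operator\<close>

lemma ruelle_iterates_Lip: "f \<in> Lip \<Longrightarrow> w \<in> Lip \<Longrightarrow> (ruelle \<nu> f ^^ n) w \<in> Lip"
  by (induction n) (auto intro: ruelle_Lip)

lemma ruelle_iterates_gap_le:
  assumes f: "f \<in> normalized \<nu>" "lip_le F f" and F: "F > 0" and w: "gap_le F A w" "0 \<le> A"
  shows "gap_le F (rate F ^ n * A) ((ruelle \<nu> f ^^ n) w)"
proof (induction n)
  case 0
  show ?case using w by simp
next
  case (Suc n)
  have "0 \<le> rate F ^ n * A" using rate_bounds[OF F] w by simp
  from ruelle_gap_le[OF f F Suc this] show ?case by (simp add: mult.assoc)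
qed

lemma ruelle_iterates_osc:
  assumes f: "f \<in> normalized \<nu>" and w: "w \<in> Lip"
  obtains A \<theta> where "0 \<le> A" "0 < \<theta>" "\<theta> < 1"
    "\<And>n x y. \<bar>(ruelle \<nu> f ^^ n) w x - (ruelle \<nu> f ^^ n) w y\<bar> \<le> A * \<theta> ^ n"
proof -
  obtain F where F: "F > 0" "lip_le F f" using Lip_lip_le[OF normalizedD(1)[OF f]] .
  obtain P where P: "P > 0" "lip_le P w" using Lip_lip_le[OF w] .
  note rate = rate_bounds[OF F(1)]
  have A: "0 \<le> P / gap F 1" using P F by (simp add: gap_nonneg)
  have "gap_le F (rate F ^ n * (P / gap F 1)) ((ruelle \<nu> f ^^ n) w)" for n
    using P by (intro ruelle_iterates_gap_le[OF f F(2,1) _ A] lip_gap_le F) auto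
  moreover have "0 \<le> rate F ^ n * (P / gap F 1)" for n
    using A rate by (intro mult_nonneg_nonneg) auto
  ultimately have "\<bar>(ruelle \<nu> f ^^ n) w x - (ruelle \<nu> f ^^ n) w y\<bar> \<le> P / gap F 1 * rate F ^ n" for n x y
    using gap_le_osc_abs by (metis mult.commute)
  then show thesis
    using A rate by (intro that[of "P / gap F 1" "rate F"]) auto
qed

text \<open>Each iterate is an average of the preceding one, so consecutive iterates differ by no
  more than the oscillation, which decays geometrically. The limit has oscillation zero.\<close>

lemma ruelle_iterates_convergent:
  assumes f: "f \<in> normalized \<nu>" and w: "w \<in> Lip"
  obtains c where "\<And>x. (\<lambda>n. (ruelle \<nu> f ^^ n) w x) \<longlonglongrightarrow> c"
proof -
  obtain A \<theta> where A: "0 \<le> A" "0 < \<theta>" "\<theta> < 1"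
    "\<And>n x y. \<bar>(ruelle \<nu> f ^^ n) w x - (ruelle \<nu> f ^^ n) w y\<bar> \<le> A * \<theta> ^ n"
    using ruelle_iterates_osc[OF assms] by blast
  let ?p = "\<lambda>n. (ruelle \<nu> f ^^ n) w"
  note L = ruelle_iterates_Lip[OF normalizedD(1)[OF f] w]
  have "\<bar>?p (Suc n) x - ?p n x\<bar> \<le> A * \<theta> ^ n" for n x
  proof -
    \<comment> \<open>Constants are fixed by the operator, so recentring at the value in
      \<open>x\<close> exhibits the increment as an average of oscillations.\<close>
    have "ruelle \<nu> f (\<lambda>y. ?p n y - ?p n x) x = ?p (Suc n) x - ?p n x"
      by (simp add: ruelle_diff normalizedD(1)[OF f] L Lip_const ruelle_normalized_const[OF f])
    then show ?thesis
      using ruelle_normalized_abs_le[OF f Lip_diff[OF L Lip_const] A(4), of n x x] by (simp only:)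
  qed
  then show thesis
  proof (rule geometric_limit_exists[OF _ A(2,3)])
    fix v assume v: "\<And>x. (\<lambda>n. ?p n x) \<longlonglongrightarrow> v x"
    have "(\<lambda>n. ?p n x - ?p n y) \<longlonglongrightarrow> 0" for x y
    proof (rule Lim_null_comparison)
      show "\<forall>\<^sub>F n in sequentially. norm (?p n x - ?p n y) \<le> A * \<theta> ^ n"
        unfolding real_norm_def by (intro always_eventually allI A(4))
      have "(\<lambda>n. A * \<theta> ^ n) \<longlonglongrightarrow> A * 0"
        using A(2,3) by (intro tendsto_mult_left LIMSEQ_realpow_zero) auto
      then show "(\<lambda>n. A * \<theta> ^ n) \<longlonglongrightarrow> 0" by simp
    qed
    from LIMSEQ_unique[OF this tendsto_diff[OF v v]] have v_const: "v x = v undefined" for x by simp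
    show thesis by (rule that[of "v undefined"]) (use v v_const in metis)
  qed
qed

text \<open>Applying L to \<psi> + v - v o T - c gives L \<psi> + L v - v - c, so the kernel
  condition is the Poisson equation v - L v = L \<psi> - c. Its Neumann series converges after each
  term is recentred at a base point, since the terms decay modulo constants.\<close>

lemma ruelle_ker_decomposition:
  assumes f: "f \<in> normalized \<nu>" and \<psi>: "\<psi> \<in> Lip"
  obtains \<zeta> v c where "\<zeta> \<in> ruelle_ker \<nu> f" "v \<in> Lip"
    "\<psi> = (\<lambda>x. \<zeta> x + (v x - v (shift_map x)) + c)"
proof -
  note fL = normalizedD(1)[OF f]
  obtain F where F: "F > 0" "lip_le F f" using Lip_lip_le[OF fL] .
  obtain P where P: "P > 0" "lip_le P \<psi>" using Lip_lip_le[OF \<psi>] .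
  note rate = rate_bounds[OF F(1)]
  define p where "p = (\<lambda>n. (ruelle \<nu> f ^^ n) \<psi>)"
  have pS: "p (Suc n) = ruelle \<nu> f (p n)" for n by (simp add: p_def)
  define A where "A = P / gap F 1"
  have A: "0 \<le> A" using P F by (simp add: A_def gap_nonneg)
  have gapp: "gap_le F (rate F ^ n * A) (p n)" for n
    unfolding p_def using P by (intro ruelle_iterates_gap_le[OF f F(2,1) _ A]) (auto simp: A_def intro: lip_gap_le F)
  have pL: "p n \<in> Lip" for n
    using rate A by (intro lip_le_Lip[OF gap_le_lip[OF gapp]]) simp
  define z :: "nat \<Rightarrow> 'a" where "z = (\<lambda>_. undefined)"
  \<comment> \<open>The partial sums of \<open>\<Sum>k\<ge>1. L\<^sup>k \<psi>\<close>, which solves \<open>v - L v = L \<psi>\<close> up to constants.\<close>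
  define u where "u = (\<lambda>n x. \<Sum>k<n. p (Suc k) x - p (Suc k) z)"
  have "\<bar>u (Suc n) x - u n x\<bar> \<le> (rate F * A) * rate F ^ n" for n x
    using gap_le_osc_abs[OF gapp, of "Suc n" x z] A rate by (simp add: u_def algebra_simps)
  then obtain v e where v: "\<And>n x. \<bar>u n x - v x\<bar> \<le> e n" "e \<longlonglongrightarrow> 0" "\<And>x. (\<lambda>n. u n x) \<longlonglongrightarrow> v x"
    using geometric_limit_exists[of u "rate F * A" "rate F"] rate by metis
  have gapu: "gap_le F (\<Sum>k<n. rate F ^ Suc k * A) (u n)" for n
  proof (induction n)
    case 0
    show ?case using F by (simp add: u_def gap_le_const)
  next
    case (Suc n)
    have "gap_le F (rate F ^ Suc n * A) (\<lambda>x. p (Suc n) x - p (Suc n) z)"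
      using gapp[of "Suc n"] by (simp add: gap_le_def)
    from gap_le_add[OF Suc this] show ?case by (simp add: u_def)
  qed
  have uL: "u n \<in> Lip" for n
    using rate A by (intro lip_le_Lip[OF gap_le_lip[OF gapu]] sum_nonneg) simp
  have "(\<lambda>n. \<Sum>k<n. rate F ^ Suc k * A) \<longlonglongrightarrow> (\<Sum>k. rate F ^ Suc k * A)"
    using rate by (intro summable_LIMSEQ summable_mult2) simp
  from gap_le_limit[OF gapu this v(3)]
  have gapv: "gap_le F (\<Sum>k. rate F ^ Suc k * A) v" .
  have vL: "v \<in> Lip"
    using rate A by (intro lip_le_Lip[OF gap_le_lip[OF gapv]] suminf_nonneg summable_mult2) simp_all
  \<comment> \<open>The operator advances each summand by one index and fixes the subtracted
    constants, so the sum telescopes. The remaining term \<open>p (Suc n)\<close> tends to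
    \<open>c\<close>.\<close>
  have Lu: "ruelle \<nu> f (u n) x - u n x = p (Suc n) x - p 1 x" for n x
  proof (induction n)
    case 0
    show ?case using ruelle_normalized_const[OF f, of 0 x] by (simp add: u_def)
  next
    case (Suc n)
    have "ruelle \<nu> f (u (Suc n)) x = ruelle \<nu> f (\<lambda>x. u n x + (p (Suc n) x - p (Suc n) z)) x"
      by (simp add: u_def)
    also have "\<dots> = ruelle \<nu> f (u n) x + (p (Suc (Suc n)) x - p (Suc n) z)"
      unfolding pS[of "Suc n"] ruelle_add[OF fL uL Lip_diff[OF pL Lip_const]]
        ruelle_diff[OF fL pL Lip_const] ruelle_normalized_const[OF f] by (rule refl)
    finally show ?case using Suc by (simp add: u_def)
  qed
  have lim: "(\<lambda>n. ruelle \<nu> f (u n) x - u n x) \<longlonglongrightarrow> ruelle \<nu> f v x - v x" for x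
  proof -
    have "\<bar>ruelle \<nu> f (u n) x - ruelle \<nu> f v x\<bar> \<le> e n" for n
      unfolding ruelle_diff[OF fL uL vL, symmetric]
      by (rule ruelle_normalized_abs_le[OF f Lip_diff[OF uL vL] v(1)])
    then have "(\<lambda>n. ruelle \<nu> f (u n) x - ruelle \<nu> f v x) \<longlonglongrightarrow> 0"
      by (intro Lim_null_comparison[OF always_eventually v(2)]) auto
    then show ?thesis
      by (intro tendsto_diff v(3)) (simp add: LIM_zero_iff)
  qed
  obtain c where c: "\<And>x. (\<lambda>n. (ruelle \<nu> f ^^ n) \<psi> x) \<longlonglongrightarrow> c"
    using ruelle_iterates_convergent[OF f \<psi>] by blast
  have Lv: "ruelle \<nu> f v x - v x = c - p 1 x" for x
  proof (rule LIMSEQ_unique[OF lim])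
    show "(\<lambda>n. ruelle \<nu> f (u n) x - u n x) \<longlonglongrightarrow> c - p 1 x"
      unfolding Lu p_def by (intro tendsto_diff tendsto_const LIMSEQ_Suc[OF c])
  qed
  define \<zeta> where "\<zeta> = (\<lambda>x. \<psi> x + (v x - v (shift_map x)) - c)"
  have "ruelle \<nu> f \<zeta> x = 0" for x
  proof -
    have "ruelle \<nu> f \<zeta> x = ruelle \<nu> f \<psi> x + (ruelle \<nu> f v x - v x) - c"
      unfolding \<zeta>_def
      by (simp add: ruelle_diff ruelle_add fL \<psi> vL Lip_diff Lip_add Lip_shift Lip_const
          ruelle_normalized_const[OF f] ruelle_normalized_shift[OF f])
    then show ?thesis using Lv[of x] by (simp add: p_def)
  qed
  then have "\<zeta> \<in> ruelle_ker \<nu> f"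
    by (auto simp: ruelle_ker_def fun_eq_iff \<zeta>_def intro!: Lip_diff Lip_add \<psi> vL Lip_shift Lip_const)
  \<comment> \<open>In \<zeta> the coboundary of \<open>v\<close> was added to \<psi>; the statement
    recovers \<psi> from \<zeta>, hence the witness is the negative of \<open>v\<close>.\<close>
  then show thesis
    by (rule that[OF _ Lip_uminus[OF vL], of _ c]) (simp add: \<zeta>_def)
qed

section \<open>Borel probabilities on the symbolic space\<close>

lemma open_seq_dist_ball: "open {y. seq_dist c y < (e::real)}" for c :: "nat \<Rightarrow> 'a"
  by (intro open_Collect_less continuous_on_const continuous_seq_dist dist_le_1)

lemma open_contains_seq_dist_ball:
  assumes "open U" "x \<in> (U :: (nat \<Rightarrow> 'a) set)"
  obtains r where "r > 0" "{y. seq_dist x y < r} \<subseteq> U"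
proof -
  interpret Metric_space UNIV "seq_dist :: (nat \<Rightarrow> 'a) \<Rightarrow> _"
    by (rule Metric_space_seq_dist[OF dist_le_1])
  have "openin mtopology U"
    using assms(1) unfolding mtopology_seq_dist[OF dist_le_1] by simp
  then obtain r where "r > 0" "mball x r \<subseteq> U"
    using assms(2) unfolding openin_mtopology by blast
  then show thesis by (intro that[of r]) (auto simp: mball_def)
qed

text \<open>Compactness gives finitely many centres for each radius 1 / (n + 1). The balls of this
  countable family that lie inside \<open>U\<close> already exhaust it.\<close>

lemma open_countable_balls:
  assumes "open (U :: (nat \<Rightarrow> 'a) set)"
  obtains I where "countable I" "U = (\<Union>(c, e)\<in>I. {y. seq_dist c y < e})"
proof -
  have "\<exists>K. finite K \<and> UNIV \<subseteq> (\<Union>c\<in>K. {y :: nat \<Rightarrow> 'a. seq_dist c y < 1 / real (Suc n)})" for n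
  proof -
    have "UNIV \<subseteq> (\<Union>c\<in>UNIV. {y :: nat \<Rightarrow> 'a. seq_dist c y < 1 / real (Suc n)})"
    proof
      fix y :: "nat \<Rightarrow> 'a"
      show "y \<in> (\<Union>c\<in>UNIV. {y. seq_dist c y < 1 / real (Suc n)})"
        by (intro UN_I[of y]) auto
    qed
    from compactE_image[OF compact_seqs open_seq_dist_ball this] show ?thesis by metis
  qed
  then have "\<exists>K. \<forall>n. finite (K n) \<and> UNIV \<subseteq> (\<Union>c\<in>K n. {y :: nat \<Rightarrow> 'a. seq_dist c y < 1 / real (Suc n)})"
    by (intro choice allI)
  then obtain K where K: "\<And>n. finite (K n)"
    and cover: "\<And>n. UNIV \<subseteq> (\<Union>c\<in>K n. {y :: nat \<Rightarrow> 'a. seq_dist c y < 1 / real (Suc n)})"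
    by blast
  define I where "I = {(c, e). {y. seq_dist c y < e} \<subseteq> U} \<inter> (\<Union>n. K n \<times> {1 / real (Suc n)})"
  have "countable (\<Union>n. K n \<times> {1 / real (Suc n)})"
    by (intro countable_UN countable_SIGMA) (auto intro: countable_finite K)
  then have "countable I"
    unfolding I_def by (rule countable_Int2)
  moreover have "U = (\<Union>(c, e)\<in>I. {y. seq_dist c y < e})"
  proof (intro equalityI subsetI)
    fix x assume "x \<in> U"
    then obtain r where r: "r > 0" "{y. seq_dist x y < r} \<subseteq> U"
      using open_contains_seq_dist_ball[OF assms] by blast
    \<comment> \<open>Half of \<open>r\<close>, because the point is itself up to one radius away
      from the centre.\<close>
    obtain n where n: "1 / real (Suc n) < r / 2"
      using r(1) reals_Archimedean[of "r / 2"] by (auto simp: inverse_eq_divide)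
    obtain c where c: "c \<in> K n" "seq_dist c x < 1 / real (Suc n)" using cover[of n] by blast
    have "{y. seq_dist c y < 1 / real (Suc n)} \<subseteq> U"
    proof
      fix y assume "y \<in> {y. seq_dist c y < 1 / real (Suc n)}"
      then have "seq_dist x y < r"
        using seq_dist_triangle[of x y c] c n by (simp add: seq_dist_commute)
      then show "y \<in> U" using r(2) by auto
    qed
    then show "x \<in> (\<Union>(c, e)\<in>I. {y. seq_dist c y < e})"
      using c by (auto simp: I_def intro!: bexI[of _ "(c, 1 / real (Suc n))"])
  qed (auto simp: I_def)
  ultimately show thesis by (rule that)
qed

text \<open>The measure built coordinate by coordinate lives on the product sigma-algebra, whereas
  Lipschitz functions are Borel. The two agree because balls are product measurable and open sets
  are countable unions of balls.\<close>

lemma sets_PiM_seqs: "sets (PiM UNIV (\<lambda>_ :: nat. borel :: 'a measure)) = sets borel"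
proof
  show "sets (PiM UNIV (\<lambda>_ :: nat. borel :: 'a measure)) \<subseteq> sets borel"
    by (rule sets_PiM_subset_borel)
  let ?P = "PiM UNIV (\<lambda>_ :: nat. borel :: 'a measure)"
  have ball: "{y. seq_dist c y < e} \<in> sets ?P" for c :: "nat \<Rightarrow> 'a" and e
  proof -
    have "(\<lambda>y. dist (c n) (y n)) \<in> borel_measurable ?P" for n
      by (rule measurable_compose[OF measurable_component_singleton])
         (auto intro!: borel_measurable_continuous_onI continuous_intros)
    then have "(\<lambda>y. seq_dist c y) \<in> borel_measurable ?P"
      unfolding seq_dist_def by (intro borel_measurable_suminf borel_measurable_times) auto
    then have "{y \<in> space ?P. seq_dist c y < e} \<in> sets ?P"
      by measurable
    then show ?thesis by (simp add: space_PiM)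
  qed
  have "U \<in> sets ?P" if U: "open U" for U
  proof -
    obtain I where I: "countable I" "U = (\<Union>(c, e)\<in>I. {y. seq_dist c y < e})"
      using open_countable_balls[OF U] .
    show ?thesis
      unfolding I(2) by (rule sets.countable_UN'[OF I(1)]) (use ball in auto)
  qed
  then have "{S. open S} \<subseteq> sets ?P" by blast
  then have "sigma_sets (space ?P) {S. open S} \<subseteq> sets ?P"
    by (rule sets.sigma_sets_subset)
  then show "sets borel \<subseteq> sets ?P"
    by (simp add: borel_def space_PiM)
qed

lemma measurable_case_nat_borel:
  assumes "f \<in> N \<rightarrow>\<^sub>M (borel :: 'a measure)" "g \<in> N \<rightarrow>\<^sub>M borel"
  shows "(\<lambda>x. case_nat (f x) (g x)) \<in> N \<rightarrow>\<^sub>M borel"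
proof -
  note cong = measurable_cong_sets[OF refl sets_PiM_seqs, of N]
  have "g \<in> N \<rightarrow>\<^sub>M PiM UNIV (\<lambda>_. borel)" unfolding cong by fact
  from measurable_case_nat'[OF assms(1) this] show ?thesis unfolding cong .
qed

text \<open>The positivity sets of nonnegative Lipschitz functions are closed under intersection, by
  taking products, and contain all balls, by the truncation \<open>max 0 (e - seq_dist c y)\<close>.
  Hence they generate the Borel sets and a probability is determined by its values on them.\<close>

lemma borel_prob_eqI:
  assumes \<mu>: "borel_prob (\<mu> :: (nat \<Rightarrow> 'a) measure)" and \<mu>': "borel_prob \<mu>'"
    and eq: "\<And>w. w \<in> Lip \<Longrightarrow> (\<integral>x. w x \<partial>\<mu>) = (\<integral>x. w x \<partial>\<mu>')"
  shows "\<mu> = \<mu>'"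
proof -
  let ?E = "{{x :: nat \<Rightarrow> 'a. w x > 0} | w. w \<in> Lip \<and> (\<forall>x. 0 \<le> w x)}"
  have E_sets: "A \<in> sets borel" if "A \<in> ?E" for A
  proof -
    from that obtain w where w: "A = {x. w x > 0}" "w \<in> Lip" by blast
    have "open A"
      unfolding w(1) by (intro open_Collect_less continuous_on_const Lip_continuous w(2))
    then show ?thesis by simp
  qed
  have int: "Int_stable ?E"
  proof (rule Int_stableI)
    fix A B assume "A \<in> ?E" "B \<in> ?E"
    then obtain w v where wv: "A = {x. w x > 0}" "w \<in> Lip" "\<forall>x. 0 \<le> w x"
      "B = {x. v x > 0}" "v \<in> Lip" "\<forall>x. 0 \<le> v x" by blast
    have "A \<inter> B = {x. w x * v x > 0}"
      using wv(3,6) by (auto simp: wv(1,4) zero_less_mult_iff dest: order_less_le_trans)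
    then show "A \<inter> B \<in> ?E"
      using wv by (intro CollectI exI[of _ "\<lambda>x. w x * v x"]) (auto intro: Lip_mult)
  qed
  have gen: "sets borel = sigma_sets UNIV ?E"
  proof
    show "sigma_sets UNIV ?E \<subseteq> sets borel"
      using sets.sigma_sets_subset'[of ?E borel UNIV] E_sets by (simp add: subset_iff)
    have ball: "{y. seq_dist c y < e} \<in> ?E" for c :: "nat \<Rightarrow> 'a" and e
    proof -
      have "lip_le 1 (\<lambda>y. max 0 (e - seq_dist c y))"
        unfolding lip_le_def
      proof (intro allI)
        fix x y
        show "max 0 (e - seq_dist c x) - max 0 (e - seq_dist c y) \<le> 1 * seq_dist x y"
          using seq_dist_triangle[of c y x] seq_dist_nonneg[of x y] by linarith
      qed
      then show ?thesis
        by (intro CollectI exI[of _ "\<lambda>y. max 0 (e - seq_dist c y)"]) (auto dest: lip_le_Lip)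
    qed
    have "U \<in> sigma_sets UNIV ?E" if U: "open U" for U
    proof -
      obtain I where I: "countable I" "U = (\<Union>(c, e)\<in>I. {y. seq_dist c y < e})"
        using open_countable_balls[OF U] .
      have "(\<Union>i\<in>I. case i of (c, e) \<Rightarrow> {y. seq_dist c y < e}) \<in> sigma_sets UNIV ?E"
      proof (rule sigma_sets_UNION)
        show "countable ((\<lambda>i. case i of (c, e) \<Rightarrow> {y. seq_dist c y < e}) ` I)" using I(1) by simp
        show "A \<in> sigma_sets UNIV ?E" if "A \<in> (\<lambda>i. case i of (c, e) \<Rightarrow> {y. seq_dist c y < e}) ` I" for A
          using that ball by (intro sigma_sets.Basic) auto
      qed
      then show ?thesis using I(2) by simp
    qed
    then have "sigma_sets UNIV {S. open S} \<subseteq> sigma_sets UNIV ?E"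
      by (intro sigma_sets_mono) blast
    then show "sets borel \<subseteq> sigma_sets UNIV ?E"
      by (simp add: borel_def)
  qed
  \<comment> \<open>The Lipschitz functions \<open>1 - exp (- real n * w x)\<close> increase to the
    indicator of the positivity set, so its measure is determined by Lipschitz integrals.\<close>
  have meas: "measure M A = lim (\<lambda>n. \<integral>x. 1 - exp (- real n * w x) \<partial>M)"
    if M: "borel_prob (M :: (nat \<Rightarrow> 'a) measure)" and w: "w \<in> Lip" "\<forall>x. 0 \<le> w x" "A = {x. w x > 0}" for M A w
  proof -
    interpret M: prob_space M using M by (simp add: borel_prob_def)
    have sets: "sets M = sets borel" using M by (simp add: borel_prob_def)
    have L: "(\<lambda>x. 1 - exp (- real n * w x)) \<in> Lip" for n
      by (intro Lip_diff Lip_const Lip_exp Lip_cmult w)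
    have "(\<lambda>n. \<integral>x. 1 - exp (- real n * w x) \<partial>M) \<longlonglongrightarrow> (\<integral>x. indicat_real A x \<partial>M)"
    proof (rule integral_dominated_convergence[where w = "\<lambda>_. 1"])
      show "AE x in M. (\<lambda>n. 1 - exp (- real n * w x)) \<longlonglongrightarrow> indicat_real A x"
      proof (intro AE_I2)
        fix x
        show "(\<lambda>n. 1 - exp (- real n * w x)) \<longlonglongrightarrow> indicat_real A x"
        proof (cases "w x > 0")
          case True
          then have "exp (- w x) < 1" by simp
          then have "(\<lambda>n. 1 - exp (- w x) ^ n) \<longlonglongrightarrow> 1 - 0"
            by (intro tendsto_intros LIMSEQ_realpow_zero) auto
          then show ?thesis using True by (simp add: w(3) flip: exp_of_nat_mult)
        next
          case False
          then have "w x = 0" using w(2)[rule_format, of x] by simp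
          then show ?thesis by (simp add: w(3))
        qed
      qed
      show "AE x in M. norm (1 - exp (- real n * w x)) \<le> 1" for n
        using w(2) by (intro AE_I2) simp
    qed (use Lip_integrable[OF M L] E_sets w sets in \<open>auto intro!: borel_measurable_indicator\<close>)
    moreover have "A \<in> sets M" using E_sets w sets by blast
    ultimately show ?thesis by (simp add: limI sets.sets_into_space Int_absorb2)
  qed
  interpret \<mu>: prob_space \<mu> using \<mu> by (simp add: borel_prob_def)
  interpret \<mu>': prob_space \<mu>' using \<mu>' by (simp add: borel_prob_def)
  show ?thesis
  proof (rule measure_eqI_generator_eq[OF int, where \<Omega> = UNIV and A = "\<lambda>_. UNIV"])
    show "emeasure \<mu> X = emeasure \<mu>' X" if "X \<in> ?E" for X
    proof -
      from that obtain w where w: "X = {x. w x > 0}" "w \<in> Lip" "\<forall>x. 0 \<le> w x" by blast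
      have L: "(\<lambda>x. 1 - exp (- real n * w x)) \<in> Lip" for n
        by (intro Lip_diff Lip_const Lip_exp Lip_cmult w)
      show ?thesis
        unfolding \<mu>.emeasure_eq_measure \<mu>'.emeasure_eq_measure
          meas[OF \<mu> w(2,3,1)] meas[OF \<mu>' w(2,3,1)] eq[OF L] ..
    qed
    show "sets \<mu> = sigma_sets UNIV ?E" "sets \<mu>' = sigma_sets UNIV ?E"
      using \<mu> \<mu>' gen by (simp_all add: borel_prob_def)
    show "range (\<lambda>_ :: nat. UNIV) \<subseteq> ?E"
      using Lip_const[of 1] by (auto intro!: exI[of _ "\<lambda>_. 1"])
  qed auto
qed

end

section \<open>Existence of Gibbs probabilities\<close>

text \<open>
  \<open>cyl_weight f k \<omega> x\<close> is the weight that the \<open>k\<close>-th iterate of the Ruelle operator at \<open>x\<close> gives to the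
  preimage \<open>(\<omega> 0, \<dots>, \<omega> (k - 1), x 0, x 1, \<dots>)\<close>, which is \<open>comb_seq k \<omega> x\<close>.
\<close>

primrec cyl_weight :: "((nat \<Rightarrow> 'a) \<Rightarrow> real) \<Rightarrow> nat \<Rightarrow> (nat \<Rightarrow> 'a) \<Rightarrow> (nat \<Rightarrow> 'a) \<Rightarrow> real" where
  "cyl_weight f 0 \<omega> x = 1"
| "cyl_weight f (Suc k) \<omega> x = cyl_weight f k \<omega> (case_nat (\<omega> k) x) * exp (f (case_nat (\<omega> k) x))"

lemma cyl_weight_cong: "(\<And>i. i < k \<Longrightarrow> \<omega> i = \<omega>' i) \<Longrightarrow> cyl_weight f k \<omega> x = cyl_weight f k \<omega>' x"
  by (induction k arbitrary: x) simp_all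

lemma comb_seq_cong: "(\<And>i. i < k \<Longrightarrow> \<omega> i = \<omega>' i) \<Longrightarrow> comb_seq k \<omega> x = comb_seq k \<omega>' x"
  by (auto simp: comb_seq_def)

lemma comb_seq_self: "comb_seq k x (\<lambda>n. x (n + k)) = x"
  by (auto simp: comb_seq_def)

context full_shift
begin

lemma seq_dist_comb_seq:
  "seq_dist (comb_seq k \<omega> x) (comb_seq k \<omega> (y :: nat \<Rightarrow> 'a)) = (1 / 2) ^ k * seq_dist x y"
  by (induction k arbitrary: x y) (simp_all add: comb_seq_0 comb_seq_Suc)

text \<open>Replacing everything from coordinate \<open>k\<close> on moves a point by at most
  2^(-k). Conditioning on \<open>k\<close> coordinates will therefore recover a Lipschitz function
  uniformly.\<close>

lemma lip_le_comb_seq_self: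
  assumes "lip_le L h" "0 \<le> L"
  shows "\<bar>h (comb_seq k x y) - h (x :: nat \<Rightarrow> 'a)\<bar> \<le> L * (1 / 2) ^ k"
proof -
  have "seq_dist (comb_seq k x y) x \<le> (1 / 2) ^ k * 1"
    using seq_dist_comb_seq[of k x y "\<lambda>n. x (n + k)"]
    by (simp only: comb_seq_self) (intro mult_left_mono seq_dist_le_1, simp)
  then have "L * seq_dist (comb_seq k x y) x \<le> L * (1 / 2) ^ k"
    using assms(2) by (intro mult_left_mono) simp_all
  then show ?thesis
    using lip_leD_abs[OF assms(1), of "comb_seq k x y" x] by linarith
qed

lemma Lip_case_nat:
  assumes "w \<in> Lip"
  shows "(\<lambda>x. w (case_nat a (x :: nat \<Rightarrow> 'a))) \<in> Lip"
proof -
  obtain L where L: "L > 0" "lip_le L w" using Lip_lip_le[OF assms] .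
  have "lip_le (L / 2) (\<lambda>x. w (case_nat a x))"
    unfolding lip_le_def
  proof (intro allI)
    fix x y :: "nat \<Rightarrow> 'a"
    show "w (case_nat a x) - w (case_nat a y) \<le> L / 2 * seq_dist x y"
      using lip_leD[OF L(2), of "case_nat a x" "case_nat a y"] by simp
  qed
  then show ?thesis by (rule lip_le_Lip)
qed

lemma Lip_comb_seq: "h \<in> Lip \<Longrightarrow> (\<lambda>x. h (comb_seq k \<omega> (x :: nat \<Rightarrow> 'a))) \<in> Lip"
proof (induction k)
  case (Suc k)
  from Lip_case_nat[OF Suc.IH[OF Suc.prems], of "\<omega> k"] show ?case by (simp add: comb_seq_Suc)
qed (simp add: comb_seq_0)

lemma Lip_cyl_weight:
  assumes "f \<in> Lip"
  shows "cyl_weight f k \<omega> \<in> (Lip :: ((nat \<Rightarrow> 'a) \<Rightarrow> real) set)"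
proof (induction k)
  case 0
  show ?case using Lip_const[of 1] by simp
next
  case (Suc k)
  have "cyl_weight f (Suc k) \<omega> = (\<lambda>x. cyl_weight f k \<omega> (case_nat (\<omega> k) x) * exp (f (case_nat (\<omega> k) x)))"
    by (simp add: fun_eq_iff)
  then show ?case
    using Lip_mult[OF Lip_case_nat[OF Suc] Lip_case_nat[OF Lip_exp[OF assms]]] by simp
qed

lemma measurable_comb_seq_borel:
  assumes "\<And>i. i < k \<Longrightarrow> (\<lambda>p. u p i) \<in> X \<rightarrow>\<^sub>M (borel :: 'a measure)" "v \<in> X \<rightarrow>\<^sub>M borel"
  shows "(\<lambda>p. comb_seq k (u p) (v p)) \<in> X \<rightarrow>\<^sub>M borel"
  using assms
proof (induction k arbitrary: v)
  case (Suc k)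
  then have "(\<lambda>p. case_nat (u p k) (v p)) \<in> X \<rightarrow>\<^sub>M borel"
    by (intro measurable_case_nat_borel) auto
  from Suc.IH[OF Suc.prems(1) this] show ?case by (simp add: comb_seq_Suc)
qed (simp add: comb_seq_0)

lemma measurable_cyl_weight:
  assumes f: "f \<in> Lip"
  assumes "\<And>i. i < k \<Longrightarrow> (\<lambda>p. u p i) \<in> X \<rightarrow>\<^sub>M (borel :: 'a measure)" "v \<in> X \<rightarrow>\<^sub>M borel"
  shows "(\<lambda>p. cyl_weight f k (u p) (v p)) \<in> borel_measurable X"
  using assms(2,3)
proof (induction k arbitrary: v)
  case (Suc k)
  then have v: "(\<lambda>p. case_nat (u p k) (v p)) \<in> X \<rightarrow>\<^sub>M borel"
    by (intro measurable_case_nat_borel) auto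
  have "(\<lambda>p. cyl_weight f k (u p) (case_nat (u p k) (v p))) \<in> borel_measurable X"
    by (rule Suc.IH[OF Suc.prems(1) v]) auto
  moreover have "(\<lambda>p. exp (f (case_nat (u p k) (v p)))) \<in> borel_measurable X"
    by (rule measurable_compose[OF v Lip_measurable[OF Lip_exp[OF f]]])
  ultimately show ?case by simp
qed simp

section \<open>The dual operator and the limit functional\<close>

definition push :: "((nat \<Rightarrow> 'a) \<Rightarrow> real) \<Rightarrow> (nat \<Rightarrow> 'a) measure \<Rightarrow> (nat \<Rightarrow> 'a) measure" where
  "push f \<mu> = distr (density (\<nu> \<Otimes>\<^sub>M \<mu>) (\<lambda>(a, x). ennreal (exp (f (case_nat a x))))) borel
     (\<lambda>(a, x). case_nat a x)"

lemma
  assumes f: "f \<in> normalized \<nu>" and \<mu>: "borel_prob \<mu>"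
  shows borel_prob_push: "borel_prob (push f \<mu>)"
    and integral_push: "w \<in> Lip \<Longrightarrow> (\<integral>x. w x \<partial>push f \<mu>) = (\<integral>x. ruelle \<nu> f w x \<partial>\<mu>)"
proof -
  interpret \<mu>: prob_space \<mu> using \<mu> by (simp add: borel_prob_def)
  have [measurable_cong]: "sets \<mu> = sets borel" using \<mu> by (simp add: borel_prob_def)
  interpret P: pair_prob_space \<nu> \<mu> ..
  have [measurable]: "(\<lambda>p. case_nat (fst p) (snd p)) \<in> \<nu> \<Otimes>\<^sub>M \<mu> \<rightarrow>\<^sub>M borel"
    by (rule measurable_case_nat_borel) measurable
  have meas: "(\<lambda>p. w (case_nat (fst p) (snd p))) \<in> borel_measurable (\<nu> \<Otimes>\<^sub>M \<mu>)" if "w \<in> Lip" for w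
    by (rule measurable_compose[OF _ Lip_measurable[OF that]]) measurable
  note fL = normalizedD(1)[OF f]
  note [measurable] = meas[OF fL]
  have push: "push f \<mu> = distr (density (\<nu> \<Otimes>\<^sub>M \<mu>) (\<lambda>p. ennreal (exp (f (case_nat (fst p) (snd p)))))) borel
     (\<lambda>p. case_nat (fst p) (snd p))"
    unfolding push_def by (simp add: case_prod_unfold)
  have int: "integrable (\<nu> \<Otimes>\<^sub>M \<mu>) (\<lambda>p. exp (f (case_nat (fst p) (snd p))) * w (case_nat (fst p) (snd p)))"
      and fub: "(\<integral>p. exp (f (case_nat (fst p) (snd p))) * w (case_nat (fst p) (snd p)) \<partial>(\<nu> \<Otimes>\<^sub>M \<mu>))
        = (\<integral>x. ruelle \<nu> f w x \<partial>\<mu>)" if w: "w \<in> Lip" for w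
  proof -
    have L: "(\<lambda>x. exp (f x) * w x) \<in> Lip" by (intro Lip_mult Lip_exp fL w)
    obtain C where C: "\<And>x. \<bar>exp (f x) * w x\<bar> \<le> C" using Lip_bounded[OF L] by blast
    show int: "integrable (\<nu> \<Otimes>\<^sub>M \<mu>) (\<lambda>p. exp (f (case_nat (fst p) (snd p))) * w (case_nat (fst p) (snd p)))"
      using C meas[OF w] by (intro P.integrable_const_bound[of _ C]) auto
    show "(\<integral>p. exp (f (case_nat (fst p) (snd p))) * w (case_nat (fst p) (snd p)) \<partial>(\<nu> \<Otimes>\<^sub>M \<mu>))
        = (\<integral>x. ruelle \<nu> f w x \<partial>\<mu>)"
      using P.integral_snd[of "\<lambda>a x. exp (f (case_nat a x)) * w (case_nat a x)"] int
      by (simp add: ruelle_def case_prod_unfold)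
  qed
  show "(\<integral>x. w x \<partial>push f \<mu>) = (\<integral>x. ruelle \<nu> f w x \<partial>\<mu>)" if w: "w \<in> Lip"
    unfolding push fub[OF w, symmetric] using Lip_measurable[OF w] w
    by (subst integral_distr) (auto simp: integral_density)
  have "emeasure (density (\<nu> \<Otimes>\<^sub>M \<mu>) (\<lambda>p. ennreal (exp (f (case_nat (fst p) (snd p)))))) (space (\<nu> \<Otimes>\<^sub>M \<mu>))
      = (\<integral>\<^sup>+p. ennreal (exp (f (case_nat (fst p) (snd p)))) \<partial>(\<nu> \<Otimes>\<^sub>M \<mu>))"
  proof (subst emeasure_density)
    show "space (\<nu> \<Otimes>\<^sub>M \<mu>) \<in> sets (\<nu> \<Otimes>\<^sub>M \<mu>)" by (rule sets.top)
  qed (auto intro!: nn_integral_cong)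
  also have "\<dots> = ennreal (\<integral>p. exp (f (case_nat (fst p) (snd p))) \<partial>(\<nu> \<Otimes>\<^sub>M \<mu>))"
    using int[OF Lip_const[of 1]] by (intro nn_integral_eq_integral) auto
  also have "\<dots> = 1"
    using fub[OF Lip_const[of 1]] by (simp add: normalizedD(2)[OF f] \<mu>.prob_space)
  finally have "prob_space (density (\<nu> \<Otimes>\<^sub>M \<mu>) (\<lambda>p. ennreal (exp (f (case_nat (fst p) (snd p))))))"
    by (intro prob_spaceI) simp
  then have "prob_space (push f \<mu>)"
    unfolding push by (rule prob_space.prob_space_distr) simp
  then show "borel_prob (push f \<mu>)"
    by (simp add: borel_prob_def push)
qed

context
  fixes f :: "(nat \<Rightarrow> 'a) \<Rightarrow> real"
  assumes f: "f \<in> normalized \<nu>"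
begin

private lemma fL: "f \<in> Lip"
  by (rule normalizedD(1)[OF f])

text \<open>Iterating the dual operator from a point mass represents the iterates of
  \<open>ruelle\<close> at that point as integrals against probabilities. Monotonicity and Fubini
  are then available before the limit is taken.\<close>

private definition mu :: "nat \<Rightarrow> (nat \<Rightarrow> 'a) measure" where
  "mu n = (push f ^^ n) (return borel (\<lambda>_. undefined))"

text \<open>The Gibbs integral, so far only a functional on Lipschitz functions. The rest of the
  construction finds a measure that represents it.\<close>

private definition limit :: "((nat \<Rightarrow> 'a) \<Rightarrow> real) \<Rightarrow> real" where
  "limit w = lim (\<lambda>n. \<integral>x. w x \<partial>mu n)"

private lemma mu: "borel_prob (mu n)"
proof (induction n)
  case 0
  show ?case by (simp add: mu_def borel_prob_def prob_space_return)
next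
  case (Suc n)
  then show ?case using borel_prob_push[OF f] by (simp add: mu_def)
qed

private lemma mu_prob: "prob_space (mu n)" and sets_mu [measurable_cong]: "sets (mu n) = sets borel"
  using mu[of n] by (auto simp: borel_prob_def)

private lemma integral_mu_Suc: "w \<in> Lip \<Longrightarrow> (\<integral>x. w x \<partial>mu (Suc n)) = (\<integral>x. ruelle \<nu> f w x \<partial>mu n)"
  using integral_push[OF f mu, of w n] by (simp add: mu_def)

private lemma integral_mu: "w \<in> Lip \<Longrightarrow> (\<integral>x. w x \<partial>mu n) = (ruelle \<nu> f ^^ n) w (\<lambda>_. undefined)"
proof (induction n arbitrary: w)
  case 0
  then show ?case by (simp add: mu_def integral_return Lip_measurable)
next
  case (Suc n)
  then show ?case
    by (simp add: integral_mu_Suc ruelle_Lip fL funpow_swap1)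
qed

private lemma limit: "w \<in> Lip \<Longrightarrow> (\<lambda>n. \<integral>x. w x \<partial>mu n) \<longlonglongrightarrow> limit w"
proof -
  assume w: "w \<in> Lip"
  obtain c where "\<And>x. (\<lambda>n. (ruelle \<nu> f ^^ n) w x) \<longlonglongrightarrow> c"
    using ruelle_iterates_convergent[OF f w] by blast
  then have "(\<lambda>n. \<integral>x. w x \<partial>mu n) \<longlonglongrightarrow> c" by (simp add: integral_mu[OF w])
  then show ?thesis unfolding limit_def by (simp add: limI)
qed

private lemma limit_ruelle:
  assumes w: "w \<in> Lip"
  shows "limit (ruelle \<nu> f w) = limit w"
  using LIMSEQ_unique[OF limit[OF ruelle_Lip[OF fL w]]] LIMSEQ_Suc[OF limit[OF w]]
  by (simp add: integral_mu_Suc[OF w])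

private lemma limit_const: "limit (\<lambda>_. c) = c"
  using LIMSEQ_unique[OF limit[OF Lip_const[of c]], of c]
  by (simp add: prob_space.prob_space[OF mu_prob])

private lemma limit_add_const: "w \<in> Lip \<Longrightarrow> limit (\<lambda>x. w x + c) = limit w + c"
proof -
  assume w: "w \<in> Lip"
  have "(\<integral>x. w x + c \<partial>mu n) = (\<integral>x. w x \<partial>mu n) + c" for n
    using Lip_integrable[OF mu w, of n] Lip_integrable[OF mu Lip_const[of c], of n]
      prob_space.prob_space[OF mu_prob[of n]]
    by (subst Bochner_Integration.integral_add) simp_all
  then show ?thesis
    using LIMSEQ_unique[OF limit[OF Lip_add[OF w Lip_const[of c]]]] tendsto_add[OF limit[OF w] tendsto_const[of c]]
    by simp
qed

private lemma limit_mono: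
  assumes "w \<in> Lip" "v \<in> Lip" "\<And>x. w x \<le> v x"
  shows "limit w \<le> limit v"
  by (rule LIMSEQ_le[OF limit[OF assms(1)] limit[OF assms(2)]])
     (auto intro!: integral_mono Lip_integrable mu assms)

private lemma limit_cmult: "w \<in> Lip \<Longrightarrow> limit (\<lambda>x. c * w x) = c * limit w"
  using LIMSEQ_unique[OF limit[OF Lip_cmult[of w c]] , of "c * limit w"]
    tendsto_mult_left[OF limit[of w], of c] by simp

text \<open>Invariance \<open>limit (ruelle \<nu> f w) = limit w\<close> with the integral over the
  new symbol taken outside: Fubini for each \<open>mu n\<close>, then dominated convergence. This is
  the consistency relation between cylinders of successive lengths.\<close>

private lemma limit_averaging:
  assumes w: "w \<in> Lip"
  shows "has_bochner_integral \<nu> (\<lambda>b. limit (\<lambda>x. w (case_nat b x) * exp (f (case_nat b x)))) (limit w)"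
proof -
  define K where "K = (\<lambda>x. exp (f x) * w x)"
  have K: "K \<in> Lip" unfolding K_def by (intro Lip_mult Lip_exp fL w)
  obtain C where C: "\<And>x. \<bar>K x\<bar> \<le> C" using Lip_bounded[OF K] by blast
  have meas: "(\<lambda>p. K (case_nat (fst p) (snd p))) \<in> borel_measurable (\<nu> \<Otimes>\<^sub>M mu n)" for n
    by (intro measurable_compose[OF measurable_case_nat_borel Lip_measurable[OF K]]) measurable
  define s where "s = (\<lambda>n b. \<integral>x. K (case_nat b x) \<partial>mu n)"
  have s_meas: "s n \<in> borel_measurable \<nu>" for n
  proof -
    interpret prob_space "mu n" by (rule mu_prob)
    show ?thesis
      unfolding s_def using meas[of n] by (intro borel_measurable_lebesgue_integral) (simp add: case_prod_unfold)
  qed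
  have s_lim: "(\<lambda>n. s n b) \<longlonglongrightarrow> limit (\<lambda>x. K (case_nat b x))" for b
    unfolding s_def by (rule limit[OF Lip_case_nat[OF K]])
  have s_bound: "norm (s n b) \<le> C" for n b
  proof -
    interpret prob_space "mu n" by (rule mu_prob)
    have "\<bar>\<integral>x. K (case_nat b x) \<partial>mu n\<bar> \<le> (\<integral>x. \<bar>K (case_nat b x)\<bar> \<partial>mu n)"
      by (rule integral_abs_bound)
    also have "\<dots> \<le> (\<integral>x. C \<partial>mu n)"
      by (intro integral_mono integrable_abs Lip_integrable[OF mu Lip_case_nat[OF K]] C) simp
    finally show ?thesis by (simp add: s_def prob_space)
  qed
  have lim_meas: "(\<lambda>b. limit (\<lambda>x. K (case_nat b x))) \<in> borel_measurable \<nu>"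
    by (rule borel_measurable_LIMSEQ_real[OF s_lim s_meas])
  have int: "integrable \<nu> (\<lambda>b. limit (\<lambda>x. K (case_nat b x)))"
    by (rule integrable_dominated_convergence[where w = "\<lambda>_. C" and s = s])
       (use lim_meas s_meas s_lim s_bound in auto)
  have conv: "(\<lambda>n. \<integral>b. s n b \<partial>\<nu>) \<longlonglongrightarrow> (\<integral>b. limit (\<lambda>x. K (case_nat b x)) \<partial>\<nu>)"
    by (rule integral_dominated_convergence[where w = "\<lambda>_. C"])
       (use lim_meas s_meas s_lim s_bound in auto)
  have "(\<integral>b. s n b \<partial>\<nu>) = (\<integral>x. ruelle \<nu> f w x \<partial>mu n)" for n
  proof -
    interpret prob_space "mu n" by (rule mu_prob)
    interpret P: pair_prob_space \<nu> "mu n" ..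
    have "integrable (\<nu> \<Otimes>\<^sub>M mu n) (\<lambda>p. K (case_nat (fst p) (snd p)))"
      using C meas[of n] by (intro P.integrable_const_bound[of _ C]) auto
    then show ?thesis
      using P.Fubini_integral[of "\<lambda>b x. K (case_nat b x)"]
      by (simp add: s_def ruelle_def K_def case_prod_unfold)
  qed
  then have "(\<lambda>n. \<integral>b. s n b \<partial>\<nu>) \<longlonglongrightarrow> limit w"
    using limit[OF ruelle_Lip[OF fL w]] limit_ruelle[OF w] by simp
  with conv int show ?thesis
    using LIMSEQ_unique by (auto simp: has_bochner_integral_iff K_def mult.commute)
qed

text \<open>
  The conditional expectation of \<open>h\<close> given the first \<open>k\<close> coordinates will be
  \<open>cyl_limit k h / cyl_limit k 1\<close>.
\<close>

private definition cyl_limit :: "nat \<Rightarrow> ((nat \<Rightarrow> 'a) \<Rightarrow> real) \<Rightarrow> (nat \<Rightarrow> 'a) \<Rightarrow> real" where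
  "cyl_limit k h \<omega> = limit (\<lambda>x. cyl_weight f k \<omega> x * h (comb_seq k \<omega> x))"

private lemma cyl_Lip: "h \<in> Lip \<Longrightarrow> (\<lambda>x. cyl_weight f k \<omega> x * h (comb_seq k \<omega> x)) \<in> Lip"
  by (intro Lip_mult Lip_cyl_weight Lip_comb_seq fL)

private lemma cyl_limit_0: "cyl_limit 0 h \<omega> = limit h"
  by (simp add: cyl_limit_def comb_seq_0)

private lemma cyl_limit_cong: "(\<And>i. i < k \<Longrightarrow> \<omega> i = \<omega>' i) \<Longrightarrow> cyl_limit k h \<omega> = cyl_limit k h \<omega>'"
  unfolding cyl_limit_def by (simp cong: cyl_weight_cong comb_seq_cong)

text \<open>Among the symbols of the cylinder, coordinate \<open>k\<close> is the one next to the
  tail, so integrating it out is \<open>limit_averaging\<close> for the cylinder function of length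
  \<open>k\<close>.\<close>

private lemma cyl_limit_Suc:
  assumes h: "h \<in> Lip"
  shows "has_bochner_integral \<nu> (\<lambda>b. cyl_limit (Suc k) h (fun_upd \<omega> k b)) (cyl_limit k h \<omega>)"
proof -
  have "cyl_limit (Suc k) h (fun_upd \<omega> k b) = limit (\<lambda>x. (cyl_weight f k \<omega> (case_nat b x)
      * h (comb_seq k \<omega> (case_nat b x))) * exp (f (case_nat b x)))" for b
    using cyl_weight_cong[of k "fun_upd \<omega> k b" \<omega> f] comb_seq_cong[of k "fun_upd \<omega> k b" \<omega>]
    by (simp add: cyl_limit_def comb_seq_Suc mult_ac)
  then show ?thesis
    using limit_averaging[OF cyl_Lip[OF h, of k \<omega>]] by (simp add: cyl_limit_def)
qed

private lemma cyl_limit_nonneg: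
  assumes "h \<in> Lip" "\<And>x. 0 \<le> h x"
  shows "0 \<le> cyl_limit k h \<omega>"
proof -
  have "0 \<le> cyl_weight f k \<omega> x" for x by (induction k arbitrary: x) auto
  then show ?thesis
    using limit_mono[OF Lip_const[of 0] cyl_Lip[OF assms(1)]] assms(2)
    by (simp add: cyl_limit_def limit_const)
qed

text \<open>Each factor of a weight is at least the minimum \<open>c\<close> of
  \<open>exp f\<close>. The normalizer is thus positive at every point, so the conditional laws are
  defined everywhere and not merely almost everywhere.\<close>

private lemma cyl_limit_pos: "0 < cyl_limit k (\<lambda>_. 1) \<omega>"
proof -
  obtain c where c: "c > 0" "\<And>x. c \<le> exp (f x)"
    using Lip_pos_bounded_below[OF Lip_exp[OF fL]] by auto
  have "c ^ k \<le> cyl_weight f k \<omega> x" for x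
  proof (induction k arbitrary: x)
    case (Suc k)
    have "0 \<le> cyl_weight f k \<omega> (case_nat (\<omega> k) x)"
      using c(1) order_trans[OF zero_le_power Suc] by simp
    then have "c ^ k * c \<le> cyl_weight f k \<omega> (case_nat (\<omega> k) x) * exp (f (case_nat (\<omega> k) x))"
      using c(1) by (intro mult_mono Suc c(2)) auto
    then show ?case by (simp add: mult.commute)
  qed simp
  then have "c ^ k \<le> cyl_limit k (\<lambda>_. 1) \<omega>"
    using limit_mono[OF Lip_const[of "c ^ k"] cyl_Lip[OF Lip_const[of 1]]]
    by (simp add: cyl_limit_def limit_const)
  then show ?thesis using c(1) by (meson less_le_trans zero_less_power)
qed

private lemma cyl_limit_measurable:
  assumes h: "h \<in> Lip" and u: "\<And>i. i < k \<Longrightarrow> (\<lambda>p. u p i) \<in> X \<rightarrow>\<^sub>M (borel :: 'a measure)"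
  shows "(\<lambda>p. cyl_limit k h (u p)) \<in> borel_measurable X"
  unfolding cyl_limit_def
proof (rule borel_measurable_LIMSEQ_real[OF limit[OF cyl_Lip[OF h]]])
  fix n
  interpret prob_space "mu n" by (rule mu_prob)
  have u': "(\<lambda>p. u (fst p) i) \<in> X \<Otimes>\<^sub>M mu n \<rightarrow>\<^sub>M borel" if "i < k" for i
    by (rule measurable_compose[OF measurable_fst u[OF that]])
  have v: "snd \<in> X \<Otimes>\<^sub>M mu n \<rightarrow>\<^sub>M borel" by measurable
  have "(\<lambda>p. cyl_weight f k (u (fst p)) (snd p) * h (comb_seq k (u (fst p)) (snd p)))
      \<in> borel_measurable (X \<Otimes>\<^sub>M mu n)"
    by (intro borel_measurable_times measurable_cyl_weight[OF fL u' v]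
        measurable_compose[OF measurable_comb_seq_borel[OF u' v] Lip_measurable[OF h]])
  then show "(\<lambda>p. \<integral>x. cyl_weight f k (u p) x * h (comb_seq k (u p) x) \<partial>mu n) \<in> borel_measurable X"
    by (intro borel_measurable_lebesgue_integral) (simp add: case_prod_unfold)
qed

text \<open>The ratio is a weighted mean of \<open>h\<close> over the cylinder around \<omega>,
  where \<open>h\<close> differs from \<open>h \<omega>\<close> by at most
  \<open>L * (1 / 2) ^ k\<close>.\<close>

private lemma cyl_limit_close:
  assumes h: "lip_le L h" "0 \<le> L"
  shows "\<bar>cyl_limit k h \<omega> / cyl_limit k (\<lambda>_. 1) \<omega> - h \<omega>\<bar> \<le> L * (1 / 2) ^ k"
proof -
  let ?Z = "cyl_limit k (\<lambda>_. 1) \<omega>" and ?e = "L * (1 / 2) ^ k"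
  note hL = lip_le_Lip[OF h(1)]
  have wL: "cyl_weight f k \<omega> \<in> Lip" by (rule Lip_cyl_weight[OF fL])
  have w0: "0 \<le> cyl_weight f k \<omega> x" for x by (induction k arbitrary: x) auto
  have Z: "?Z = limit (cyl_weight f k \<omega>)" by (simp add: cyl_limit_def)
  have "cyl_limit k h \<omega> \<le> limit (\<lambda>x. (h \<omega> + ?e) * cyl_weight f k \<omega> x)"
    unfolding cyl_limit_def
  proof (rule limit_mono[OF cyl_Lip[OF hL] Lip_cmult[OF wL]])
    fix x
    have "h (comb_seq k \<omega> x) \<le> h \<omega> + ?e" using lip_le_comb_seq_self[OF h, of k \<omega> x] by linarith
    from mult_right_mono[OF this w0[of x]]
    show "cyl_weight f k \<omega> x * h (comb_seq k \<omega> x) \<le> (h \<omega> + ?e) * cyl_weight f k \<omega> x"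
      by (simp add: mult.commute)
  qed
  moreover have "limit (\<lambda>x. (h \<omega> - ?e) * cyl_weight f k \<omega> x) \<le> cyl_limit k h \<omega>"
    unfolding cyl_limit_def
  proof (rule limit_mono[OF Lip_cmult[OF wL] cyl_Lip[OF hL]])
    fix x
    have "h \<omega> - ?e \<le> h (comb_seq k \<omega> x)" using lip_le_comb_seq_self[OF h, of k \<omega> x] by linarith
    from mult_right_mono[OF this w0[of x]]
    show "(h \<omega> - ?e) * cyl_weight f k \<omega> x \<le> cyl_weight f k \<omega> x * h (comb_seq k \<omega> x)"
      by (simp add: mult.commute)
  qed
  ultimately have "cyl_limit k h \<omega> \<le> (h \<omega> + ?e) * ?Z" "(h \<omega> - ?e) * ?Z \<le> cyl_limit k h \<omega>"
    by (simp_all add: limit_cmult[OF wL] Z)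
  then have "cyl_limit k h \<omega> / ?Z \<le> h \<omega> + ?e" "h \<omega> - ?e \<le> cyl_limit k h \<omega> / ?Z"
    by (simp_all add: cyl_limit_pos pos_divide_le_eq pos_le_divide_eq)
  then show ?thesis by linarith
qed

section \<open>Transition kernels and the Ionescu-Tulcea measure\<close>

private definition next_symbol :: "nat \<Rightarrow> (nat \<Rightarrow> 'a) \<Rightarrow> 'a measure" where
  "next_symbol k \<omega> =
     density \<nu> (\<lambda>b. ennreal (cyl_limit (Suc k) (\<lambda>_. 1) (fun_upd \<omega> k b) / cyl_limit k (\<lambda>_. 1) \<omega>))"

private lemma cyl_limit_upd_measurable:
  assumes h: "h \<in> Lip"
  shows "(\<lambda>b. cyl_limit (Suc k) h (fun_upd \<omega> k b)) \<in> borel_measurable \<nu>"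
  by (rule cyl_limit_measurable[OF h]) auto

text \<open>One step of the martingale property. The kernel is the law of coordinate
  \<open>k\<close> given the earlier ones; the new normalizer cancels against its density and
  \<open>cyl_limit_Suc\<close> integrates the coordinate out. The case \<open>h = 1\<close> gives
  the kernel total mass 1.\<close>

private lemma nn_integral_next_symbol:
  assumes h: "h \<in> Lip" "\<And>x. 0 \<le> h x"
  shows "(\<integral>\<^sup>+b. ennreal (cyl_limit (Suc k) h (fun_upd \<omega> k b) / cyl_limit (Suc k) (\<lambda>_. 1) (fun_upd \<omega> k b))
      \<partial>next_symbol k \<omega>) = ennreal (cyl_limit k h \<omega> / cyl_limit k (\<lambda>_. 1) \<omega>)"
proof -
  note [measurable] = cyl_limit_upd_measurable[OF h(1)] cyl_limit_upd_measurable[OF Lip_const]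
  let ?Z = "cyl_limit k (\<lambda>_. 1) \<omega>" and ?Z' = "\<lambda>b. cyl_limit (Suc k) (\<lambda>_. 1) (fun_upd \<omega> k b)"
    and ?W' = "\<lambda>b. cyl_limit (Suc k) h (fun_upd \<omega> k b)"
  have "(\<integral>\<^sup>+b. ennreal (?W' b / ?Z' b) \<partial>next_symbol k \<omega>)
      = (\<integral>\<^sup>+b. ennreal (?Z' b / ?Z) * ennreal (?W' b / ?Z' b) \<partial>\<nu>)"
    unfolding next_symbol_def by (subst nn_integral_density) auto
  also have "\<dots> = (\<integral>\<^sup>+b. ennreal (?W' b / ?Z) \<partial>\<nu>)"
  proof (rule nn_integral_cong)
    fix b
    have "?Z' b / ?Z * (?W' b / ?Z' b) = ?W' b / ?Z"
      using cyl_limit_pos[of "Suc k" "fun_upd \<omega> k b"] by (simp del: fun_upd_apply)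
    then show "ennreal (?Z' b / ?Z) * ennreal (?W' b / ?Z' b) = ennreal (?W' b / ?Z)"
      using cyl_limit_pos[of "Suc k" "fun_upd \<omega> k b"] cyl_limit_pos[of k \<omega>]
        cyl_limit_nonneg[OF h, of "Suc k" "fun_upd \<omega> k b"]
      by (simp add: ennreal_mult[symmetric] less_imp_le)
  qed
  also have "\<dots> = ennreal (\<integral>b. ?W' b / ?Z \<partial>\<nu>)"
    using cyl_limit_Suc[OF h(1), of k \<omega>] cyl_limit_pos[of k \<omega>] cyl_limit_nonneg[OF h]
    by (intro nn_integral_eq_integral) (auto simp: has_bochner_integral_iff intro!: AE_I2 divide_nonneg_nonneg less_imp_le)
  also have "(\<integral>b. ?W' b / ?Z \<partial>\<nu>) = cyl_limit k h \<omega> / ?Z"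
    using cyl_limit_Suc[OF h(1), of k \<omega>] by (simp add: has_bochner_integral_iff)
  finally show ?thesis .
qed

private lemma prob_space_next_symbol: "prob_space (next_symbol k \<omega>)"
proof
  have "emeasure (next_symbol k \<omega>) (space (next_symbol k \<omega>)) = (\<integral>\<^sup>+b. 1 \<partial>next_symbol k \<omega>)"
    by simp
  also have "\<dots> = (\<integral>\<^sup>+b. ennreal (cyl_limit (Suc k) (\<lambda>_. 1) (fun_upd \<omega> k b) / cyl_limit (Suc k) (\<lambda>_. 1) (fun_upd \<omega> k b))
      \<partial>next_symbol k \<omega>)"
    using cyl_limit_pos[of "Suc k"] by (intro nn_integral_cong) (simp add: less_imp_neq[symmetric] del: fun_upd_apply)
  also have "\<dots> = 1"
    using nn_integral_next_symbol[OF Lip_const[of 1], of k \<omega>] cyl_limit_pos[of k \<omega>] by simp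
  finally show "emeasure (next_symbol k \<omega>) (space (next_symbol k \<omega>)) = 1" .
qed

private lemma Ionescu_Tulcea_next_symbol: "Ionescu_Tulcea next_symbol (\<lambda>_. borel)"
  unfolding Ionescu_Tulcea_def
proof (intro conjI allI impI)
  fix k
  show "prob_space (next_symbol k \<omega>)" for \<omega>
    by (rule prob_space_next_symbol)
  show "next_symbol k \<in> PiM {0..<k} (\<lambda>_. borel) \<rightarrow>\<^sub>M subprob_algebra borel"
  proof (rule measurable_subprob_algebra)
    show "subprob_space (next_symbol k \<omega>)" for \<omega>
      by (rule prob_space_imp_subprob_space[OF prob_space_next_symbol])
    show "sets (next_symbol k \<omega>) = sets borel" for \<omega> by (simp add: next_symbol_def)
    fix A :: "'a set" assume A [measurable]: "A \<in> sets borel"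
    let ?X = "PiM {0..<k} (\<lambda>_. borel :: 'a measure)"
    have comp: "(\<lambda>p. fst p i) \<in> ?X \<Otimes>\<^sub>M \<nu> \<rightarrow>\<^sub>M borel" if "i < k" for i
      by (rule measurable_compose[OF measurable_fst measurable_component_singleton]) (use that in auto)
    have [measurable]: "(\<lambda>p. cyl_limit (Suc k) (\<lambda>_. 1) (fun_upd (fst p) k (snd p))) \<in> borel_measurable (?X \<Otimes>\<^sub>M \<nu>)"
    proof (rule cyl_limit_measurable[OF Lip_const])
      fix i assume "i < Suc k"
      then show "(\<lambda>p. (fun_upd (fst p) k (snd p)) i) \<in> ?X \<Otimes>\<^sub>M \<nu> \<rightarrow>\<^sub>M borel"
        using comp[of i] by (cases "i = k") auto
    qed
    have [measurable]: "(\<lambda>p. cyl_limit k (\<lambda>_. 1) (fst p)) \<in> borel_measurable (?X \<Otimes>\<^sub>M \<nu>)"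
      by (rule cyl_limit_measurable[OF Lip_const comp])
    have "(\<lambda>\<omega>. \<integral>\<^sup>+b. ennreal (cyl_limit (Suc k) (\<lambda>_. 1) (fun_upd \<omega> k b) / cyl_limit k (\<lambda>_. 1) \<omega>) * indicator A b \<partial>\<nu>)
        \<in> borel_measurable ?X"
      by (rule nu.borel_measurable_nn_integral) (simp add: case_prod_unfold)
    then show "(\<lambda>\<omega>. emeasure (next_symbol k \<omega>) A) \<in> borel_measurable ?X"
      unfolding next_symbol_def
      using cyl_limit_upd_measurable[OF Lip_const] by (subst emeasure_density) auto
  qed
qed

text \<open>The conditional expectations all have mean \<open>limit h\<close> and converge uniformly
  to \<open>h\<close>, so the Ionescu-Tulcea measure represents \<open>limit\<close>. The dual
  equation is then \<open>limit_ruelle\<close>.\<close>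

lemma gibbs_exists: "\<exists>\<mu>. borel_prob \<mu> \<and> ruelle_dual_eigen \<nu> f 1 \<mu>"
proof -
  interpret IT: Ionescu_Tulcea next_symbol "\<lambda>_. borel :: 'a measure"
    by (rule Ionescu_Tulcea_next_symbol)
  define C where "C = (\<lambda>k. IT.C 0 k (\<lambda>_. undefined))"
  have ratio_meas: "(\<lambda>\<omega>. ennreal (cyl_limit k h \<omega> / cyl_limit k (\<lambda>_. 1) \<omega>)) \<in> borel_measurable (PiM {0..<k} (\<lambda>_. borel))"
    if "h \<in> Lip" for h k
    by (intro measurable_compose[OF _ measurable_ennreal] borel_measurable_divide cyl_limit_measurable that Lip_const)
       auto
  have martingale: "(\<integral>\<^sup>+\<omega>. ennreal (cyl_limit k h \<omega> / cyl_limit k (\<lambda>_. 1) \<omega>) \<partial>C k) = ennreal (limit h)"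
    if h: "h \<in> Lip" "\<And>x. 0 \<le> h x" for h k
  proof (induction k)
    case 0
    show ?case
      unfolding C_def IT.C.simps(1)
    proof (subst nn_integral_return)
      show "(\<lambda>_. undefined) \<in> space (PiM {0..<0} (\<lambda>_ :: nat. borel :: 'a measure))" by (simp add: space_PiM)
    qed (use ratio_meas[OF h(1), of 0] in \<open>simp_all add: cyl_limit_0 limit_const\<close>)
  next
    case (Suc k)
    have space: "space (C k) = space (PiM {0..<k} (\<lambda>_. borel))"
      using IT.space_C[of "\<lambda>_. undefined" 0 k] by (simp add: C_def)
    have sets: "sets (C k) = sets (PiM {0..<k} (\<lambda>_. borel))"
      using IT.sets_C[of "\<lambda>_. undefined" 0 k] by (simp add: C_def)
    have eP: "IT.eP k \<in> C k \<rightarrow>\<^sub>M subprob_algebra (PiM {0..<Suc k} (\<lambda>_. borel))"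
      using IT.measurable_eP[of k] sets by (simp cong: measurable_cong_sets)
    have "(\<integral>\<^sup>+\<omega>. ennreal (cyl_limit (Suc k) h \<omega> / cyl_limit (Suc k) (\<lambda>_. 1) \<omega>) \<partial>C (Suc k))
       = (\<integral>\<^sup>+\<omega>. \<integral>\<^sup>+\<omega>'. ennreal (cyl_limit (Suc k) h \<omega>' / cyl_limit (Suc k) (\<lambda>_. 1) \<omega>') \<partial>IT.eP k \<omega> \<partial>C k)"
      using nn_integral_bind[OF ratio_meas[OF h(1)] eP] by (simp add: C_def)
    also have "\<dots> = (\<integral>\<^sup>+\<omega>. ennreal (cyl_limit k h \<omega> / cyl_limit k (\<lambda>_. 1) \<omega>) \<partial>C k)"
    proof (rule nn_integral_cong)
      fix \<omega> assume "\<omega> \<in> space (C k)"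
      then show "(\<integral>\<^sup>+\<omega>'. ennreal (cyl_limit (Suc k) h \<omega>' / cyl_limit (Suc k) (\<lambda>_. 1) \<omega>') \<partial>IT.eP k \<omega>)
          = ennreal (cyl_limit k h \<omega> / cyl_limit k (\<lambda>_. 1) \<omega>)"
        using nn_integral_next_symbol[OF h, of k \<omega>]
        by (subst IT.nn_integral_eP) (auto simp: space ratio_meas[OF h(1)])
    qed
    finally show ?case using Suc by simp
  qed
  define \<mu> where "\<mu> = IT.PF.lim"
  have sets\<mu>: "sets \<mu> = sets (PiM UNIV (\<lambda>_. borel))"
    by (simp add: \<mu>_def)
  \<comment> \<open>The projective limit describes the marginal through the level
    \<open>IT.up_to {0..<k}\<close>, which is at least \<open>k\<close>; restricting from that level
    gives back the law \<open>C k\<close>.\<close>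
  have distr\<mu>: "distr \<mu> (PiM {0..<k} (\<lambda>_. borel)) (\<lambda>x. restrict x {0..<k}) = C k" for k
  proof -
    have "k \<le> IT.up_to {0..<k}" using IT.up_to[of "{0..<k}"] by (cases k) auto
    then show ?thesis
      using IT.distr_lim[of "{0..<k}"] IT.distr_C[of k "IT.up_to {0..<k}" "\<lambda>_. undefined" 0]
      by (simp add: \<mu>_def C_def IT.CI_def)
  qed
  have restr_meas: "(\<lambda>x. restrict x {0..<k}) \<in> \<mu> \<rightarrow>\<^sub>M PiM {0..<k} (\<lambda>_. borel)" for k
    unfolding measurable_cong_sets[OF sets\<mu> refl] by (rule measurable_restrict_subset) simp
  have "prob_space (C 0)"
    unfolding C_def by (rule IT.prob_space_C) simp
  then have \<mu>_prob: "prob_space \<mu>"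
    using prob_space_distrD[OF restr_meas[of 0]] distr\<mu>[of 0] by simp
  have \<mu>: "borel_prob \<mu>"
    using \<mu>_prob sets\<mu> by (simp add: borel_prob_def sets_PiM_seqs)
  interpret \<mu>: prob_space \<mu> by (rule \<mu>_prob)
  have pos: "(\<integral>x. h x \<partial>\<mu>) = limit h" if h: "h \<in> Lip" "\<And>x. 0 \<le> h x" for h
  proof -
    obtain L where L: "L > 0" "lip_le L h" using Lip_lip_le[OF h(1)] .
    have limh: "0 \<le> limit h" using limit_mono[OF Lip_const[of 0] h(1)] h(2) by (simp add: limit_const)
    have close: "\<bar>(\<integral>x. h x \<partial>\<mu>) - limit h\<bar> \<le> L * (1 / 2) ^ k" for k
    proof -
      let ?r = "\<lambda>x. cyl_limit k h x / cyl_limit k (\<lambda>_. 1) x"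
      have r0: "0 \<le> ?r x" for x
        using cyl_limit_nonneg[OF h, of k x] cyl_limit_pos[of k x] by simp
      \<comment> \<open>The ratio depends only on the first \<open>k\<close> coordinates, so its
        integral may be computed under the marginal \<open>C k\<close>.\<close>
      have r_restrict: "?r (restrict x {0..<k}) = ?r x" for x
        using cyl_limit_cong[of k "restrict x {0..<k}" x] by simp
      have "(\<integral>\<^sup>+x. ennreal (?r x) \<partial>\<mu>) = (\<integral>\<^sup>+x. ennreal (?r (restrict x {0..<k})) \<partial>\<mu>)"
        by (simp only: r_restrict)
      also have "\<dots> = (\<integral>\<^sup>+\<omega>. ennreal (?r \<omega>) \<partial>C k)"
        unfolding distr\<mu>[symmetric] using ratio_meas[OF h(1), of k]
        by (subst nn_integral_distr[OF restr_meas]) simp_all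
      also have "\<dots> = ennreal (limit h)" by (rule martingale[OF h])
      finally have nn: "(\<integral>\<^sup>+x. ennreal (?r x) \<partial>\<mu>) = ennreal (limit h)" .
      have "(\<lambda>x. ?r x) \<in> borel_measurable \<mu>"
        unfolding measurable_cong_sets[OF sets\<mu> refl]
        by (intro borel_measurable_divide cyl_limit_measurable h(1) Lip_const) auto
      then have r: "has_bochner_integral \<mu> ?r (limit h)"
        using nn r0 limh by (intro has_bochner_integral_nn_integral) auto
      have hi: "integrable \<mu> h" by (rule Lip_integrable[OF \<mu> h(1)])
      have "\<bar>(\<integral>x. h x \<partial>\<mu>) - limit h\<bar> = \<bar>\<integral>x. ?r x - h x \<partial>\<mu>\<bar>"
        using r hi by (simp add: has_bochner_integral_iff abs_minus_commute)
      also have "\<dots> \<le> (\<integral>x. \<bar>?r x - h x\<bar> \<partial>\<mu>)" by (rule integral_abs_bound)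
      also have "\<dots> \<le> (\<integral>x. L * (1 / 2) ^ k \<partial>\<mu>)"
        using r hi cyl_limit_close[OF L(2)] L(1)
        by (intro integral_mono integrable_abs Bochner_Integration.integrable_diff)
           (auto simp: has_bochner_integral_iff)
      finally show ?thesis by (simp add: \<mu>.prob_space)
    qed
    have "(\<lambda>k. L * (1 / 2) ^ k) \<longlonglongrightarrow> L * 0"
      by (intro tendsto_mult_left LIMSEQ_realpow_zero) auto
    from LIMSEQ_le_const[OF this, of "\<bar>(\<integral>x. h x \<partial>\<mu>) - limit h\<bar>"] close
    show ?thesis by simp
  qed
  have all: "(\<integral>x. h x \<partial>\<mu>) = limit h" if h: "h \<in> Lip" for h
  proof -
    \<comment> \<open>The martingale identity was stated with nonnegative integrals; adding a bound
      makes \<open>h\<close> nonnegative.\<close>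
    obtain D where D: "\<And>x. \<bar>h x\<bar> \<le> D" using Lip_bounded[OF h] by blast
    have "0 \<le> h x + D" for x using D[of x] by linarith
    from pos[OF Lip_add[OF h Lip_const] this]
    show ?thesis
      using Lip_integrable[OF \<mu> h] by (simp add: limit_add_const[OF h] \<mu>.prob_space)
  qed
  have "ruelle_dual_eigen \<nu> f 1 \<mu>"
    unfolding ruelle_dual_eigen_def by (simp add: all ruelle_Lip fL limit_ruelle)
  with \<mu> show ?thesis by blast
qed

end

end

section \<open>Gibbs probabilities of Lipschitz potentials\<close>

context full_shift
begin

lemma integral_ruelle_iterates:
  assumes "f \<in> Lip" "ruelle_dual_eigen \<nu> f 1 \<mu>" "w \<in> Lip"
  shows "(\<integral>x. (ruelle \<nu> f ^^ n) w x \<partial>\<mu>) = (\<integral>x. w x \<partial>\<mu>)"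
proof (induction n)
  case (Suc n)
  then show ?case
    using assms(2) ruelle_iterates_Lip[OF assms(1,3)] by (simp add: ruelle_dual_eigen_def)
qed simp

text \<open>Every such probability integrates \<open>w\<close> like all its iterates, and these
  converge boundedly to a constant that does not depend on the probability.\<close>

lemma gibbs_unique:
  assumes f: "f \<in> normalized \<nu>"
    and \<mu>: "borel_prob \<mu>" "ruelle_dual_eigen \<nu> f 1 \<mu>"
    and \<mu>': "borel_prob \<mu>'" "ruelle_dual_eigen \<nu> f 1 \<mu>'"
  shows "\<mu> = \<mu>'"
proof (rule borel_prob_eqI[OF \<mu>(1) \<mu>'(1)])
  fix w :: "(nat \<Rightarrow> 'a) \<Rightarrow> real" assume w: "w \<in> Lip"
  obtain c where c: "\<And>x. (\<lambda>n. (ruelle \<nu> f ^^ n) w x) \<longlonglongrightarrow> c"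
    using ruelle_iterates_convergent[OF f w] by blast
  obtain C where C: "\<And>x. \<bar>w x\<bar> \<le> C" using Lip_bounded[OF w] by blast
  note fL = normalizedD(1)[OF f]
  note L = ruelle_iterates_Lip[OF fL w]
  have bound: "\<bar>(ruelle \<nu> f ^^ n) w x\<bar> \<le> C" for n x
    by (induction n arbitrary: x) (auto intro: C ruelle_normalized_abs_le[OF f L])
  have "(\<integral>x. w x \<partial>M) = c" if M: "borel_prob M" "ruelle_dual_eigen \<nu> f 1 M" for M
  proof -
    interpret M: prob_space M using M by (simp add: borel_prob_def)
    have "(\<lambda>n. \<integral>x. (ruelle \<nu> f ^^ n) w x \<partial>M) \<longlonglongrightarrow> (\<integral>x. c \<partial>M)"
      by (rule integral_dominated_convergence[where w = "\<lambda>_. C"])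
         (use c bound Lip_integrable[OF M(1) L] in auto)
    then show ?thesis
      using LIMSEQ_unique[OF tendsto_const] unfolding integral_ruelle_iterates[OF fL M(2) w]
      by (simp add: M.prob_space)
  qed
  from this[OF \<mu>] this[OF \<mu>'] show "(\<integral>x. w x \<partial>\<mu>) = (\<integral>x. w x \<partial>\<mu>')" by simp
qed

lemma is_rpf_normalized:
  assumes f: "f \<in> Lip" and t: "is_rpf \<nu> f (l, w, \<rho>)"
  shows "(\<lambda>x. f x + ln (w x) - ln (w (shift_map x)) - ln l) \<in> normalized \<nu>"
proof -
  have l: "l > 0" and w: "w \<in> Lip" "\<And>x. w x > 0" and eig: "\<And>x. ruelle \<nu> f w x = l * w x"
    using t by (auto simp: is_rpf_def)
  note lnw = Lip_ln[OF w]
  have "ruelle \<nu> (\<lambda>x. f x + ln (w x) - ln (w (shift_map x)) - ln l) (\<lambda>_. 1) x = 1" for x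
  proof -
    have "ruelle \<nu> (\<lambda>x. f x + ln (w x) - ln (w (shift_map x)) - ln l) (\<lambda>_. 1) x
        = ruelle \<nu> f (\<lambda>y. w y * (1 / (w (shift_map y) * l))) x"
      using l w(2) by (simp add: ruelle_def exp_diff exp_add field_simps)
    also have "\<dots> = ruelle \<nu> f w x * (1 / (w x * l))"
      by (rule ruelle_shift[where v = "\<lambda>x. 1 / (w x * l)"])
    also have "\<dots> = 1" using l w(2)[of x] by (simp add: eig)
    finally show ?thesis .
  qed
  then show ?thesis
    by (auto simp: normalized_def fun_eq_iff intro!: Lip_diff Lip_add f lnw Lip_shift[OF lnw] Lip_const)
qed

text \<open>A logarithmic eigenfunction \<open>q\<close> normalizes \<open>f\<close> to
  \<open>N\<close>. The Gibbs probability of \<open>N\<close>, reweighted by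
  \<open>exp (- q)\<close>, is the eigenmeasure of \<open>f\<close>; this makes the choice in
  \<open>rpf\<close> meaningful.\<close>

lemma is_rpf_exists:
  assumes f: "f \<in> Lip"
  shows "\<exists>t. is_rpf \<nu> f t"
proof -
  obtain q \<kappa> where q: "q \<in> Lip" "\<And>x. log_ruelle f q x = q x + \<kappa>"
    using log_ruelle_eigenfunction[OF f] by blast
  define N where "N = (\<lambda>x. f x + q x - log_ruelle f q (shift_map x))"
  have N: "N \<in> normalized \<nu>" unfolding N_def by (rule normalized_log_ruelle[OF f q(1)])
  obtain \<mu> where \<mu>: "borel_prob \<mu>" "ruelle_dual_eigen \<nu> N 1 \<mu>" using gibbs_exists[OF N] by blast
  interpret \<mu>: prob_space \<mu> using \<mu> by (simp add: borel_prob_def)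
  have sets\<mu> [measurable_cong]: "sets \<mu> = sets borel" using \<mu> by (simp add: borel_prob_def)
  define e where "e = (\<lambda>x. exp (- q x))"
  have e: "e \<in> Lip" unfolding e_def by (intro Lip_exp Lip_uminus q)
  have [measurable]: "w \<in> borel_measurable \<mu>" if "w \<in> Lip" for w
    using Lip_integrable[OF \<mu>(1) that] by simp
  obtain b where b: "b > 0" "\<And>x. b \<le> e x"
    using Lip_pos_bounded_below[OF e] by (auto simp: e_def)
  \<comment> \<open>The mass of the reweighted probability. Dividing the measure by \<open>c\<close>
    and multiplying the eigenfunction by it gives the pairing 1.\<close>
  define c where "c = (\<integral>x. e x \<partial>\<mu>)"
  have "(\<integral>x. b \<partial>\<mu>) \<le> c"
    unfolding c_def by (intro integral_mono Lip_integrable \<mu> e Lip_const b)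
  then have c: "c > 0" using b(1) by (simp add: \<mu>.prob_space)
  define \<rho> where "\<rho> = density \<mu> (\<lambda>x. ennreal (e x / c))"
  have int\<rho>: "(\<integral>x. h x \<partial>\<rho>) = (\<integral>x. e x * h x \<partial>\<mu>) / c" if h: "h \<in> Lip" for h
    unfolding \<rho>_def using h e c
    by (subst integral_density) (auto simp: e_def)
  have "prob_space \<rho>"
  proof
    have "emeasure \<rho> (space \<rho>) = (\<integral>\<^sup>+x. ennreal (e x / c) \<partial>\<mu>)"
      unfolding \<rho>_def using e by (subst emeasure_density) (auto intro!: nn_integral_cong)
    also have "\<dots> = ennreal (\<integral>x. e x / c \<partial>\<mu>)"
      using Lip_integrable[OF \<mu>(1) e] c by (intro nn_integral_eq_integral) (auto simp: e_def)
    also have "\<dots> = 1" using c by (simp add: c_def)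
    finally show "emeasure \<rho> (space \<rho>) = 1" .
  qed
  then have \<rho>: "borel_prob \<rho>" by (simp add: borel_prob_def \<rho>_def sets\<mu>)
  define w where "w = (\<lambda>x. c * exp (q x))"
  have wL: "w \<in> Lip" unfolding w_def by (intro Lip_cmult Lip_exp q)
  have "ruelle \<nu> f w = (\<lambda>x. exp \<kappa> * w x)"
    unfolding w_def fun_eq_iff ruelle_cmult exp_log_ruelle[OF f q(1), symmetric] q(2)
    by (simp add: exp_add)
  moreover have "ruelle_dual_eigen \<nu> f (exp \<kappa>) \<rho>"
    unfolding ruelle_dual_eigen_def
  proof
    fix h :: "(nat \<Rightarrow> 'a) \<Rightarrow> real" assume h: "h \<in> Lip"
    have eh: "(\<lambda>x. e x * h x) \<in> Lip" by (intro Lip_mult e h)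
    \<comment> \<open>The operators of \<open>f\<close> and \<open>N\<close> are conjugate through
      multiplication by \<open>e\<close>, up to the eigenvalue.\<close>
    have "e x * ruelle \<nu> f h x = exp \<kappa> * ruelle \<nu> N (\<lambda>x. e x * h x) x" for x
    proof -
      have "ruelle \<nu> N (\<lambda>x. e x * h x) x = ruelle \<nu> f (\<lambda>y. h y * exp (- q (shift_map y) - \<kappa>)) x"
        by (simp add: ruelle_def N_def e_def q(2) exp_diff exp_add exp_minus field_simps)
      also have "\<dots> = ruelle \<nu> f h x * exp (- q x - \<kappa>)"
        by (rule ruelle_shift[where v = "\<lambda>x. exp (- q x - \<kappa>)"])
      finally show ?thesis by (simp add: e_def exp_diff exp_minus field_simps)
    qed
    then have "(\<integral>x. ruelle \<nu> f h x \<partial>\<rho>) = exp \<kappa> * (\<integral>x. ruelle \<nu> N (\<lambda>x. e x * h x) x \<partial>\<mu>) / c"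
      by (simp add: int\<rho> ruelle_Lip f h)
    also have "\<dots> = exp \<kappa> * (\<integral>x. h x \<partial>\<rho>)"
      using \<mu>(2) eh by (simp add: ruelle_dual_eigen_def int\<rho> h)
    finally show "(\<integral>x. ruelle \<nu> f h x \<partial>\<rho>) = exp \<kappa> * (\<integral>x. h x \<partial>\<rho>)" .
  qed
  moreover have "(\<integral>x. w x \<partial>\<rho>) = 1"
    unfolding int\<rho>[OF wL] using c by (simp add: w_def e_def mult.left_commute \<mu>.prob_space flip: exp_add)
  ultimately have "is_rpf \<nu> f (exp \<kappa>, w, \<rho>)"
    using wL \<rho> c by (simp add: is_rpf_def w_def)
  then show ?thesis by blast
qed

text \<open>Whatever triple \<open>rpf\<close> selects, it yields a normalized potential
  cohomologous to \<open>f\<close> up to a constant, and there is only one. From here on any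
  explicit candidate identifies the normalization.\<close>

lemma normalization_eq:
  assumes f: "f \<in> Lip" and N: "N \<in> normalized \<nu>" and r: "r \<in> Lip"
    and eq: "\<And>x. N x = f x + r x - r (shift_map x) - \<kappa>"
  shows "normalization \<nu> f = N"
proof -
  obtain l w \<rho> where t: "rpf \<nu> f = (l, w, \<rho>)" by (cases "rpf \<nu> f")
  have rpf: "is_rpf \<nu> f (l, w, \<rho>)"
    using someI_ex[OF is_rpf_exists[OF f]] t by (simp add: rpf_def)
  have w: "w \<in> Lip" "\<And>x. w x > 0" using rpf by (auto simp: is_rpf_def)
  have norm: "normalization \<nu> f = (\<lambda>x. f x + ln (w x) - ln (w (shift_map x)) - ln l)"
    by (simp add: normalization_def t)
  have "normalization \<nu> f \<in> normalized \<nu>"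
    unfolding norm by (rule is_rpf_normalized[OF f rpf])
  moreover have "(\<lambda>x. ln (w x) - r x) \<in> Lip"
    by (intro Lip_diff Lip_ln w r)
  ultimately show ?thesis
    by (rule normalized_cohomologous_unique[OF N, where \<kappa> = "ln l - \<kappa>"]) (simp add: norm eq)
qed

lemma gibbs:
  assumes f: "f \<in> Lip" and N: "N \<in> normalized \<nu>" and r: "r \<in> Lip"
    and eq: "\<And>x. N x = f x + r x - r (shift_map x) - \<kappa>"
  shows "borel_prob (gibbs \<nu> f)" "ruelle_dual_eigen \<nu> N 1 (gibbs \<nu> f)"
proof -
  have "\<exists>!\<mu>. borel_prob \<mu> \<and> ruelle_dual_eigen \<nu> N 1 \<mu>"
    using gibbs_exists[OF N] gibbs_unique[OF N] by blast
  from theI'[OF this] show "borel_prob (gibbs \<nu> f)" "ruelle_dual_eigen \<nu> N 1 (gibbs \<nu> f)"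
    unfolding gibbs_def normalization_eq[OF assms] by blast+
qed

lemma gibbs_normalized:
  assumes "f \<in> normalized \<nu>"
  shows "borel_prob (gibbs \<nu> f)" "ruelle_dual_eigen \<nu> f 1 (gibbs \<nu> f)"
  using gibbs[OF normalizedD(1)[OF assms] assms Lip_const[of 0], of 0] by auto

section \<open>Invariance and integrals of coboundaries\<close>

lemma integral_shift:
  assumes "f \<in> normalized \<nu>" "ruelle_dual_eigen \<nu> f 1 \<mu>" "v \<in> Lip"
  shows "(\<integral>x. v (shift_map x) \<partial>\<mu>) = (\<integral>x. v x \<partial>\<mu>)"
proof -
  have "ruelle \<nu> f (\<lambda>x. v (shift_map x)) = v"
    by (simp add: fun_eq_iff ruelle_normalized_shift[OF assms(1)])
  then show ?thesis
    using bspec[OF assms(2)[unfolded ruelle_dual_eigen_def] Lip_shift[OF assms(3)]] by simp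
qed

text \<open>Shift invariance removes the coboundary. The potential of \<mu> need not be related to
  the function integrated; this is how decompositions taken with respect to \<open>f\<close> are
  evaluated under the perturbed probabilities.\<close>

lemma integral_coboundary:
  assumes f: "f \<in> normalized \<nu>" and \<mu>: "borel_prob \<mu>" "ruelle_dual_eigen \<nu> f 1 \<mu>"
    and w: "w \<in> Lip" and v: "v \<in> Lip"
  shows "(\<integral>x. w x + (v x - v (shift_map x)) + c \<partial>\<mu>) = (\<integral>x. w x \<partial>\<mu>) + c"
proof -
  interpret \<mu>: prob_space \<mu> using \<mu> by (simp add: borel_prob_def)
  note int = Lip_integrable[OF \<mu>(1) w] Lip_integrable[OF \<mu>(1) v] Lip_integrable[OF \<mu>(1) Lip_shift[OF v]]
  show ?thesis
    using int by (simp add: integral_shift[OF f \<mu>(2) v] \<mu>.prob_space)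
qed

lemma integral_ruelle_ker:
  assumes "ruelle_dual_eigen \<nu> f 1 \<mu>" "\<psi> \<in> ruelle_ker \<nu> f"
  shows "(\<integral>x. \<psi> x \<partial>\<mu>) = 0"
  using assms by (auto simp: ruelle_dual_eigen_def ruelle_ker_def)

section \<open>First-order response of Gibbs probabilities\<close>

text \<open>The derivative \<open>exp u - 1\<close> of \<open>exp u - u\<close> is bounded by
  \<open>m * exp m\<close> on the interval. The Lipschitz form controls the oscillation of the
  remainder; the choice \<open>v = 0\<close> gives its size.\<close>

lemma exp_remainder_lipschitz:
  fixes u v m :: real
  assumes "\<bar>u\<bar> \<le> m" "\<bar>v\<bar> \<le> m"
  shows "\<bar>(exp u - u) - (exp v - v)\<bar> \<le> m * exp m * \<bar>u - v\<bar>"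
proof -
  have one: "(exp a - a) - (exp b - b) \<le> m * exp m * \<bar>a - b\<bar>" if a: "\<bar>a\<bar> \<le> m" for a b
  proof -
    have m: "0 \<le> m" using a by linarith
    have "exp a * (1 + (b - a)) \<le> exp a * exp (b - a)"
      by (intro mult_left_mono exp_ge_add_one_self) simp
    then have "exp a - exp b \<le> exp a * (a - b)"
      by (simp add: algebra_simps flip: exp_add)
    then have "(exp a - a) - (exp b - b) \<le> (exp a - 1) * (a - b)"
      by (simp add: algebra_simps)
    also have "\<dots> \<le> \<bar>exp a - 1\<bar> * \<bar>a - b\<bar>"
      by (metis abs_ge_self abs_mult)
    also have "\<dots> \<le> m * exp m * \<bar>a - b\<bar>"
    proof (rule mult_right_mono)
      have "exp a * (1 + - a) \<le> exp a * exp (- a)"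
        by (intro mult_left_mono exp_ge_add_one_self) simp
      then have "exp a - 1 \<le> a * exp a"
        by (simp add: algebra_simps flip: exp_add)
      also have "\<dots> \<le> m * exp m"
        using a m by (intro mult_mono) auto
      finally have "exp a - 1 \<le> m * exp m" .
      moreover have "1 - exp a \<le> m * exp m"
      proof -
        have "1 - exp a \<le> - a" using exp_ge_add_one_self[of a] by linarith
        also have "\<dots> \<le> m * 1" using a by linarith
        also have "\<dots> \<le> m * exp m" using m by (intro mult_left_mono) auto
        finally show ?thesis .
      qed
      ultimately show "\<bar>exp a - 1\<bar> \<le> m * exp m" by (simp add: abs_le_iff)
    qed simp
    finally show ?thesis .
  qed
  show ?thesis
    using one[OF assms(1), of v] one[OF assms(2), of u] by (simp add: abs_le_iff abs_minus_commute)
qed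

text \<open>
  Since \<open>L\<^sub>f \<eta> = 0\<close>, the potential \<open>f + t \<eta>\<close> is normalized up to an error of second order in \<open>t\<close>,
  measured in the modulus of continuity; the contraction bounds the correction by the same order.
\<close>

lemma perturbed_normalization:
  assumes f: "f \<in> normalized \<nu>" and \<eta>: "\<eta> \<in> ruelle_ker \<nu> f"
  obtains C where "0 \<le> C" "\<And>t. \<bar>t\<bar> \<le> 1 \<Longrightarrow> \<exists>N q \<kappa>. N \<in> normalized \<nu> \<and> q \<in> Lip \<and>
    (\<forall>x. N x = f x + t * \<eta> x + q x - q (shift_map x) - \<kappa>) \<and>
    (\<forall>x. \<bar>N x - f x - t * \<eta> x\<bar> \<le> C * t\<^sup>2)"
proof -
  note fL = normalizedD(1)[OF f]
  have \<eta>L: "\<eta> \<in> Lip" and L\<eta>: "\<And>x. ruelle \<nu> f \<eta> x = 0" using \<eta> by (auto simp: ruelle_ker_def)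
  obtain F where F: "F > 0" "lip_le F f" using Lip_lip_le[OF fL] .
  obtain M where M: "M > 0" "lip_le M \<eta>" using Lip_lip_le[OF \<eta>L] .
  obtain D0 where D0: "\<And>x. \<bar>\<eta> x\<bar> \<le> D0" using Lip_bounded[OF \<eta>L] by blast
  define D where "D = max 0 D0"
  have D: "\<bar>\<eta> x\<bar> \<le> D" "0 \<le> D" for x using D0[of x] by (auto simp: D_def)
  \<comment> \<open>The constant that \<open>log_ruelle_contraction\<close> asks for with
    \<open>f\<close> and \<open>t * \<eta>\<close>, valid for all |t| \<le> 1.\<close>
  define K where "K = 2 * (F + M)"
  have K: "K > 0" using F M by (simp add: K_def)
  note rate = rate_bounds[OF K]
  have fK: "lip_le K f" by (rule lip_le_mono[OF F(2)]) (use F M in \<open>simp add: K_def\<close>)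
  define b where "b = D * exp D * M / gap K 1"
  define a where "a = D * exp D * D"
  have g1: "gap K 1 > 0" using K by (simp add: gap_def)
  have ab: "0 \<le> a" "0 \<le> b" using D M g1 by (auto simp: a_def b_def)
  define c1 where "c1 = b / (1 - rate K)"
  have c1: "0 \<le> c1" using ab rate by (simp add: c1_def)
  show thesis
  \<comment> \<open>The coboundary of \<open>q\<close> contributes at most \<open>c1 * t^2\<close>
    and \<kappa> at most \<open>(c1 + a) * t^2\<close>.\<close>
  proof (rule that[of "2 * c1 + (c1 + a)"])
    show "0 \<le> 2 * c1 + (c1 + a)" using ab c1 by simp
    fix t :: real assume t: "\<bar>t\<bar> \<le> 1"
    define p where "p = (\<lambda>x. t * \<eta> x)"
    have pL: "p \<in> Lip" unfolding p_def by (rule Lip_cmult[OF \<eta>L])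
    have lipp: "lip_le M p"
      unfolding p_def using lip_le_mono[OF lip_le_cmult[OF M(2), of t], of M] t M(1)
      by (simp add: mult_left_le_one_le)
    have pD: "\<bar>p x\<bar> \<le> \<bar>t\<bar> * D" for x
      unfolding p_def abs_mult by (intro mult_left_mono D) simp
    have tD: "\<bar>t\<bar> * D * exp (\<bar>t\<bar> * D) \<le> \<bar>t\<bar> * (D * exp D)"
    proof -
      have "exp (\<bar>t\<bar> * D) \<le> exp D" using t D by (simp add: mult_left_le_one_le)
      then have "\<bar>t\<bar> * D * exp (\<bar>t\<bar> * D) \<le> \<bar>t\<bar> * D * exp D" using D by (intro mult_left_mono) auto
      then show ?thesis by (simp add: mult.assoc)
    qed
    \<comment> \<open>The linear term of \<open>exp p\<close> is killed by the operator, so only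
      this second-order remainder survives in \<open>ruelle \<nu> f (exp p) = 1 + R\<close>.\<close>
    define E where "E = (\<lambda>x. exp (p x) - p x - 1)"
    have EL: "E \<in> Lip" unfolding E_def by (intro Lip_diff Lip_exp Lip_const pL)
    define R where "R = ruelle \<nu> f E"
    have ER: "ruelle \<nu> f (\<lambda>x. exp (p x)) x = 1 + R x" for x
    proof -
      have "ruelle \<nu> f p x = 0" unfolding p_def by (simp only: ruelle_cmult L\<eta>)
      then show ?thesis
        unfolding R_def E_def
        by (simp add: ruelle_diff fL pL Lip_exp Lip_diff Lip_const ruelle_normalized_const[OF f])
    qed
    have "lip_le (t\<^sup>2 * (D * exp D * M)) E"
      unfolding lip_le_def
    proof (intro allI)
      fix x y :: "nat \<Rightarrow> 'a"
      have "E x - E y \<le> \<bar>(exp (p x) - p x) - (exp (p y) - p y)\<bar>" by (simp add: E_def)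
      also have "\<dots> \<le> \<bar>t\<bar> * D * exp (\<bar>t\<bar> * D) * \<bar>p x - p y\<bar>"
        by (rule exp_remainder_lipschitz[OF pD pD])
      also have "\<dots> \<le> \<bar>t\<bar> * (D * exp D) * (\<bar>t\<bar> * (M * seq_dist x y))"
      proof (rule mult_mono[OF tD])
        show "\<bar>p x - p y\<bar> \<le> \<bar>t\<bar> * (M * seq_dist x y)"
          unfolding p_def right_diff_distrib[symmetric] abs_mult
          by (intro mult_left_mono lip_leD_abs[OF M(2)]) simp
      qed (use D in auto)
      also have "\<dots> = \<bar>t\<bar> * \<bar>t\<bar> * (D * exp D * M) * seq_dist x y"
        by (simp only: mult_ac)
      also have "\<dots> = t\<^sup>2 * (D * exp D * M) * seq_dist x y"
        by (simp add: power2_eq_square)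
      finally show "E x - E y \<le> t\<^sup>2 * (D * exp D * M) * seq_dist x y" .
    qed
    from lip_gap_le[OF this _ K]
    have gapE: "gap_le K (t\<^sup>2 * b) E" using D M by (simp add: b_def)
    have gapR: "gap_le K (t\<^sup>2 * b) R"
      unfolding gap_le_def
    proof (intro allI)
      fix x y :: "nat \<Rightarrow> 'a"
      have "R x - R y \<le> rate K * (t\<^sup>2 * b) * gap K (seq_dist x y)"
        unfolding R_def using ab by (intro gap_leD[OF ruelle_gap_le[OF f fK K gapE]]) simp
      also have "\<dots> \<le> 1 * (t\<^sup>2 * b) * gap K (seq_dist x y)"
        using rate ab K by (intro mult_right_mono gap_nonneg) auto
      finally show "R x - R y \<le> t\<^sup>2 * b * gap K (seq_dist x y)" by simp
    qed
    have E0: "0 \<le> E x" for x unfolding E_def using exp_ge_add_one_self[of "p x"] by linarith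
    have Ea: "E x \<le> a * t\<^sup>2" for x
    proof -
      have "\<bar>(exp (p x) - p x) - (exp 0 - 0)\<bar> \<le> \<bar>t\<bar> * D * exp (\<bar>t\<bar> * D) * \<bar>p x - 0\<bar>"
        using D by (intro exp_remainder_lipschitz pD) simp
      also have "\<dots> \<le> \<bar>t\<bar> * (D * exp D) * (\<bar>t\<bar> * D)"
        using pD[of x] D by (intro mult_mono[OF tD]) auto
      also have "\<dots> = a * (\<bar>t\<bar> * \<bar>t\<bar>)"
        by (simp only: a_def mult_ac)
      also have "\<dots> = a * t\<^sup>2"
        by (simp add: power2_eq_square)
      finally show ?thesis by (simp add: E_def)
    qed
    have R0: "0 \<le> R x" for x
      unfolding R_def using ruelle_mono[OF fL Lip_const[of 0] EL E0] ruelle_normalized_const[OF f, of 0] by simp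
    have Ra: "R x \<le> a * t\<^sup>2" for x
      unfolding R_def by (rule ruelle_normalized_le[OF f EL Ea])
    have lr: "log_ruelle f p x = ln (1 + R x)" for x
      by (simp add: log_ruelle_def ER)
    have lr0: "0 \<le> log_ruelle f p x" "log_ruelle f p x \<le> a * t\<^sup>2" for x
      using R0[of x] Ra[of x] ln_add_one_self_le_self[of "R x"] by (auto simp: lr)
    have gaplr: "gap_le K (t\<^sup>2 * b) (log_ruelle f p)"
      unfolding gap_le_def
    proof (intro allI)
      fix x y :: "nat \<Rightarrow> 'a"
      have pos: "0 \<le> t\<^sup>2 * b * gap K (seq_dist x y)" using ab K by (intro mult_nonneg_nonneg gap_nonneg) auto
      have "log_ruelle f p x - log_ruelle f p y \<le> ((1 + R x) - (1 + R y)) / (1 + R y)"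
        unfolding lr using R0[of x] R0[of y] by (intro ln_diff_le) auto
      also have "\<dots> \<le> t\<^sup>2 * b * gap K (seq_dist x y) / (1 + R y)"
        using R0[of y] gap_leD[OF gapR, of x y] by (intro divide_right_mono) auto
      also have "\<dots> \<le> t\<^sup>2 * b * gap K (seq_dist x y) / 1"
        using R0[of y] pos by (intro divide_left_mono) auto
      finally show "log_ruelle f p x - log_ruelle f p y \<le> t\<^sup>2 * b * gap K (seq_dist x y)" by simp
    qed
    have fpL: "(\<lambda>x. f x + p x) \<in> Lip" by (intro Lip_add fL pL)
    obtain q \<kappa> where q: "q \<in> Lip" "\<And>x. log_ruelle (\<lambda>x. f x + p x) q x = q x + \<kappa>"
      using log_ruelle_eigenfunction[OF fpL] by blast
    have pqL: "(\<lambda>x. p x + q x) \<in> Lip" by (intro Lip_add pL q)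
    have q': "log_ruelle f (\<lambda>x. p x + q x) x = q x + \<kappa>" for x
      using q(2)[of x] by (simp add: log_ruelle_def ruelle_tilt exp_add)
    \<comment> \<open>The eigenvalue equation splits as \<open>q + \<kappa> = (log_ruelle f (p + q)
      - log_ruelle f p) + log_ruelle f p\<close>. The bracket contracts the modulus of
      \<open>q\<close> at a rate independent of \<open>t\<close>, and the last term is of order
      t^2.\<close>
    have improve: "gap_le K (rate K * A + t\<^sup>2 * b) q" if A: "0 \<le> A" "gap_le K A q" for A
    proof -
      have "gap_le K (rate K * A) (\<lambda>x. log_ruelle f (\<lambda>x. p x + q x) x - log_ruelle f p x)"
        using F M A by (intro log_ruelle_contraction[OF F(2) lipp pqL _ K]) (auto simp: K_def)
      from gap_le_add[OF this gaplr] have "gap_le K (rate K * A + t\<^sup>2 * b) (\<lambda>x. q x + \<kappa>)"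
        by (simp add: q')
      then show ?thesis by (simp add: gap_le_def)
    qed
    \<comment> \<open>This constant may depend on \<open>t\<close> without control; it only starts
      the improvement and disappears in the limit.\<close>
    obtain Q where Q: "Q > 0" "lip_le Q q" using Lip_lip_le[OF q(1)] .
    have "gap_le K (t\<^sup>2 * b / (1 - rate K)) q"
      by (rule gap_le_self_improve[OF K lip_gap_le[OF Q(2) _ K]]) (use Q g1 ab improve in auto)
    then have gapq: "gap_le K (c1 * t\<^sup>2) q" by (simp add: c1_def mult.commute)
    have osc: "\<bar>q x - q y\<bar> \<le> c1 * t\<^sup>2" for x y
      using c1 by (intro gap_le_osc_abs[OF gapq]) simp
    \<comment> \<open>After subtracting \<open>q z\<close>, the function \<open>p + q\<close> is
      within the oscillation of \<open>q\<close> of \<open>p\<close>, whose logarithmic image is at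
      most \<open>a * t^2\<close>.\<close>
    have \<kappa>: "\<bar>\<kappa>\<bar> \<le> (c1 + a) * t\<^sup>2"
    proof -
      define z :: "nat \<Rightarrow> 'a" where "z = (\<lambda>_. undefined)"
      have "log_ruelle f (\<lambda>x. p x + q x + - q z) z = \<kappa>"
        using log_ruelle_add_const[OF fL pqL, of "- q z" z] by (simp add: q')
      moreover have "\<bar>log_ruelle f (\<lambda>x. p x + q x + - q z) z - log_ruelle f p z\<bar> \<le> c1 * t\<^sup>2"
        using osc[of _ z] by (intro log_ruelle_nonexpansive[OF fL Lip_add[OF pqL Lip_const] pL]) simp
      ultimately show ?thesis using lr0[of z] by (simp add: distrib_right)
    qed
    define N where "N = (\<lambda>x. f x + p x + q x - log_ruelle (\<lambda>x. f x + p x) q (shift_map x))"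
    have N: "N \<in> normalized \<nu>" unfolding N_def by (rule normalized_log_ruelle[OF fpL q(1)])
    have Neq: "N x = f x + t * \<eta> x + q x - q (shift_map x) - \<kappa>" for x
      unfolding N_def q(2) by (simp add: p_def)
    have "\<bar>N x - f x - t * \<eta> x\<bar> \<le> (2 * c1 + (c1 + a)) * t\<^sup>2" for x
    proof -
      have "\<bar>q x - q (shift_map x) - \<kappa>\<bar> \<le> c1 * t\<^sup>2 + (c1 + a) * t\<^sup>2"
        using osc[of x "shift_map x"] \<kappa> by linarith
      moreover have "0 \<le> c1 * t\<^sup>2" using c1 by simp
      ultimately show ?thesis by (simp add: Neq algebra_simps)
    qed
    with N q(1) Neq show "\<exists>N q \<kappa>. N \<in> normalized \<nu> \<and> q \<in> Lip \<and>
        (\<forall>x. N x = f x + t * \<eta> x + q x - q (shift_map x) - \<kappa>) \<and>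
        (\<forall>x. \<bar>N x - f x - t * \<eta> x\<bar> \<le> (2 * c1 + (c1 + a)) * t\<^sup>2)"
      by blast
  qed
qed

text \<open>All that the expansions use about the perturbed probability. Quantifying over every such
  \<mu> makes the constants independent of \<open>t\<close> and of the choice of
  \<open>N\<close>.\<close>

definition near_gibbs ::
    "((nat \<Rightarrow> 'a) \<Rightarrow> real) \<Rightarrow> ((nat \<Rightarrow> 'a) \<Rightarrow> real) \<Rightarrow> real \<Rightarrow> real \<Rightarrow> (nat \<Rightarrow> 'a) measure \<Rightarrow> bool" where
  "near_gibbs f \<eta> C t \<mu> \<longleftrightarrow> borel_prob \<mu> \<and>
     (\<exists>N\<in>normalized \<nu>. ruelle_dual_eigen \<nu> N 1 \<mu> \<and> (\<forall>x. \<bar>N x - f x - t * \<eta> x\<bar> \<le> C * t\<^sup>2))"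

text \<open>Write \<open>exp (N - f) = 1 + t * \<eta> + G\<close> with \<open>G\<close> of order
  t^2. The constant term contributes \<open>ruelle \<nu> f \<psi> = 0\<close>, so the expansion
  begins at first order.\<close>

lemma near_gibbs_ker_expansion:
  assumes f: "f \<in> normalized \<nu>" and \<eta>: "\<eta> \<in> Lip" and C: "0 \<le> C" and \<psi>: "\<psi> \<in> ruelle_ker \<nu> f"
  obtains C' where "0 \<le> C'" "\<And>t \<mu>. \<bar>t\<bar> \<le> 1 \<Longrightarrow> near_gibbs f \<eta> C t \<mu> \<Longrightarrow>
    \<bar>(\<integral>x. \<psi> x \<partial>\<mu>) - t * (\<integral>x. ruelle \<nu> f (\<lambda>x. \<eta> x * \<psi> x) x \<partial>\<mu>)\<bar> \<le> C' * t\<^sup>2"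
proof -
  note fL = normalizedD(1)[OF f]
  have \<psi>L: "\<psi> \<in> Lip" and L\<psi>: "\<And>x. ruelle \<nu> f \<psi> x = 0" using \<psi> by (auto simp: ruelle_ker_def)
  obtain D0 where D0: "\<And>x. \<bar>\<eta> x\<bar> \<le> D0" using Lip_bounded[OF \<eta>] by blast
  obtain P0 where P0: "\<And>x. \<bar>\<psi> x\<bar> \<le> P0" using Lip_bounded[OF \<psi>L] by blast
  \<comment> \<open>For |t| \<le> 1 one has t^2 \<le> |t|, whence \<open>N - f\<close> is at most
    \<open>|t| * m\<close>.\<close>
  define m where "m = max 0 D0 + C"
  have m: "0 \<le> m" using C by (simp add: m_def)
  define P where "P = max 0 P0"
  have P: "\<bar>\<psi> x\<bar> \<le> P" "0 \<le> P" for x using P0[of x] by (auto simp: P_def)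
  define C' where "C' = (m * exp m * m + C) * P"
  show thesis
  proof (rule that[of C'])
    show "0 \<le> C'" unfolding C'_def using m C P by (intro mult_nonneg_nonneg add_nonneg_nonneg) auto
    fix t \<mu> assume t: "\<bar>t\<bar> \<le> 1" and "near_gibbs f \<eta> C t \<mu>"
    then obtain N where \<mu>: "borel_prob \<mu>" and N: "N \<in> normalized \<nu>" "ruelle_dual_eigen \<nu> N 1 \<mu>"
      and close: "\<And>x. \<bar>N x - f x - t * \<eta> x\<bar> \<le> C * t\<^sup>2"
      by (auto simp: near_gibbs_def)
    interpret \<mu>: prob_space \<mu> using \<mu> by (simp add: borel_prob_def)
    define d where "d = (\<lambda>x. N x - f x)"
    have dL: "d \<in> Lip" unfolding d_def by (intro Lip_diff fL normalizedD(1)[OF N(1)])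
    have d: "\<bar>d x\<bar> \<le> \<bar>t\<bar> * m" for x
    proof -
      have "\<bar>d x\<bar> \<le> \<bar>t * \<eta> x\<bar> + C * t\<^sup>2" using close[of x] by (simp add: d_def)
      also have "\<dots> \<le> \<bar>t\<bar> * max 0 D0 + C * \<bar>t\<bar>"
      proof (rule add_mono)
        show "\<bar>t * \<eta> x\<bar> \<le> \<bar>t\<bar> * max 0 D0"
          unfolding abs_mult using D0[of x] by (intro mult_left_mono) auto
        have "\<bar>t\<bar> * \<bar>t\<bar> \<le> \<bar>t\<bar> * 1" using t by (intro mult_left_mono) auto
        then have "t\<^sup>2 \<le> \<bar>t\<bar>" by (simp add: power2_eq_square)
        then show "C * t\<^sup>2 \<le> C * \<bar>t\<bar>" using C by (rule mult_left_mono)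
      qed
      finally show ?thesis by (simp add: m_def algebra_simps)
    qed
    define G where "G = (\<lambda>x. exp (d x) - 1 - t * \<eta> x)"
    have GL: "G \<in> Lip" unfolding G_def by (intro Lip_diff Lip_exp dL Lip_const Lip_cmult \<eta>)
    have tm: "\<bar>t\<bar> * m \<le> m" using t m by (simp add: mult_left_le_one_le)
    have G: "\<bar>G x\<bar> \<le> (m * exp m * m + C) * t\<^sup>2" for x
    proof -
      have "\<bar>(exp (d x) - d x) - (exp 0 - 0)\<bar> \<le> \<bar>t\<bar> * m * exp (\<bar>t\<bar> * m) * \<bar>d x - 0\<bar>"
        using m by (intro exp_remainder_lipschitz d) simp
      also have "\<dots> \<le> \<bar>t\<bar> * m * exp m * (\<bar>t\<bar> * m)"
        using d[of x] tm m by (intro mult_mono) auto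
      also have "\<dots> = m * exp m * m * (\<bar>t\<bar> * \<bar>t\<bar>)"
        by (simp only: mult_ac)
      also have "\<dots> = m * exp m * m * t\<^sup>2"
        by (simp add: power2_eq_square)
      finally have "\<bar>exp (d x) - 1 - d x\<bar> \<le> m * exp m * m * t\<^sup>2" by (simp add: algebra_simps)
      moreover have "\<bar>d x - t * \<eta> x\<bar> \<le> C * t\<^sup>2" using close[of x] by (simp add: d_def)
      ultimately show ?thesis unfolding G_def distrib_right by linarith
    qed
    have L: "(\<lambda>x. \<eta> x * \<psi> x) \<in> Lip" "(\<lambda>x. G x * \<psi> x) \<in> Lip" by (intro Lip_mult \<eta> GL \<psi>L)+
    have "ruelle \<nu> N \<psi> x = t * ruelle \<nu> f (\<lambda>x. \<eta> x * \<psi> x) x + ruelle \<nu> f (\<lambda>x. G x * \<psi> x) x" for x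
    proof -
      have "ruelle \<nu> N \<psi> x = ruelle \<nu> (\<lambda>x. f x + d x) \<psi> x" by (simp add: d_def)
      also have "\<dots> = ruelle \<nu> f (\<lambda>x. \<psi> x + (t * (\<eta> x * \<psi> x) + G x * \<psi> x)) x"
        unfolding ruelle_tilt by (simp add: G_def algebra_simps)
      also have "\<dots> = t * ruelle \<nu> f (\<lambda>x. \<eta> x * \<psi> x) x + ruelle \<nu> f (\<lambda>x. G x * \<psi> x) x"
        by (simp only: ruelle_add[OF fL \<psi>L Lip_add[OF Lip_cmult[OF L(1)] L(2)]] L\<psi>
            ruelle_add[OF fL Lip_cmult[OF L(1)] L(2)] ruelle_cmult)
      finally show ?thesis .
    qed
    moreover have "(\<integral>x. ruelle \<nu> N \<psi> x \<partial>\<mu>) = (\<integral>x. \<psi> x \<partial>\<mu>)"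
      using N(2) \<psi>L by (simp add: ruelle_dual_eigen_def)
    ultimately have "(\<integral>x. \<psi> x \<partial>\<mu>) = t * (\<integral>x. ruelle \<nu> f (\<lambda>x. \<eta> x * \<psi> x) x \<partial>\<mu>)
        + (\<integral>x. ruelle \<nu> f (\<lambda>x. G x * \<psi> x) x \<partial>\<mu>)"
      using Lip_integrable[OF \<mu> ruelle_Lip[OF fL L(1)]] Lip_integrable[OF \<mu> ruelle_Lip[OF fL L(2)]]
      by simp
    moreover have "\<bar>\<integral>x. ruelle \<nu> f (\<lambda>x. G x * \<psi> x) x \<partial>\<mu>\<bar> \<le> C' * t\<^sup>2"
    proof -
      have GP: "\<bar>G x * \<psi> x\<bar> \<le> C' * t\<^sup>2" for x
      proof -
        have "\<bar>G x\<bar> * \<bar>\<psi> x\<bar> \<le> (m * exp m * m + C) * t\<^sup>2 * P"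
          using G[of x] P by (intro mult_mono) (auto intro: order_trans[OF abs_ge_zero])
        then show ?thesis by (simp add: abs_mult C'_def mult_ac)
      qed
      have "\<bar>\<integral>x. ruelle \<nu> f (\<lambda>x. G x * \<psi> x) x \<partial>\<mu>\<bar> \<le> (\<integral>x. \<bar>ruelle \<nu> f (\<lambda>x. G x * \<psi> x) x\<bar> \<partial>\<mu>)"
        by (rule integral_abs_bound)
      also have "\<dots> \<le> (\<integral>x. C' * t\<^sup>2 \<partial>\<mu>)"
        by (intro integral_mono integrable_abs Lip_integrable[OF \<mu> ruelle_Lip[OF fL L(2)]]
            ruelle_normalized_abs_le[OF f L(2) GP]) simp
      finally show ?thesis by (simp add: \<mu>.prob_space)
    qed
    ultimately show "\<bar>(\<integral>x. \<psi> x \<partial>\<mu>) - t * (\<integral>x. ruelle \<nu> f (\<lambda>x. \<eta> x * \<psi> x) x \<partial>\<mu>)\<bar> \<le> C' * t\<^sup>2"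
      by simp
  qed
qed

lemma near_gibbs_ker_small:
  assumes f: "f \<in> normalized \<nu>" and \<eta>: "\<eta> \<in> Lip" and C: "0 \<le> C" and \<psi>: "\<psi> \<in> ruelle_ker \<nu> f"
  obtains C' where "0 \<le> C'"
    "\<And>t \<mu>. \<bar>t\<bar> \<le> 1 \<Longrightarrow> near_gibbs f \<eta> C t \<mu> \<Longrightarrow> \<bar>\<integral>x. \<psi> x \<partial>\<mu>\<bar> \<le> C' * \<bar>t\<bar>"
proof -
  obtain C1 where C1: "0 \<le> C1" "\<And>t \<mu>. \<bar>t\<bar> \<le> 1 \<Longrightarrow> near_gibbs f \<eta> C t \<mu> \<Longrightarrow>
      \<bar>(\<integral>x. \<psi> x \<partial>\<mu>) - t * (\<integral>x. ruelle \<nu> f (\<lambda>x. \<eta> x * \<psi> x) x \<partial>\<mu>)\<bar> \<le> C1 * t\<^sup>2"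
    using near_gibbs_ker_expansion[OF assms] by blast
  have \<psi>L: "\<psi> \<in> Lip" using \<psi> by (simp add: ruelle_ker_def)
  define h where "h = ruelle \<nu> f (\<lambda>x. \<eta> x * \<psi> x)"
  have h: "h \<in> Lip" unfolding h_def by (intro ruelle_Lip Lip_mult normalizedD(1)[OF f] \<eta> \<psi>L)
  obtain P where P: "\<And>x. \<bar>h x\<bar> \<le> P" using Lip_bounded[OF h] by blast
  have P0: "0 \<le> P" using P[of undefined] by linarith
  show thesis
  proof (rule that[of "P + C1"])
    show "0 \<le> P + C1" using P0 C1(1) by simp
    fix t \<mu> assume t: "\<bar>t\<bar> \<le> 1" and ng: "near_gibbs f \<eta> C t \<mu>"
    then have \<mu>: "borel_prob \<mu>" by (simp add: near_gibbs_def)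
    interpret \<mu>: prob_space \<mu> using \<mu> by (simp add: borel_prob_def)
    have "\<bar>\<integral>x. h x \<partial>\<mu>\<bar> \<le> (\<integral>x. \<bar>h x\<bar> \<partial>\<mu>)" by (rule integral_abs_bound)
    also have "\<dots> \<le> (\<integral>x. P \<partial>\<mu>)"
      by (intro integral_mono integrable_abs Lip_integrable[OF \<mu>] h Lip_const P)
    finally have "\<bar>\<integral>x. h x \<partial>\<mu>\<bar> \<le> P" by (simp add: \<mu>.prob_space)
    then have "\<bar>t * (\<integral>x. h x \<partial>\<mu>)\<bar> \<le> \<bar>t\<bar> * P"
      unfolding abs_mult by (intro mult_left_mono) auto
    moreover have "C1 * t\<^sup>2 \<le> C1 * \<bar>t\<bar>"
    proof -
      have "\<bar>t\<bar> * \<bar>t\<bar> \<le> \<bar>t\<bar> * 1" using t by (intro mult_left_mono) auto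
      then show ?thesis using C1(1) by (intro mult_left_mono) (auto simp: power2_eq_square)
    qed
    moreover have "\<bar>(\<integral>x. \<psi> x \<partial>\<mu>) - t * (\<integral>x. h x \<partial>\<mu>)\<bar> \<le> C1 * t\<^sup>2"
      using C1(2)[OF t ng] by (simp add: h_def)
    ultimately have "\<bar>\<integral>x. \<psi> x \<partial>\<mu>\<bar> \<le> \<bar>t\<bar> * P + C1 * \<bar>t\<bar>" by linarith
    then show "\<bar>\<integral>x. \<psi> x \<partial>\<mu>\<bar> \<le> (P + C1) * \<bar>t\<bar>" by (simp add: algebra_simps)
  qed
qed

text \<open>In the decomposition of \<open>h\<close> the coboundary integrates to zero and the
  constant to itself under every Gibbs probability. Only the kernel part moves, and it is of first
  order.\<close>

lemma near_gibbs_Lip_continuous: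
  assumes f: "f \<in> normalized \<nu>" and \<eta>: "\<eta> \<in> Lip" and C: "0 \<le> C" and h: "h \<in> Lip"
  obtains C' where "0 \<le> C'" "\<And>t \<mu>. \<bar>t\<bar> \<le> 1 \<Longrightarrow> near_gibbs f \<eta> C t \<mu> \<Longrightarrow>
    \<bar>(\<integral>x. h x \<partial>\<mu>) - (\<integral>x. h x \<partial>gibbs \<nu> f)\<bar> \<le> C' * \<bar>t\<bar>"
proof -
  obtain \<zeta> v c where dec: "\<zeta> \<in> ruelle_ker \<nu> f" "v \<in> Lip" "h = (\<lambda>x. \<zeta> x + (v x - v (shift_map x)) + c)"
    using ruelle_ker_decomposition[OF f h] by blast
  have \<zeta>: "\<zeta> \<in> Lip" using dec(1) by (simp add: ruelle_ker_def)
  note g = gibbs_normalized[OF f]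
  have c: "(\<integral>x. h x \<partial>gibbs \<nu> f) = c"
    unfolding dec(3) integral_coboundary[OF f g \<zeta> dec(2)] integral_ruelle_ker[OF g(2) dec(1)] by simp
  obtain C' where C': "0 \<le> C'"
    "\<And>t \<mu>. \<bar>t\<bar> \<le> 1 \<Longrightarrow> near_gibbs f \<eta> C t \<mu> \<Longrightarrow> \<bar>\<integral>x. \<zeta> x \<partial>\<mu>\<bar> \<le> C' * \<bar>t\<bar>"
    using near_gibbs_ker_small[OF f \<eta> C dec(1)] by blast
  show thesis
  proof (rule that[OF C'(1)])
    fix t \<mu> assume t: "\<bar>t\<bar> \<le> 1" and ng: "near_gibbs f \<eta> C t \<mu>"
    then obtain N where N: "borel_prob \<mu>" "N \<in> normalized \<nu>" "ruelle_dual_eigen \<nu> N 1 \<mu>"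
      by (auto simp: near_gibbs_def)
    have "(\<integral>x. h x \<partial>\<mu>) = (\<integral>x. \<zeta> x \<partial>\<mu>) + c"
      unfolding dec(3) by (rule integral_coboundary[OF N(2,1,3) \<zeta> dec(2)])
    then show "\<bar>(\<integral>x. h x \<partial>\<mu>) - (\<integral>x. h x \<partial>gibbs \<nu> f)\<bar> \<le> C' * \<bar>t\<bar>"
      using C'(2)[OF t ng] by (simp add: c)
  qed
qed

text \<open>The coefficient in the expansion is still an integral under the moving probability, of a
  function that need not lie in the kernel. Continuity replaces that probability by the Gibbs
  probability of \<open>f\<close> at the cost of another t^2, and duality then removes the
  operator.\<close>

lemma near_gibbs_ker_derivative:
  assumes f: "f \<in> normalized \<nu>" and \<eta>: "\<eta> \<in> Lip" and C: "0 \<le> C" and \<psi>: "\<psi> \<in> ruelle_ker \<nu> f"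
  obtains C' where "0 \<le> C'" "\<And>t \<mu>. \<bar>t\<bar> \<le> 1 \<Longrightarrow> near_gibbs f \<eta> C t \<mu> \<Longrightarrow>
    \<bar>(\<integral>x. \<psi> x \<partial>\<mu>) - t * (\<integral>x. \<psi> x * \<eta> x \<partial>gibbs \<nu> f)\<bar> \<le> C' * t\<^sup>2"
proof -
  have \<psi>L: "\<psi> \<in> Lip" using \<psi> by (simp add: ruelle_ker_def)
  have L: "(\<lambda>x. \<eta> x * \<psi> x) \<in> Lip" by (intro Lip_mult \<eta> \<psi>L)
  define h where "h = ruelle \<nu> f (\<lambda>x. \<eta> x * \<psi> x)"
  have h: "h \<in> Lip" unfolding h_def by (intro ruelle_Lip L normalizedD(1)[OF f])
  have h_gibbs: "(\<integral>x. h x \<partial>gibbs \<nu> f) = (\<integral>x. \<psi> x * \<eta> x \<partial>gibbs \<nu> f)"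
    using bspec[OF gibbs_normalized(2)[OF f, unfolded ruelle_dual_eigen_def] L]
    by (simp add: h_def mult.commute)
  obtain C1 where C1: "0 \<le> C1" "\<And>t \<mu>. \<bar>t\<bar> \<le> 1 \<Longrightarrow> near_gibbs f \<eta> C t \<mu> \<Longrightarrow>
      \<bar>(\<integral>x. \<psi> x \<partial>\<mu>) - t * (\<integral>x. ruelle \<nu> f (\<lambda>x. \<eta> x * \<psi> x) x \<partial>\<mu>)\<bar> \<le> C1 * t\<^sup>2"
    using near_gibbs_ker_expansion[OF assms] by blast
  obtain C2 where C2: "0 \<le> C2" "\<And>t \<mu>. \<bar>t\<bar> \<le> 1 \<Longrightarrow> near_gibbs f \<eta> C t \<mu> \<Longrightarrow>
      \<bar>(\<integral>x. h x \<partial>\<mu>) - (\<integral>x. h x \<partial>gibbs \<nu> f)\<bar> \<le> C2 * \<bar>t\<bar>"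
    using near_gibbs_Lip_continuous[OF f \<eta> C h] by blast
  show thesis
  proof (rule that[of "C1 + C2"])
    show "0 \<le> C1 + C2" using C1 C2 by simp
    fix t \<mu> assume t: "\<bar>t\<bar> \<le> 1" and ng: "near_gibbs f \<eta> C t \<mu>"
    let ?I = "\<integral>x. h x \<partial>\<mu>" and ?J = "\<integral>x. \<psi> x * \<eta> x \<partial>gibbs \<nu> f"
    have "\<bar>t * ?I - t * ?J\<bar> \<le> \<bar>t\<bar> * (C2 * \<bar>t\<bar>)"
      unfolding right_diff_distrib[symmetric] abs_mult h_gibbs[symmetric]
      by (intro mult_left_mono C2(2)[OF t ng]) simp
    also have "\<dots> = C2 * t\<^sup>2" by (simp add: power2_eq_square)
    finally have "\<bar>t * ?I - t * ?J\<bar> \<le> C2 * t\<^sup>2" .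
    moreover have "\<bar>(\<integral>x. \<psi> x \<partial>\<mu>) - t * ?I\<bar> \<le> C1 * t\<^sup>2"
      using C1(2)[OF t ng] by (simp add: h_def)
    ultimately show "\<bar>(\<integral>x. \<psi> x \<partial>\<mu>) - t * ?J\<bar> \<le> (C1 + C2) * t\<^sup>2"
      unfolding distrib_right by linarith
  qed
qed

section \<open>From quadratic error bounds to the derivative\<close>

lemma has_real_derivative_quadratic_error:
  fixes G :: "real \<Rightarrow> real"
  assumes "\<And>t. \<bar>t\<bar> \<le> 1 \<Longrightarrow> \<bar>G t - G 0 - t * d\<bar> \<le> C * t\<^sup>2"
  shows "(G has_real_derivative d) (at 0)"
  unfolding has_field_derivative_iff
proof (rule LIM_zero_cancel, rule Lim_null_comparison)
  show "\<forall>\<^sub>F t in at 0. norm ((G t - G 0) / (t - 0) - d) \<le> C * \<bar>t\<bar>"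
    unfolding eventually_at
  proof (intro exI[of _ 1] conjI ballI impI)
    fix t :: real assume t: "t \<noteq> 0 \<and> dist t 0 < 1"
    then have "\<bar>G t - G 0 - t * d\<bar> \<le> C * t\<^sup>2" by (intro assms) simp
    then have "\<bar>G t - G 0 - t * d\<bar> / \<bar>t\<bar> \<le> C * t\<^sup>2 / \<bar>t\<bar>" by (intro divide_right_mono) auto
    moreover have "C * t\<^sup>2 / \<bar>t\<bar> = C * \<bar>t\<bar>"
      using t by (cases "t > 0") (auto simp: power2_eq_square)
    moreover have "(G t - G 0) / (t - 0) - d = (G t - G 0 - t * d) / t"
      using t by (simp add: field_simps)
    ultimately show "norm ((G t - G 0) / (t - 0) - d) \<le> C * \<bar>t\<bar>" by simp
  qed simp
  have "((\<lambda>t. C * \<bar>t\<bar>) \<longlongrightarrow> C * \<bar>0\<bar>) (at (0 :: real))"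
    by (intro tendsto_intros)
  then show "((\<lambda>t. C * \<bar>t\<bar>) \<longlongrightarrow> 0) (at (0 :: real))" by simp
qed

lemma pressure_functional_derivative:
  assumes f: "f \<in> normalized \<nu>" and g: "g \<in> Lip"
    and \<zeta>: "\<zeta> \<in> ruelle_ker \<nu> f" and \<eta>: "\<eta> \<in> ruelle_ker \<nu> f" and \<xi>: "\<xi> \<in> ruelle_ker \<nu> f"
    and u: "u \<in> Lip" and v: "v \<in> Lip" and w: "w \<in> Lip"
    and f_eq: "f = (\<lambda>x. \<zeta> x + (u x - u (shift_map x)) + c)"
    and g_eq: "g = (\<lambda>x. \<eta> x + (v x - v (shift_map x)))"
    and \<phi>_eq: "\<phi> = (\<lambda>x. \<xi> x + (w x - w (shift_map x)) + k)"
  shows "((\<lambda>t. gibbs_entropy \<nu> (\<lambda>x. f x + t * g x) + (\<integral>x. \<phi> x \<partial>gibbs \<nu> (\<lambda>x. f x + t * g x)))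
    has_real_derivative (\<integral>x. (\<xi> x - \<zeta> x) * \<eta> x \<partial>gibbs \<nu> f)) (at 0)"
proof -
  note fL = normalizedD(1)[OF f]
  have \<zeta>L: "\<zeta> \<in> Lip" and \<eta>L: "\<eta> \<in> Lip" and \<xi>L: "\<xi> \<in> Lip"
    using \<zeta> \<eta> \<xi> by (auto simp: ruelle_ker_def)
  define \<psi> where "\<psi> = (\<lambda>x. \<xi> x - \<zeta> x)"
  have \<psi>L: "\<psi> \<in> Lip" unfolding \<psi>_def by (intro Lip_diff \<xi>L \<zeta>L)
  have \<psi>: "\<psi> \<in> ruelle_ker \<nu> f"
    using \<zeta> \<xi> \<psi>L ruelle_diff[OF fL \<xi>L \<zeta>L] by (simp add: ruelle_ker_def fun_eq_iff \<psi>_def)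
  obtain C where C: "0 \<le> C" "\<And>t. \<bar>t\<bar> \<le> 1 \<Longrightarrow> \<exists>N q \<kappa>. N \<in> normalized \<nu> \<and> q \<in> Lip \<and>
      (\<forall>x. N x = f x + t * \<eta> x + q x - q (shift_map x) - \<kappa>) \<and>
      (\<forall>x. \<bar>N x - f x - t * \<eta> x\<bar> \<le> C * t\<^sup>2)"
    using perturbed_normalization[OF f \<eta>] by blast
  obtain C1 where C1: "0 \<le> C1" "\<And>t \<mu>. \<bar>t\<bar> \<le> 1 \<Longrightarrow> near_gibbs f \<eta> C t \<mu> \<Longrightarrow>
      \<bar>(\<integral>x. \<psi> x \<partial>\<mu>) - t * (\<integral>x. \<psi> x * \<eta> x \<partial>gibbs \<nu> f)\<bar> \<le> C1 * t\<^sup>2"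
    using near_gibbs_ker_derivative[OF f \<eta>L C(1) \<psi>] by blast
  obtain C2 where C2: "0 \<le> C2"
      "\<And>t \<mu>. \<bar>t\<bar> \<le> 1 \<Longrightarrow> near_gibbs f \<eta> C t \<mu> \<Longrightarrow> \<bar>\<integral>x. \<eta> x \<partial>\<mu>\<bar> \<le> C2 * \<bar>t\<bar>"
    using near_gibbs_ker_small[OF f \<eta>L C(1) \<eta>] by blast
  define G where "G = (\<lambda>t. gibbs_entropy \<nu> (\<lambda>x. f x + t * g x) + (\<integral>x. \<phi> x \<partial>gibbs \<nu> (\<lambda>x. f x + t * g x)))"
  define d where "d = (\<integral>x. \<psi> x * \<eta> x \<partial>gibbs \<nu> f)"
  \<comment> \<open>The value of the functional at \<open>t = 0\<close> is \<open>k - c\<close>; the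
    instance \<open>t = 0\<close> of this bound yields it.\<close>
  have G: "\<bar>G t - (k - c) - t * d\<bar> \<le> (C + C1 + C2) * t\<^sup>2" if t: "\<bar>t\<bar> \<le> 1" for t
  proof -
    obtain N q \<kappa> where N: "N \<in> normalized \<nu>" and q: "q \<in> Lip"
      and N_eq: "\<And>x. N x = f x + t * \<eta> x + q x - q (shift_map x) - \<kappa>"
      and close: "\<And>x. \<bar>N x - f x - t * \<eta> x\<bar> \<le> C * t\<^sup>2"
      using C(2)[OF t] by blast
    define ft where "ft = (\<lambda>x. f x + t * g x)"
    have ftL: "ft \<in> Lip" unfolding ft_def by (intro Lip_add fL Lip_cmult g)
    \<comment> \<open>Subtracting \<open>t * v\<close> cancels the coboundary part of
      \<open>t * g\<close>, so the potential \<open>N\<close> built for direction \<eta> is also the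
      normalization of \<open>f + t * g\<close>.\<close>
    have rL: "(\<lambda>x. q x - t * v x) \<in> Lip" by (intro Lip_diff q Lip_cmult v)
    have N_eq': "N x = ft x + (q x - t * v x) - (q (shift_map x) - t * v (shift_map x)) - \<kappa>" for x
      by (simp add: N_eq ft_def g_eq algebra_simps)
    define \<mu> where "\<mu> = gibbs \<nu> ft"
    have \<mu>: "borel_prob \<mu>" "ruelle_dual_eigen \<nu> N 1 \<mu>"
      unfolding \<mu>_def using gibbs[OF ftL N rL N_eq'] by auto
    interpret \<mu>: prob_space \<mu> using \<mu> by (simp add: borel_prob_def)
    have ng: "near_gibbs f \<eta> C t \<mu>"
      using \<mu> N close by (auto simp: near_gibbs_def)
    define e where "e = (\<lambda>x. N x - f x - t * \<eta> x)"
    have eL: "e \<in> Lip" unfolding e_def by (intro Lip_diff fL Lip_cmult \<eta>L normalizedD(1)[OF N])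
    note int = Lip_integrable[OF \<mu>(1)]
    have "G t = - (\<integral>x. N x \<partial>\<mu>) + (\<integral>x. \<phi> x \<partial>\<mu>)"
      unfolding G_def gibbs_entropy_def ft_def[symmetric] normalization_eq[OF ftL N rL N_eq'] \<mu>_def ..
    also have "(\<integral>x. N x \<partial>\<mu>) = (\<integral>x. f x \<partial>\<mu>) + t * (\<integral>x. \<eta> x \<partial>\<mu>) + (\<integral>x. e x \<partial>\<mu>)"
    proof -
      have "(\<integral>x. N x \<partial>\<mu>) = (\<integral>x. f x + t * \<eta> x + e x \<partial>\<mu>)" by (simp add: e_def)
      then show ?thesis
        using int[OF fL] int[OF \<eta>L] int[OF eL] by simp
    qed
    also have "(\<integral>x. f x \<partial>\<mu>) = (\<integral>x. \<zeta> x \<partial>\<mu>) + c"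
      unfolding f_eq by (rule integral_coboundary[OF N \<mu> \<zeta>L u])
    also have "(\<integral>x. \<phi> x \<partial>\<mu>) = (\<integral>x. \<xi> x \<partial>\<mu>) + k"
      unfolding \<phi>_eq by (rule integral_coboundary[OF N \<mu> \<xi>L w])
    finally have "G t - (k - c) - t * d
        = ((\<integral>x. \<psi> x \<partial>\<mu>) - t * d) - t * (\<integral>x. \<eta> x \<partial>\<mu>) - (\<integral>x. e x \<partial>\<mu>)"
      using int[OF \<xi>L] int[OF \<zeta>L] by (simp add: \<psi>_def)
    moreover have "\<bar>(\<integral>x. \<psi> x \<partial>\<mu>) - t * d\<bar> \<le> C1 * t\<^sup>2"
      unfolding d_def by (rule C1(2)[OF t ng])
    moreover have "\<bar>t * (\<integral>x. \<eta> x \<partial>\<mu>)\<bar> \<le> C2 * t\<^sup>2"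
    proof -
      have "\<bar>t * (\<integral>x. \<eta> x \<partial>\<mu>)\<bar> \<le> \<bar>t\<bar> * (C2 * \<bar>t\<bar>)"
        unfolding abs_mult by (intro mult_left_mono C2(2)[OF t ng]) simp
      also have "\<dots> = C2 * t\<^sup>2" by (simp add: power2_eq_square)
      finally show ?thesis .
    qed
    moreover have "\<bar>\<integral>x. e x \<partial>\<mu>\<bar> \<le> C * t\<^sup>2"
    proof -
      have "\<bar>\<integral>x. e x \<partial>\<mu>\<bar> \<le> (\<integral>x. \<bar>e x\<bar> \<partial>\<mu>)" by (rule integral_abs_bound)
      also have "\<dots> \<le> (\<integral>x. C * t\<^sup>2 \<partial>\<mu>)"
        by (intro integral_mono integrable_abs int eL Lip_const) (simp add: e_def close)
      finally show ?thesis by (simp add: \<mu>.prob_space)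
    qed
    ultimately show ?thesis
      unfolding distrib_right by linarith
  qed
  have "\<bar>G t - G 0 - t * d\<bar> \<le> (C + C1 + C2) * t\<^sup>2" if "\<bar>t\<bar> \<le> 1" for t
    using G[OF that] G[of 0] by simp
  then have "(G has_real_derivative d) (at 0)"
    by (rule has_real_derivative_quadratic_error)
  then show ?thesis by (simp add: G_def d_def \<psi>_def)
qed

end

theorem theorem25:
  fixes \<nu> :: "'a::metric_space measure"
    and \<phi> B f :: "(nat \<Rightarrow> 'a) \<Rightarrow> real"
  assumes "compact (UNIV :: 'a set)" and "diameter (UNIV :: 'a set) = 1"
    and "borel_prob \<nu>" and "measure_support \<nu> = UNIV"
    and "\<phi> \<in> Lip"
    and "B \<in> normalized \<nu>"
    and "equilibrium \<nu> \<phi> (gibbs \<nu> B)"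
    and "\<And>\<mu>. equilibrium \<nu> \<phi> \<mu> \<Longrightarrow> \<mu> = gibbs \<nu> B"
    and "f \<in> normalized \<nu>"
    and "gibbs \<nu> f \<noteq> gibbs \<nu> B"
  shows "(\<forall>g\<in>Lip. \<forall>\<zeta>\<in>ruelle_ker \<nu> f. \<forall>\<eta>\<in>ruelle_ker \<nu> f. \<forall>\<xi>\<in>ruelle_ker \<nu> f.
            \<forall>u\<in>Lip. \<forall>v\<in>Lip. \<forall>w\<in>Lip. \<forall>c k :: real.
            (\<integral>x. g x \<partial>gibbs \<nu> f) = 0 \<longrightarrow>
            f = (\<lambda>x. \<zeta> x + (u x - u (shift_map x)) + c) \<longrightarrow>
            g = (\<lambda>x. \<eta> x + (v x - v (shift_map x))) \<longrightarrow>
            \<phi> = (\<lambda>x. \<xi> x + (w x - w (shift_map x)) + k) \<longrightarrow>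
            ((\<lambda>t. gibbs_entropy \<nu> (\<lambda>x. f x + t * g x)
                    + (\<integral>x. \<phi> x \<partial>gibbs \<nu> (\<lambda>x. f x + t * g x)))
              has_real_derivative (\<integral>x. (\<xi> x - \<zeta> x) * \<eta> x \<partial>gibbs \<nu> f)) (at 0))
       \<and> ((\<forall>\<eta>\<in>ruelle_ker \<nu> f.
              ((\<lambda>t. gibbs_entropy \<nu> (\<lambda>x. f x + t * \<eta> x)
                      + (\<integral>x. \<phi> x \<partial>gibbs \<nu> (\<lambda>x. f x + t * \<eta> x)))
                has_real_derivative 0) (at 0))
          \<longrightarrow>
          (\<forall>g\<in>Lip. (\<integral>x. g x \<partial>gibbs \<nu> f) = 0 \<longrightarrow>
              ((\<lambda>t. gibbs_entropy \<nu> (\<lambda>x. f x + t * g x)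
                      + (\<integral>x. \<phi> x \<partial>gibbs \<nu> (\<lambda>x. f x + t * g x)))
                has_real_derivative 0) (at 0)))"
proof -
  have "dist a b \<le> 1" for a b :: 'a
    using diameter_bounded_bound[OF compact_imp_bounded[OF assms(1)], of a b] assms(2) by simp
  then interpret full_shift \<nu>
    by (intro full_shift.intro assms(1,3))
  note f = assms(9) and \<phi> = assms(5)
  show ?thesis
  proof (intro conjI ballI allI impI)
    fix g :: "(nat \<Rightarrow> 'a) \<Rightarrow> real"
    assume ker: "\<forall>\<eta>\<in>ruelle_ker \<nu> f.
        ((\<lambda>t. gibbs_entropy \<nu> (\<lambda>x. f x + t * \<eta> x) + (\<integral>x. \<phi> x \<partial>gibbs \<nu> (\<lambda>x. f x + t * \<eta> x)))
          has_real_derivative 0) (at 0)"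
      and g: "g \<in> Lip" "(\<integral>x. g x \<partial>gibbs \<nu> f) = 0"
    obtain \<zeta> u c where \<zeta>: "\<zeta> \<in> ruelle_ker \<nu> f" "u \<in> Lip"
      "f = (\<lambda>x. \<zeta> x + (u x - u (shift_map x)) + c)"
      using ruelle_ker_decomposition[OF f normalizedD(1)[OF f]] by metis
    obtain \<xi> w k where \<xi>: "\<xi> \<in> ruelle_ker \<nu> f" "w \<in> Lip"
      "\<phi> = (\<lambda>x. \<xi> x + (w x - w (shift_map x)) + k)"
      using ruelle_ker_decomposition[OF f \<phi>] by metis
    obtain \<eta> v b where \<eta>: "\<eta> \<in> ruelle_ker \<nu> f" "v \<in> Lip"
      "g = (\<lambda>x. \<eta> x + (v x - v (shift_map x)) + b)"
      using ruelle_ker_decomposition[OF f g(1)] by metis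
    have \<eta>L: "\<eta> \<in> Lip" using \<eta>(1) by (simp add: ruelle_ker_def)
    \<comment> \<open>The decomposition leaves a constant, which equals the integral of
      \<open>g\<close> because \<eta> and the coboundary integrate to zero.\<close>
    have "b = 0"
      using g(2) integral_coboundary[OF f gibbs_normalized[OF f] \<eta>L \<eta>(2), of b]
        integral_ruelle_ker[OF gibbs_normalized(2)[OF f] \<eta>(1)]
      by (simp add: \<eta>(3))
    then have g_eq: "g = (\<lambda>x. \<eta> x + (v x - v (shift_map x)))" using \<eta>(3) by simp
    \<comment> \<open>The directions \<open>g\<close> and \<eta> have the same kernel part, hence
      the same derivative; the formula is applied to \<eta> with \<open>v = 0\<close> and compared
      with the assumed value 0.\<close>
    have "((\<lambda>t. gibbs_entropy \<nu> (\<lambda>x. f x + t * \<eta> x) + (\<integral>x. \<phi> x \<partial>gibbs \<nu> (\<lambda>x. f x + t * \<eta> x)))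
        has_real_derivative (\<integral>x. (\<xi> x - \<zeta> x) * \<eta> x \<partial>gibbs \<nu> f)) (at 0)"
      by (rule pressure_functional_derivative[OF f \<eta>L \<zeta>(1) \<eta>(1) \<xi>(1) \<zeta>(2) Lip_const[of 0] \<xi>(2) \<zeta>(3) _ \<xi>(3)])
         simp
    with bspec[OF ker \<eta>(1)] have "(\<integral>x. (\<xi> x - \<zeta> x) * \<eta> x \<partial>gibbs \<nu> f) = 0"
      by (rule DERIV_unique[symmetric])
    with pressure_functional_derivative[OF f g(1) \<zeta>(1) \<eta>(1) \<xi>(1) \<zeta>(2) \<eta>(2) \<xi>(2) \<zeta>(3) g_eq \<xi>(3)]
    show "((\<lambda>t. gibbs_entropy \<nu> (\<lambda>x. f x + t * g x) + (\<integral>x. \<phi> x \<partial>gibbs \<nu> (\<lambda>x. f x + t * g x)))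
        has_real_derivative 0) (at 0)"
      by simp
  qed (rule pressure_functional_derivative[OF f])
qed

end
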